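(* Let $a,b,x,y,z,t$ be non-negative integers and let $Q=Q_{a,b}(x,y,z,t)$ be the region defined in the context. Let \[E=(y+b)\tbinom{z+1}{2}+x\tbinom{a+z+1}{2}+b(x+y)(a+y+z)+(x+y)\tbinom{b+1}{2}\] and \begin{align*} P=&\frac{\operatorname{H}_q(x)\operatorname{H}_q(y)\operatorname{H}_q(z)\operatorname{H}_q(t)\operatorname{H}_q(a)\operatorname{H}_q(b)}{\operatorname{H}_q(a+x)\operatorname{H}_q(b+t)\operatorname{H}_q(a+b+y)} \times\frac{\operatorname{H}_q(a+b+x+2y+z+t)\operatorname{H}_q(a+b+x+y+t)}{\operatorname{H}_q(a+b+y+z+t)\operatorname{H}_q(a+b+x+2y+t)\operatorname{H}_q(a+b+x+y+z)}\\ &\times \frac{\operatorname{H}_q(a+x+y)\operatorname{H}_q(b+y+t)\operatorname{H}_q(a+b+y+z)^2}{\operatorname{H}_q(x+y+t)\operatorname{H}_q(a+y+z)\operatorname{H}_q(b+y+z)}. \end{align*} Then \[q^{E}\sum_{T}q^{|\pi_T|}=\operatorname{M}_2(Q)=q^{E}P,\] where the sum is over all lozenge tilings $T$ of $Q$ (equivalently over all piles $\pi_T$ fitting in the compound box associated with $Q$).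
   Context: Triangular lattice drawn with one family of lattice lines horizontal; a lozenge is a union of two unit triangles sharing an edge; lozenge tilings cover a region without gaps or overlaps. Hexagon sides are listed clockwise NW, N, NE, SE, S, SW, with N and S horizontal. A right lozenge has two horizontal sides and the other two parallel to the NW side ("/"); left lozenges have two horizontal sides and the other two parallel to the NE side; vertical lozenges have no horizontal side. The region $Q_{a,b}(x,y,z,t)$: take the hexagon with sides NW $z+a+b$, N $x+y$, NE $y+t+a+b$, SE $z$, S $x+y+a+b$, SW $y+t$. Remove the equilateral triangle of side $b$ lying in the hexagon and having as one side the segment of the NE side whose upper endpoint is at distance $t$ from the N/NE corner (the remaining part of the NE side below it has length $y+a$); and remove the up-pointing triangle of side $a$ whose base is the segment of the S side whose left endpoint is at distance $x$ from the SW/S corner (the part to its right has length $y+b$). (The left sides of the two removed triangles lie on a common lattice line.) $\operatorname{M}_2(Q)$ is the sum over tilings of $Q$ of the product of lozenge weights, where each right lozenge gets weight $q^{k}$, $k$ being the distance (in lattice rows) between the horizontal line containing its top side and the line containing the S side of $Q$, and left and vertical lozenges get weight 1. Volume: each tiling $T$ is viewed in the standard way as a pile $\pi_T$ of unit cubes in a compound box of four rectangular boxes (right lozenges being tops of columns, with the same monotonicity as plane partitions); $|\pi_T|$ is the number of cubes, the empty pile having volume $0$. Equivalently $|\pi_T|=\kappa(T)-\min_{T'}\kappa(T')$ with $\kappa(T)=\sum k(\ell)$ over right lozenges $\ell$ of $T$. $q$-notation: $[n]_q=1+q+\dots+q^{n-1}$, $[n]_q!=[1]_q\cdots[n]_q$,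 $[0]_q!=1$, $\operatorname{H}_q(n)=[0]_q![1]_q!\cdots[n-1]_q!$. *)

theory Defs
  imports Complex_Main
begin

text \<open>
  Lattice points are written in the basis \<open>e\<^sub>1\<close> = unit step east, \<open>e\<^sub>2\<close> = unit step in direction
  ``/'' (north-east). So \<open>j\<close> is the row (height) of the point \<open>(i, j)\<close>, lines \<open>i = const\<close> have
  direction ``/'' and lines \<open>i + j = const\<close> have direction ``\ ''.
\<close>

type_synonym point = "int \<times> int"

datatype unit_triangle = Up int int | Down int int

fun vertices :: "unit_triangle \<Rightarrow> point set" where
  "vertices (Up i j) = {(i, j), (i + 1, j), (i, j + 1)}"
| "vertices (Down i j) = {(i + 1, j), (i, j + 1), (i + 1, j + 1)}"

text \<open>
  The two unit triangles of a right, left or vertical lozenge share an edge of direction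
  ``\ '', ``/'' or horizontal, respectively.
\<close>

datatype lozenge = Right_Loz int int | Left_Loz int int | Vertical_Loz int int

fun cells :: "lozenge \<Rightarrow> unit_triangle set" where
  "cells (Right_Loz i j) = {Up i j, Down i j}"
| "cells (Left_Loz i j) = {Up i j, Down (i - 1) j}"
| "cells (Vertical_Loz i j) = {Up i j, Down i (j - 1)}"

type_synonym region = "unit_triangle set"

definition triangles_in :: "point set \<Rightarrow> region" where
  "triangles_in S = {\<tau>. vertices \<tau> \<subseteq> S}"

definition tilings :: "region \<Rightarrow> lozenge set set" where
  "tilings R = {T. (\<Union>L\<in>T. cells L) = R \<and> pairwise (\<lambda>L L'. disjnt (cells L) (cells L')) T}"

text \<open>
  Hexagon with NW, SE, S, SW sides of the given lengths and SW/S corner at the origin. Clockwise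
  from there its corners are \<open>(0, 0)\<close>, \<open>(-sw, sw)\<close>, \<open>(-sw, sw + nw)\<close>,
  \<open>(s + se - sw - nw, sw + nw)\<close>, \<open>(s, se)\<close>, \<open>(s, 0)\<close>; in particular the N side has length
  \<open>s + se - nw\<close> and the NE side has length \<open>sw + nw - se\<close>.
\<close>

definition hexagon :: "int \<Rightarrow> int \<Rightarrow> int \<Rightarrow> int \<Rightarrow> point set" where
  "hexagon nw se s sw =
     {(i, j). - sw \<le> i \<and> i \<le> s \<and> 0 \<le> j \<and> j \<le> sw + nw \<and> 0 \<le> i + j \<and> i + j \<le> s + se}"

definition up_triangle :: "point \<Rightarrow> int \<Rightarrow> point set" where
  "up_triangle = (\<lambda>(i\<^sub>0, j\<^sub>0) n. {(i, j). i\<^sub>0 \<le> i \<and> j\<^sub>0 \<le> j \<and> i + j \<le> i\<^sub>0 + j\<^sub>0 + n})"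

text \<open>
  The N/NE corner of the hexagon is \<open>(x - t, a + b + y + z + t)\<close>, so the segment of the NE side
  whose upper end is at distance \<open>t\<close> from it runs from \<open>(x, a + b + y + z)\<close> to
  \<open>(x + b, a + y + z)\<close>; the equilateral triangle inside the hexagon on this segment points up and
  has lower left corner \<open>(x, a + y + z)\<close>. With \<open>nw = z + a + b\<close>, \<open>se = z\<close>, \<open>s = x + y + a + b\<close>
  and \<open>sw = y + t\<close> the N and NE sides have lengths \<open>x + y\<close> and \<open>y + t + a + b\<close>.
\<close>

definition Q_region :: "nat \<Rightarrow> nat \<Rightarrow> nat \<Rightarrow> nat \<Rightarrow> nat \<Rightarrow> nat \<Rightarrow> region" where
  "Q_region a b x y z t =
     triangles_in (hexagon (int (z + a + b)) (int z) (int (x + y + a + b)) (int (y + t)))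
     - triangles_in (up_triangle (int x, int (a + y + z)) (int b))
     - triangles_in (up_triangle (int x, 0) (int a))"

text \<open>The S side of the regions lies on the line \<open>j = 0\<close>.\<close>

fun weight :: "'a::field \<Rightarrow> lozenge \<Rightarrow> 'a" where
  "weight q (Right_Loz i j) = q ^ nat (j + 1)"
| "weight q (Left_Loz i j) = 1"
| "weight q (Vertical_Loz i j) = 1"

definition M2 :: "'a::field \<Rightarrow> region \<Rightarrow> 'a" where
  "M2 q R = (\<Sum>T\<in>tilings R. \<Prod>L\<in>T. weight q L)"

text \<open>
  Three-dimensional reading of a tiling. Right lozenges are the tops of columns, and raising a
  column by one unit cube moves its top one step along a ``\ '' line, from \<open>(i, j)\<close> to
  \<open>(i - 1, j + 1)\<close>. All columns whose tops lie on the same line \<open>i + j = d\<close> are one behind the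
  other; because of the plane partition monotonicity, the column number \<open>m = 0, 1, \<dots>\<close> (from the
  back) has the \<open>m\<close>-th highest right lozenge on that line as its top. The triple \<open>(d, m, k)\<close> is
  the unit cube of column \<open>m\<close> over line \<open>d\<close> whose top face is seen at height \<open>k\<close> above the
  S side; it lies below the surface of \<open>T\<close> iff more than \<open>m\<close> right lozenges on the line have their
  top side at height \<open>k\<close> or more.

  The columns of \<open>solid T\<close> are continued down to height \<open>0\<close>. The part of them lying below the
  surface of every tiling is what is under the floor of the compound box; the pile consists of the
  remaining cubes.
\<close>

definition solid :: "lozenge set \<Rightarrow> (int \<times> nat \<times> nat) set" where
  "solid T = {(d, m, k). 1 \<le> k \<and>
     m < card {(i, j). Right_Loz i j \<in> T \<and> i + j = d \<and> int k \<le> j + 1}}"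

definition pile :: "region \<Rightarrow> lozenge set \<Rightarrow> (int \<times> nat \<times> nat) set" where
  "pile R T = solid T - (\<Inter>T'\<in>tilings R. solid T')"

definition volume :: "region \<Rightarrow> lozenge set \<Rightarrow> nat" where
  "volume R T = card (pile R T)"

definition q_int :: "'a::field \<Rightarrow> nat \<Rightarrow> 'a" where
  "q_int q n = (\<Sum>i<n. q ^ i)"

definition q_fact :: "'a::field \<Rightarrow> nat \<Rightarrow> 'a" where
  "q_fact q n = (\<Prod>k=1..n. q_int q k)"

definition q_H :: "'a::field \<Rightarrow> nat \<Rightarrow> 'a" where
  "q_H q n = (\<Prod>k<n. q_fact q k)"

definition E_exp :: "nat \<Rightarrow> nat \<Rightarrow> nat \<Rightarrow> nat \<Rightarrow> nat \<Rightarrow> nat" where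
  "E_exp a b x y z =
     (y + b) * ((z + 1) choose 2) + x * ((a + z + 1) choose 2)
     + b * (x + y) * (a + y + z) + (x + y) * ((b + 1) choose 2)"

definition P_prod :: "'a::field \<Rightarrow> nat \<Rightarrow> nat \<Rightarrow> nat \<Rightarrow> nat \<Rightarrow> nat \<Rightarrow> nat \<Rightarrow> 'a" where
  "P_prod q a b x y z t =
     (q_H q x * q_H q y * q_H q z * q_H q t * q_H q a * q_H q b)
       / (q_H q (a + x) * q_H q (b + t) * q_H q (a + b + y))
     * ((q_H q (a + b + x + 2 * y + z + t) * q_H q (a + b + x + y + t))
       / (q_H q (a + b + y + z + t) * q_H q (a + b + x + 2 * y + t) * q_H q (a + b + x + y + z)))
     * ((q_H q (a + x + y) * q_H q (b + y + t) * (q_H q (a + b + y + z))\<^sup>2)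
       / (q_H q (x + y + t) * q_H q (a + y + z) * q_H q (b + y + z)))"

end

theory Submission
  imports Defs "Jordan_Normal_Form.Char_Poly"
begin

text \<open>
  Cut the region along the lattice lines of direction ``/''. A tiling is determined by the sets
  \<open>S\<^sub>c\<close> of heights at which left lozenges cross the lines \<open>i = c\<close>, consecutive sets interlace, and the
  heights of the right lozenges sum up to a constant minus the heights of all left lozenges. The
  weighted number of Gelfand-Tsetlin patterns with a given top row is a \<open>q\<close>-Vandermonde product (sum
  the Vandermonde determinant over one row).

  The line \<open>i = x\<close> carries the left sides of both removed triangles. It splits the region
  into two trapezoids, and \<open>M\<^sub>2\<close> becomes a sum over \<open>y\<close>-subsets \<open>S\<close> of an interval of a product of two
  Vandermonde products. The blocks of forced lozenges next to \<open>S\<close> on the two sides are adjacent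
  intervals, so up to a factor independent of \<open>S\<close> the summand only depends on \<open>a + x\<close> and \<open>b + t\<close>; hence the
  sum reduces to the case \<open>a = b = 0\<close> of a hexagon, whose tilings are counted by a single Vandermonde
  product.

  All this is done for generic \<open>q\<close> and carried over to an arbitrary field as an identity of integer
  polynomials. Tilings form a lattice, so there is one whose pile lies in all others;
  comparing lowest terms, its weight is \<open>q^E\<close>.
\<close>

section \<open>Vandermonde determinants\<close>

text \<open>The generic argument divides by 1 - q^k and needs negative powers of q, because right
  lozenges are weighted through left ones. The theorem only asks that no \<open>q_int q n\<close>
  vanishes, so q = 0 and, in characteristic 0, q = 1 are allowed. The integer polynomial identity
  closes this gap, and it is enough to prove it for real q > 1. Sets of heights are compared through
  \<open>count_ge\<close> rather than by enumeration. Tileability of a strip, interlacing and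
  passage to complements then all become linear inequalities between counting functions, which
  remain usable when forced lozenges are added. In the hexagon the cut can be moved: expanding the
  patterns on one side by one row and summing over the old cut leaves a sum of the same shape over
  the next line. This replaces any appeal to a known q-summation formula. The exponent of q is
  collected term by term as a long sum of cubic polynomials and is compared with
  \<open>E_exp\<close> only at the end.\<close>

lemma newton_expansion:
  fixes x :: "nat \<Rightarrow> 'a::comm_ring_1"
  shows "\<exists>c. c j = 1 \<and> (\<forall>m>j. c m = 0) \<and> (\<forall>t. t ^ j = (\<Sum>m\<le>j. c m * (\<Prod>k<m. t - x k)))"
proof (induction j)
  case 0
  show ?case by (rule exI[of _ "\<lambda>m. if m = 0 then 1 else 0"]) auto
next
  case (Suc j)
  then obtain c where c: "c j = 1" "\<forall>m>j. c m = 0"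
    "\<And>t. t ^ j = (\<Sum>m\<le>j. c m * (\<Prod>k<m. t - x k))" by blast
  \<comment> \<open>Comes from t = (t - x m) + x m: multiplying a Newton product by t gives the next
    Newton product plus x m times the old one.\<close>
  define d where "d m = (if m = 0 then 0 else c (m - 1)) + c m * x m" for m
  have "t ^ Suc j = (\<Sum>m\<le>Suc j. d m * (\<Prod>k<m. t - x k))" for t
  proof -
    have "t ^ Suc j = t * (\<Sum>m\<le>j. c m * (\<Prod>k<m. t - x k))"
      using c(3)[of t] by simp
    also have "\<dots> = (\<Sum>m\<le>j. c m * (\<Prod>k<Suc m. t - x k)) + (\<Sum>m\<le>j. c m * x m * (\<Prod>k<m. t - x k))"
      unfolding sum_distrib_left sum.distrib[symmetric]
      by (rule sum.cong) (auto simp: algebra_simps)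
    also have "(\<Sum>m\<le>j. c m * x m * (\<Prod>k<m. t - x k)) = (\<Sum>m\<le>Suc j. c m * x m * (\<Prod>k<m. t - x k))"
      using c(2) by simp
    also have "(\<Sum>m\<le>j. c m * (\<Prod>k<Suc m. t - x k))
      = (\<Sum>m\<le>Suc j. (if m = 0 then 0 else c (m - 1)) * (\<Prod>k<m. t - x k))"
      by (subst sum.atMost_Suc_shift) simp
    finally show ?thesis
      unfolding d_def by (simp only: sum.distrib[symmetric] algebra_simps)
  qed
  moreover have "d (Suc j) = 1" "\<forall>m>Suc j. d m = 0"
    using c(1,2) by (auto simp: d_def)
  ultimately show ?case by blast
qed

text \<open>Expanding the powers in the Newton basis at the nodes factors the matrix into a lower
  triangular matrix of Newton values and a unit upper triangular matrix of coefficients.\<close>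

lemma det_vandermonde:
  fixes x :: "nat \<Rightarrow> 'a::idom"
  shows "det (mat n n (\<lambda>(i, j). x i ^ j)) = (\<Prod>j<n. \<Prod>i<j. x j - x i)"
proof -
  have "\<forall>j. \<exists>c. c j = 1 \<and> (\<forall>m>j. c m = 0) \<and> (\<forall>t. t ^ j = (\<Sum>m\<le>j. c m * (\<Prod>k<m. t - x k)))"
    using newton_expansion[of _ x] by blast
  then obtain c where c: "\<And>j. c j j = 1" "\<And>j m. m > j \<Longrightarrow> c j m = 0"
    "\<And>j t. t ^ j = (\<Sum>m\<le>j. c j m * (\<Prod>k<m. t - x k))"
    by metis
  \<comment> \<open>Lower triangular, since for m > i the factor k = i vanishes.\<close>
  define A where "A = mat n n (\<lambda>(i, m). \<Prod>k<m. x i - x k)"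
  define B where "B = mat n n (\<lambda>(m, j). c j m)"
  have AB: "A \<in> carrier_mat n n" "B \<in> carrier_mat n n" by (auto simp: A_def B_def)
  have "mat n n (\<lambda>(i, j). x i ^ j) = A * B"
  proof (rule eq_matI)
    fix i j assume ij: "i < dim_row (A * B)" "j < dim_col (A * B)"
    then have ij: "i < n" "j < n" by (auto simp: A_def B_def)
    have "(A * B) $$ (i, j) = (\<Sum>m<n. (\<Prod>k<m. x i - x k) * c j m)"
      using ij by (simp add: A_def B_def scalar_prod_def atLeast0LessThan)
    also have "\<dots> = (\<Sum>m\<le>j. (\<Prod>k<m. x i - x k) * c j m)"
      using ij by (intro sum.mono_neutral_right) (auto simp: c(2))
    also have "\<dots> = x i ^ j" unfolding c(3)[of "x i" j] by (simp add: mult.commute)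
    finally show "mat n n (\<lambda>(i, j). x i ^ j) $$ (i, j) = (A * B) $$ (i, j)" using ij by simp
  qed (auto simp: A_def B_def)
  then have "det (mat n n (\<lambda>(i, j). x i ^ j)) = det A * det B"
    using det_mult[OF AB] by simp
  also have "det B = 1"
  proof -
    have "upper_triangular B" by (auto simp: upper_triangular_def B_def c(2))
    then have "det B = prod_list (diag_mat B)" using AB by (intro det_upper_triangular)
    also have "\<dots> = (\<Prod>i<n. 1)"
      by (simp add: B_def diag_mat_def c(1) prod.list_conv_set_nth atLeast0LessThan)
    finally show ?thesis by simp
  qed
  also have "det A = (\<Prod>j<n. \<Prod>i<j. x j - x i)"
  proof -
    have "det A = prod_list (diag_mat A)" using AB
      by (intro det_lower_triangular[of n]) (auto simp: A_def)
    also have "\<dots> = (\<Prod>j<n. \<Prod>i<j. x j - x i)"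
      by (simp add: A_def diag_mat_def prod.list_conv_set_nth atLeast0LessThan)
    finally show ?thesis .
  qed
  finally show ?thesis by simp
qed

text \<open>Subtracting from each row of the Vandermonde matrix of size \<open>Suc n\<close> the row
  before it keeps the determinant and turns the first column into a unit vector; the matrix of
  differences is the remaining minor.\<close>

lemma det_vandermonde_differences:
  fixes x :: "nat \<Rightarrow> 'a::idom"
  shows "det (mat n n (\<lambda>(i, j). x (Suc i) ^ Suc j - x i ^ Suc j)) = (\<Prod>j<Suc n. \<Prod>i<j. x j - x i)"
proof -
  define W where "W = mat (Suc n) (Suc n) (\<lambda>(i, j). x i ^ j)"
  define D where "D = mat (Suc n) (Suc n) (\<lambda>(i, k). if k = i then 1 else if Suc k = i then -1 else (0::'a))"
  define M where "M = mat n n (\<lambda>(i, j). x (Suc i) ^ Suc j - x i ^ Suc j)"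
  define R where "R = mat 1 n (\<lambda>(i, j). x 0 ^ Suc j)"
  have WD: "W \<in> carrier_mat (Suc n) (Suc n)" "D \<in> carrier_mat (Suc n) (Suc n)"
    by (auto simp: W_def D_def)
  have "D * W = four_block_mat (1\<^sub>m 1) R (0\<^sub>m n 1) M"
  proof (rule eq_matI)
    fix i j assume "i < dim_row (four_block_mat (1\<^sub>m 1) R (0\<^sub>m n 1) M)"
      "j < dim_col (four_block_mat (1\<^sub>m 1) R (0\<^sub>m n 1) M)"
    then have ij: "i < Suc n" "j < Suc n" by (auto simp: R_def M_def)
    have DW: "(D * W) $$ (i, j) = (\<Sum>k<Suc n. (if k = i then 1 else if Suc k = i then -1 else 0) * x k ^ j)"
      using ij by (simp add: D_def W_def scalar_prod_def atLeast0LessThan)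
    show "(D * W) $$ (i, j) = four_block_mat (1\<^sub>m 1) R (0\<^sub>m n 1) M $$ (i, j)"
    proof (cases i)
      case 0
      then have "(D * W) $$ (i, j) = (\<Sum>k<Suc n. if k = 0 then x 0 ^ j else 0)"
        unfolding DW by (intro sum.cong) auto
      also have "\<dots> = x 0 ^ j" by (subst sum.delta) auto
      finally show ?thesis using 0 ij by (cases j) (auto simp: R_def M_def)
    next
      case (Suc i')
      have "(D * W) $$ (i, j) = (\<Sum>k<Suc n. (if k = i then x i ^ j else 0) + (if k = i' then - (x i' ^ j) else 0))"
        unfolding DW by (intro sum.cong) (auto simp: Suc)
      also have "\<dots> = x i ^ j - x i' ^ j"
        using ij Suc by (simp only: sum.distrib, subst (1 2) sum.delta) auto
      finally show ?thesis using Suc ij by (cases j) (auto simp: R_def M_def)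
    qed
  qed (auto simp: D_def W_def R_def M_def)
  then have "det D * det W = det (four_block_mat (1\<^sub>m 1) R (0\<^sub>m n 1) M)"
    using det_mult[OF WD(2,1)] by simp
  also have "\<dots> = det (1\<^sub>m 1) * det M"
    by (rule det_four_block_mat_lower_left_zero_col) (auto simp: R_def M_def)
  also have "\<dots> = det M" by simp
  also have "det D = 1"
  proof -
    have "det D = prod_list (diag_mat D)" using WD
      by (intro det_lower_triangular[of "Suc n"]) (auto simp: D_def)
    also have "\<dots> = (\<Prod>i<Suc n. 1)"
      by (simp add: D_def diag_mat_def prod.list_conv_set_nth atLeast0LessThan del: upt_Suc)
    finally show ?thesis by simp
  qed
  finally show ?thesis by (simp only: W_def M_def det_vandermonde mult_1)
qed

lemma permutes_lessThan_image: "\<pi> permutes {0..<n::nat} \<Longrightarrow> i < n \<Longrightarrow> \<pi> i < n"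
  using permutes_in_image[of \<pi> "{0..<n}" i] by simp

text \<open>Row i of the matrix with entries \<open>f (b i) ^ Suc j\<close> depends on b i alone. As
  the determinant is linear in each row, the coordinates of b can be summed independently inside
  it.\<close>

lemma sum_vandermonde_PiE:
  fixes f :: "'b \<Rightarrow> 'a::idom" and J :: "nat \<Rightarrow> 'b set"
  assumes "\<And>i. i < n \<Longrightarrow> finite (J i)"
  shows "(\<Sum>b\<in>PiE {..<n} J. (\<Prod>i<n. f (b i)) * (\<Prod>j<n. \<Prod>i<j. f (b j) - f (b i)))
    = det (mat n n (\<lambda>(i, j). \<Sum>s\<in>J i. f s ^ Suc j))"
proof -
  have "(\<Sum>b\<in>PiE {..<n} J. (\<Prod>i<n. f (b i)) * (\<Prod>j<n. \<Prod>i<j. f (b j) - f (b i)))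
    = (\<Sum>b\<in>PiE {..<n} J. \<Sum>\<pi> | \<pi> permutes {0..<n}. signof \<pi> * (\<Prod>i<n. f (b i) ^ Suc (\<pi> i)))"
  proof (rule sum.cong[OF refl])
    fix b
    have "(\<Prod>i<n. f (b i)) * (\<Prod>j<n. \<Prod>i<j. f (b j) - f (b i))
      = (\<Prod>i<n. f (b i)) * det (mat n n (\<lambda>(i, j). f (b i) ^ j))"
      using det_vandermonde[of n "\<lambda>i. f (b i)"] by simp
    also have "det (mat n n (\<lambda>(i, j). f (b i) ^ j))
      = (\<Sum>\<pi> | \<pi> permutes {0..<n}. signof \<pi> * (\<Prod>i<n. f (b i) ^ \<pi> i))"
      by (subst det_def'[of _ n]) (auto intro!: sum.cong prod.cong simp: atLeast0LessThan permutes_lessThan_image)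
    also have "(\<Prod>i<n. f (b i)) * \<dots>
      = (\<Sum>\<pi> | \<pi> permutes {0..<n}. signof \<pi> * (\<Prod>i<n. f (b i) ^ Suc (\<pi> i)))"
      by (simp add: sum_distrib_left prod.distrib mult.left_commute)
    finally show "(\<Prod>i<n. f (b i)) * (\<Prod>j<n. \<Prod>i<j. f (b j) - f (b i))
      = (\<Sum>\<pi> | \<pi> permutes {0..<n}. signof \<pi> * (\<Prod>i<n. f (b i) ^ Suc (\<pi> i)))" .
  qed
  also have "\<dots> = (\<Sum>\<pi> | \<pi> permutes {0..<n}. signof \<pi> * (\<Sum>b\<in>PiE {..<n} J. \<Prod>i<n. f (b i) ^ Suc (\<pi> i)))"
    by (subst sum.swap) (simp add: sum_distrib_left)
  also have "\<dots> = (\<Sum>\<pi> | \<pi> permutes {0..<n}. signof \<pi> * (\<Prod>i<n. \<Sum>s\<in>J i. f s ^ Suc (\<pi> i)))"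
  proof (rule sum.cong[OF refl])
    fix \<pi>
    have "(\<Prod>i<n. \<Sum>s\<in>J i. f s ^ Suc (\<pi> i)) = (\<Sum>b\<in>PiE {..<n} J. \<Prod>i<n. f (b i) ^ Suc (\<pi> i))"
      by (rule prod_sum_PiE) (use assms in auto)
    then show "signof \<pi> * (\<Sum>b\<in>PiE {..<n} J. \<Prod>i<n. f (b i) ^ Suc (\<pi> i))
      = signof \<pi> * (\<Prod>i<n. \<Sum>s\<in>J i. f s ^ Suc (\<pi> i))" by simp
  qed
  also have "\<dots> = det (mat n n (\<lambda>(i, j). \<Sum>s\<in>J i. f s ^ Suc j))"
    by (subst det_def'[of _ n]) (auto intro!: sum.cong prod.cong simp: atLeast0LessThan permutes_lessThan_image)
  finally show ?thesis .
qed

lemma det_mult_columns: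
  fixes A :: "nat \<Rightarrow> nat \<Rightarrow> 'a::comm_ring_1"
  shows "det (mat n n (\<lambda>(i, j). c j * A i j)) = (\<Prod>j<n. c j) * det (mat n n (\<lambda>(i, j). A i j))"
proof -
  have "(\<Prod>i = 0..<n. c (\<pi> i) * A i (\<pi> i)) = (\<Prod>j<n. c j) * (\<Prod>i = 0..<n. A i (\<pi> i))"
    if "\<pi> permutes {0..<n}" for \<pi>
    using prod.permute[OF that, of c] by (simp add: prod.distrib atLeast0LessThan comp_def)
  then have "det (mat n n (\<lambda>(i, j). c j * A i j))
    = (\<Sum>\<pi> | \<pi> permutes {0..<n}. signof \<pi> * ((\<Prod>j<n. c j) * (\<Prod>i = 0..<n. A i (\<pi> i))))"
    by (subst det_def'[of _ n]) (auto intro!: sum.cong simp: permutes_lessThan_image)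
  also have "\<dots> = (\<Prod>j<n. c j) * (\<Sum>\<pi> | \<pi> permutes {0..<n}. signof \<pi> * (\<Prod>i = 0..<n. A i (\<pi> i)))"
    by (simp add: sum_distrib_left mult.left_commute)
  also have "(\<Sum>\<pi> | \<pi> permutes {0..<n}. signof \<pi> * (\<Prod>i = 0..<n. A i (\<pi> i))) = det (mat n n (\<lambda>(i, j). A i j))"
    by (subst det_def'[of _ n]) (auto intro!: sum.cong simp: permutes_lessThan_image)
  finally show ?thesis .
qed

text \<open>The telescoped form matters: a factor depending only on the column, times a difference
  of powers of consecutive nodes.\<close>

lemma sum_powi_interval:
  fixes p :: "'a::field"
  assumes "p \<noteq> 0" "p ^ k \<noteq> 1" "l \<le> u"
  shows "(\<Sum>s\<in>{l<..u}. (p powi s) ^ k) = p ^ k / (p ^ k - 1) * ((p powi u) ^ k - (p powi l) ^ k)"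
  using assms(3)
proof (induction u rule: int_ge_induct)
  case base
  then show ?case by simp
next
  case (step u)
  have "{l<..u + 1} = insert (u + 1) {l<..u}" using step by auto
  then have "(\<Sum>s\<in>{l<..u + 1}. (p powi s) ^ k) = (p powi (u + 1)) ^ k
    + p ^ k / (p ^ k - 1) * ((p powi u) ^ k - (p powi l) ^ k)"
    using step.IH by simp
  also have "\<dots> = p ^ k / (p ^ k - 1) * ((p powi (u + 1)) ^ k - (p powi l) ^ k)"
    using assms(1,2) by (simp add: power_int_add power_mult_distrib field_simps)
  finally show ?case .
qed

text \<open>Summed over an interval, each entry of the determinant is a geometric series. Once the
  column factors are pulled out, rows of differences remain, and these form a Vandermonde
  determinant with one more node.\<close>

lemma sum_vandermonde_interlacing:
  fixes p :: "'a::field"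
  assumes "p \<noteq> 0" and ne1: "\<And>k. k > 0 \<Longrightarrow> p ^ k \<noteq> 1" and mono: "\<And>i. i < n \<Longrightarrow> \<alpha> i \<le> \<alpha> (Suc i)"
  shows "(\<Sum>b\<in>PiE {..<n} (\<lambda>i. {\<alpha> i<..\<alpha> (Suc i)}).
      (\<Prod>i<n. p powi b i) * (\<Prod>j<n. \<Prod>i<j. p powi b j - p powi b i))
    = (\<Prod>k=1..n. p ^ k / (p ^ k - 1)) * (\<Prod>j<Suc n. \<Prod>i<j. p powi \<alpha> j - p powi \<alpha> i)"
proof -
  have "(\<Sum>b\<in>PiE {..<n} (\<lambda>i. {\<alpha> i<..\<alpha> (Suc i)}).
      (\<Prod>i<n. p powi b i) * (\<Prod>j<n. \<Prod>i<j. p powi b j - p powi b i))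
    = det (mat n n (\<lambda>(i, j). \<Sum>s\<in>{\<alpha> i<..\<alpha> (Suc i)}. (p powi s) ^ Suc j))"
    by (rule sum_vandermonde_PiE) auto
  also have "mat n n (\<lambda>(i, j). \<Sum>s\<in>{\<alpha> i<..\<alpha> (Suc i)}. (p powi s) ^ Suc j)
    = mat n n (\<lambda>(i, j). p ^ Suc j / (p ^ Suc j - 1) * ((p powi \<alpha> (Suc i)) ^ Suc j - (p powi \<alpha> i) ^ Suc j))"
    by (rule eq_matI) (auto simp only: sum_powi_interval[OF assms(1) ne1 mono]
        index_mat dim_row_mat dim_col_mat prod.case zero_less_Suc)
  also have "det \<dots> = (\<Prod>j<n. p ^ Suc j / (p ^ Suc j - 1)) *
      det (mat n n (\<lambda>(i, j). (p powi \<alpha> (Suc i)) ^ Suc j - (p powi \<alpha> i) ^ Suc j))"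
    by (rule det_mult_columns)
  also have "(\<Prod>j<n. p ^ Suc j / (p ^ Suc j - 1)) = (\<Prod>k=1..n. p ^ k / (p ^ k - 1))"
    by (rule prod.reindex_bij_witness[of _ "\<lambda>k. k - 1" Suc]) auto
  finally show ?thesis by (simp only: det_vandermonde_differences[of n "\<lambda>i. p powi \<alpha> i"])
qed

section \<open>Interlacing sets\<close>

text \<open>Integer valued, so that counts can be subtracted without truncation.\<close>

definition count_ge :: "int set \<Rightarrow> int \<Rightarrow> int" where
  "count_ge A k = int (card {j \<in> A. k \<le> j})"

lemma count_ge_step:
  assumes "finite A"
  shows "count_ge A k = count_ge A (k + 1) + (if k \<in> A then 1 else 0)"
proof (cases "k \<in> A")
  case True
  then have "{j \<in> A. k \<le> j} = insert k {j \<in> A. k + 1 \<le> j}" by auto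
  then show ?thesis using assms True by (simp add: count_ge_def)
next
  case False
  then have "{j \<in> A. k \<le> j} = {j \<in> A. k + 1 \<le> j}"
    by (auto simp: zle_add1_eq_le order.order_iff_strict)
  then show ?thesis using False by (simp add: count_ge_def)
qed

lemma count_ge_antimono: "finite A \<Longrightarrow> k \<le> l \<Longrightarrow> count_ge A l \<le> count_ge A k"
  unfolding count_ge_def by (auto intro!: card_mono)

lemma count_ge_nonneg: "0 \<le> count_ge A k"
  by (simp add: count_ge_def)

lemma count_ge_Un_disjoint:
  "finite A \<Longrightarrow> finite B \<Longrightarrow> A \<inter> B = {} \<Longrightarrow> count_ge (A \<union> B) k = count_ge A k + count_ge B k"
proof -
  assume "finite A" "finite B" "A \<inter> B = {}"
  moreover have "{j \<in> A \<union> B. k \<le> j} = {j \<in> A. k \<le> j} \<union> {j \<in> B. k \<le> j}" by auto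
  ultimately show ?thesis by (auto simp: count_ge_def card_Un_disjoint disjoint_iff)
qed

lemma count_ge_Diff:
  "finite A \<Longrightarrow> B \<subseteq> A \<Longrightarrow> count_ge (A - B) k = count_ge A k - count_ge B k"
  using count_ge_Un_disjoint[of B "A - B" k] finite_subset[of B A] by (auto simp: Un_absorb1)

lemma count_ge_shift: "count_ge ((+) c ` A) k = count_ge A (k - c)"
proof -
  have "{j \<in> (+) c ` A. k \<le> j} = (+) c ` {j \<in> A. k - c \<le> j}" by auto
  then show ?thesis by (simp add: count_ge_def card_image)
qed

lemma count_ge_interval: "count_ge {l..<u} k = max 0 (u - max l k)"
proof -
  have "{j \<in> {l..<u}. k \<le> j} = {max l k..<u}" by auto
  then show ?thesis unfolding count_ge_def by (simp add: max_def)
qed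

lemma count_ge_empty [simp]: "count_ge {} k = 0"
  by (simp add: count_ge_def)

lemma count_ge_image:
  assumes "inj_on f I"
  shows "count_ge (f ` I) k = int (card {i \<in> I. k \<le> f i})"
proof -
  have "{j \<in> f ` I. k \<le> j} = f ` {i \<in> I. k \<le> f i}" by auto
  moreover have "inj_on f {i \<in> I. k \<le> f i}" using assms by (rule inj_on_subset) auto
  ultimately show ?thesis by (simp add: count_ge_def card_image)
qed

text \<open>
  For the increasing enumerations this says \<open>a\<^sub>0 < b\<^sub>0 \<le> a\<^sub>1 < b\<^sub>1 \<le> \<dots> \<le> a\<^sub>n\<close>; the inequalities between counting
  functions are preserved by pointwise maxima, which makes the tilings a lattice.
\<close>

definition interlaces :: "int set \<Rightarrow> int set \<Rightarrow> bool" where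
  "interlaces B A \<longleftrightarrow> finite B \<and> finite A \<and> card A = Suc (card B) \<and>
     (\<forall>k. count_ge B k \<le> count_ge A k \<and> count_ge A k \<le> count_ge B (k + 1) + 1)"

text \<open>Turns the counting form of interlacing into a product of intervals, as needed for
  summation coordinate by coordinate. If b i left its interval, one of the two counting inequalities
  would fail, at height b i or at height \<alpha> i.\<close>

lemma interlacing_enumeration:
  fixes \<alpha> :: "nat \<Rightarrow> int"
  assumes mono: "strict_mono_on {..n} \<alpha>"
  shows "bij_betw (\<lambda>b. b ` {..<n}) (PiE {..<n} (\<lambda>i. {\<alpha> i<..\<alpha> (Suc i)}))
    {B. interlaces B (\<alpha> ` {..n})}" (is "bij_betw ?f ?P ?I")
    and "\<And>b. b \<in> PiE {..<n} (\<lambda>i. {\<alpha> i<..\<alpha> (Suc i)}) \<Longrightarrow> strict_mono_on {..<n} b"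
proof -
  have \<alpha>_le: "\<alpha> i \<le> \<alpha> j" if "i \<le> j" "j \<le> n" for i j
    using strict_mono_onD[OF mono, of i j] that by (cases "i = j") auto
  have inj_\<alpha>: "inj_on \<alpha> {..n}" using mono by (rule strict_mono_on_imp_inj_on)
  have b: "\<alpha> i < b i" "b i \<le> \<alpha> (Suc i)" if "b \<in> ?P" "i < n" for b i
    using that by (auto simp: PiE_def Pi_def)
  show sm: "strict_mono_on {..<n} b" if bP: "b \<in> ?P" for b
  proof (rule strict_mono_onI)
    fix i j assume ij: "i \<in> {..<n}" "j \<in> {..<n}" "i < j"
    have "b i \<le> \<alpha> (Suc i)" using b[OF bP] ij by auto
    also have "\<dots> \<le> \<alpha> j" using ij by (intro \<alpha>_le) auto
    also have "\<dots> < b j" using b[OF bP] ij by auto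
    finally show "b i < b j" .
  qed
  have "inj_on ?f ?P"
  proof (rule inj_onI)
    fix b b' assume P: "b \<in> ?P" "b' \<in> ?P" and eq: "b ` {..<n} = b' ` {..<n}"
    show "b = b'"
    proof (rule PiE_ext[OF P])
      fix i assume i: "i \<in> {..<n}"
      then obtain j where j: "j < n" "b i = b' j" using eq by (metis imageE imageI lessThan_iff)
      \<comment> \<open>For i < j one would have b i \<le> \<alpha> (Suc i) \<le> \<alpha> j < b' j,
        contradicting b i = b' j; the other case is symmetric.\<close>
      have "\<not> i < j" "\<not> j < i"
        using \<alpha>_le[of "Suc i" j] \<alpha>_le[of "Suc j" i] b[OF P(1), of i] b[OF P(2), of j] i j by fastforce+
      then show "b i = b' i" using j by (metis linorder_neqE_nat)
    qed
  qed
  moreover have "interlaces (?f b) (\<alpha> ` {..n})" if bP: "b \<in> ?P" for b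
  proof -
    have inj: "inj_on b {..<n}" using sm[OF bP] by (rule strict_mono_on_imp_inj_on)
    have "count_ge (?f b) k \<le> count_ge (\<alpha> ` {..n}) k" for k
    proof -
      have "card {i \<in> {..<n}. k \<le> b i} = card (Suc ` {i \<in> {..<n}. k \<le> b i})"
        by (simp add: card_image)
      also have "\<dots> \<le> card {i \<in> {..n}. k \<le> \<alpha> i}"
        using b[OF bP] by (intro card_mono) force+
      finally show ?thesis using inj inj_\<alpha> by (simp add: count_ge_image)
    qed
    moreover have "count_ge (\<alpha> ` {..n}) k \<le> count_ge (?f b) (k + 1) + 1" for k
    proof -
      \<comment> \<open>Every \<alpha> i with i < n lies strictly below b i; the index n accounts
        for the summand 1.\<close>
      have "{i \<in> {..n}. k \<le> \<alpha> i} \<subseteq> insert n {i \<in> {..<n}. k + 1 \<le> b i}"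
      proof
        fix i assume i: "i \<in> {i \<in> {..n}. k \<le> \<alpha> i}"
        show "i \<in> insert n {i \<in> {..<n}. k + 1 \<le> b i}"
          using i b(1)[OF bP, of i] by (cases "i = n") auto
      qed
      then have "card {i \<in> {..n}. k \<le> \<alpha> i} \<le> card (insert n {i \<in> {..<n}. k + 1 \<le> b i})"
        by (intro card_mono) auto
      also have "\<dots> = Suc (card {i \<in> {..<n}. k + 1 \<le> b i})" by simp
      finally show ?thesis using inj inj_\<alpha> by (simp add: count_ge_image)
    qed
    ultimately show ?thesis using inj inj_\<alpha> by (simp add: interlaces_def card_image)
  qed
  moreover have "B \<in> ?f ` ?P" if B: "interlaces B (\<alpha> ` {..n})" for B
  proof -
    from B have fin: "finite B" and card: "card B = n"
      and c: "\<And>k. count_ge B k \<le> count_ge (\<alpha> ` {..n}) k"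
        "\<And>k. count_ge (\<alpha> ` {..n}) k \<le> count_ge B (k + 1) + 1"
      using inj_\<alpha> by (auto simp: interlaces_def card_image)
    define b where "b = (\<lambda>i\<in>{..<n}. sorted_list_of_set B ! i)"
    have len: "length (sorted_list_of_set B) = n" using card by simp
    have "sorted_wrt (<) (sorted_list_of_set B)" by simp
    then have smb: "b i < b j" if "i < j" "j < n" for i j
      using that len by (simp add: b_def sorted_wrt_nth_less)
    have inj: "inj_on b {..<n}"
      by (rule strict_mono_on_imp_inj_on, rule strict_mono_onI) (use smb in auto)
    have im: "b ` {..<n} = B"
    proof -
      have "b ` {..<n} = set (sorted_list_of_set B)"
        using card by (auto simp: b_def set_conv_nth)
      then show ?thesis using fin by simp
    qed
    have smb_le: "b i \<le> b j \<longleftrightarrow> i \<le> j" if "i < n" "j < n" for i j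
      using smb[of i j] smb[of j i] that by (cases i j rule: linorder_cases) auto
    have \<alpha>_iff: "\<alpha> i \<le> \<alpha> j \<longleftrightarrow> i \<le> j" if "i \<le> n" "j \<le> n" for i j
      using strict_mono_onD[OF mono, of i j] strict_mono_onD[OF mono, of j i] that
      by (cases i j rule: linorder_cases) auto
    have "b i \<in> {\<alpha> i<..\<alpha> (Suc i)}" if i: "i < n" for i
    proof -
      have "\<not> \<alpha> (Suc i) < b i"
      proof
        assume less: "\<alpha> (Suc i) < b i"
        have "{j \<in> {..<n}. b i \<le> b j} = {i..<n}" using smb_le i by auto
        then have "count_ge B (b i) = int (n - i)"
          using count_ge_image[OF inj, of "b i"] im by simp
        moreover have "{j \<in> {..n}. b i \<le> \<alpha> j} \<subseteq> {Suc i<..n}"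
          using less i \<alpha>_iff[of _ "Suc i"] by force
        then have "card {j \<in> {..n}. b i \<le> \<alpha> j} \<le> n - Suc i"
          using card_mono[of "{Suc i<..n}"] by fastforce
        ultimately show False using c(1)[of "b i"] count_ge_image[OF inj_\<alpha>, of "b i"] i by linarith
      qed
      moreover have "\<not> b i \<le> \<alpha> i"
      proof
        assume le: "b i \<le> \<alpha> i"
        have "{j \<in> {..n}. \<alpha> i \<le> \<alpha> j} = {i..n}" using \<alpha>_iff i by auto
        then have "count_ge (\<alpha> ` {..n}) (\<alpha> i) = int (Suc n - i)"
          using count_ge_image[OF inj_\<alpha>, of "\<alpha> i"] by simp
        moreover have "{j \<in> {..<n}. \<alpha> i + 1 \<le> b j} \<subseteq> {i<..<n}"
          using le i smb_le[of _ i] by force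
        then have "card {j \<in> {..<n}. \<alpha> i + 1 \<le> b j} \<le> n - Suc i"
          using card_mono[of "{i<..<n}"] by fastforce
        ultimately show False
          using c(2)[of "\<alpha> i"] count_ge_image[OF inj, of "\<alpha> i + 1", unfolded im] i by linarith
      qed
      ultimately show ?thesis by simp
    qed
    then have "b \<in> ?P" by (auto simp: b_def PiE_def Pi_def extensional_def)
    then show ?thesis using im by blast
  qed
  ultimately show "bij_betw ?f ?P ?I" by (auto simp: bij_betw_def)
qed

section \<open>Weighted Gelfand-Tsetlin patterns as q-Vandermonde products\<close>

lemma q_H_Suc: "q_H q (Suc n) = q_H q n * q_fact q n"
  by (simp add: q_H_def)

text \<open>q has to be invertible because left lozenges will carry negative exponents. The second
  assumption allows the geometric series in the determinants to be summed and makes every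
  \<open>q_H\<close> invertible.\<close>

locale generic_q =
  fixes q :: "'a::field"
  assumes q_nonzero: "q \<noteq> 0" and q_power_ne_1: "\<And>k. k > 0 \<Longrightarrow> q ^ k \<noteq> 1"
begin

lemma q_int_closed_form: "(1 - q) * q_int q n = 1 - q ^ n"
  unfolding q_int_def by (rule one_diff_power_eq[symmetric])

lemma q_ne_1: "1 - q \<noteq> 0"
  using q_power_ne_1[of 1] by simp

lemma q_int_nonzero: "n > 0 \<Longrightarrow> q_int q n \<noteq> 0"
  using q_int_closed_form[of n] q_power_ne_1[of n] by auto

lemma q_fact_nonzero: "q_fact q n \<noteq> 0"
  by (auto simp: q_fact_def q_int_nonzero)

lemma q_H_nonzero: "q_H q n \<noteq> 0"
  by (auto simp: q_H_def q_fact_nonzero)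

text \<open>Left lozenges have weight 1 in \<open>M2\<close>; the negative exponent appears when
  right lozenges are eliminated in favour of left ones by \<open>kappa_eq\<close>.\<close>

definition wt :: "int set \<Rightarrow> 'a" where
  "wt A = q powi (- (\<Sum>j\<in>A. j + 1))"

definition cross :: "int set \<Rightarrow> int set \<Rightarrow> 'a" where
  "cross A B = (\<Prod>v\<in>B. \<Prod>u\<in>A. q powi (- (v + 1)) * q_int q (nat (v - u)))"

text \<open>Up to a power of q (1 - q) this is the Vandermonde product in the nodes q^(-v), see
  \<open>inverse_powi_diff\<close>. In this normalisation it becomes a power of q times a
  hyperfactorial \<open>q_H\<close> on an interval.\<close>

definition vdm :: "int set \<Rightarrow> 'a" where
  "vdm A = (\<Prod>v\<in>A. \<Prod>u\<in>{u \<in> A. u < v}. q powi (- (v + 1)) * q_int q (nat (v - u)))"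

text \<open>
  The weighted number of Gelfand-Tsetlin patterns with top row \<open>A\<close>, the top row itself not being
  weighted.
\<close>

definition patterns :: "int set \<Rightarrow> 'a" where
  "patterns A = vdm A / q_H q (card A)"

lemma vdm_image:
  fixes f :: "nat \<Rightarrow> int"
  assumes "strict_mono_on {..<n} f"
  shows "vdm (f ` {..<n}) = (\<Prod>j<n. \<Prod>i<j. q powi (- (f j + 1)) * q_int q (nat (f j - f i)))"
proof -
  have inj: "inj_on f {..<n}" using assms by (rule strict_mono_on_imp_inj_on)
  have "vdm (f ` {..<n}) = (\<Prod>j<n. \<Prod>u\<in>{u \<in> f ` {..<n}. u < f j}. q powi (- (f j + 1)) * q_int q (nat (f j - u)))"
    unfolding vdm_def by (subst prod.reindex[OF inj]) simp
  also have "\<dots> = (\<Prod>j<n. \<Prod>i<j. q powi (- (f j + 1)) * q_int q (nat (f j - f i)))"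
  proof (rule prod.cong[OF refl])
    fix j assume j: "j \<in> {..<n}"
    have less: "f i < f j \<longleftrightarrow> i < j" if "i < n" for i
      using strict_mono_onD[OF assms, of i j] strict_mono_onD[OF assms, of j i] that j
      by (cases i j rule: linorder_cases) auto
    have "{u \<in> f ` {..<n}. u < f j} = f ` {..<j}" using less j by auto
    moreover have "inj_on f {..<j}" using inj j by (auto intro: inj_on_subset)
    ultimately show "(\<Prod>u\<in>{u \<in> f ` {..<n}. u < f j}. q powi (- (f j + 1)) * q_int q (nat (f j - u)))
      = (\<Prod>i<j. q powi (- (f j + 1)) * q_int q (nat (f j - f i)))"
      by (simp add: prod.reindex)
  qed
  finally show ?thesis .
qed

lemma inverse_powi_diff:
  assumes "u < v"
  shows "inverse q powi v - inverse q powi u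
    = q * (1 - q) * (q powi (- (v + 1)) * q_int q (nat (v - u)))"
proof -
  have "q powi u = q powi (v - int (nat (v - u)))" using assms by simp
  also have "\<dots> = q powi v / q ^ nat (v - u)"
    using q_nonzero power_int_diff[of q v "int (nat (v - u))"] by (metis power_int_of_nat)
  finally have u: "q powi u = q powi v / q ^ nat (v - u)" .
  have "q * (1 - q) * (q powi (- (v + 1)) * q_int q (nat (v - u)))
    = q * q powi (- (v + 1)) * (1 - q ^ nat (v - u))"
    unfolding q_int_closed_form[symmetric] by (simp only: mult_ac)
  also have "q * q powi (- (v + 1)) = inverse (q powi v)"
    unfolding power_int_minus using q_nonzero by (simp add: power_int_add)
  also have "inverse (q powi v) * (1 - q ^ nat (v - u)) = inverse q powi v - inverse q powi u"
    using q_nonzero by (simp add: power_int_inverse u field_simps)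
  finally show ?thesis by simp
qed

lemma vandermonde_eq_vdm:
  fixes f :: "nat \<Rightarrow> int"
  assumes "strict_mono_on {..<n} f"
  shows "(\<Prod>j<n. \<Prod>i<j. inverse q powi f j - inverse q powi f i)
    = (\<Prod>j<n. (q * (1 - q)) ^ j) * vdm (f ` {..<n})"
proof -
  have "(\<Prod>j<n. \<Prod>i<j. inverse q powi f j - inverse q powi f i)
    = (\<Prod>j<n. \<Prod>i<j. q * (1 - q) * (q powi (- (f j + 1)) * q_int q (nat (f j - f i))))"
    by (intro prod.cong refl inverse_powi_diff strict_mono_onD[OF assms]) auto
  also have "\<dots> = (\<Prod>j<n. (q * (1 - q)) ^ j * (\<Prod>i<j. q powi (- (f j + 1)) * q_int q (nat (f j - f i))))"
    by (intro prod.cong refl) (simp add: prod.distrib power_mult_distrib)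
  finally show ?thesis unfolding vdm_image[OF assms] by (simp only: prod.distrib)
qed

lemma prod_powi_eq_wt:
  fixes f :: "nat \<Rightarrow> int"
  assumes "inj_on f {..<n}"
  shows "(\<Prod>i<n. inverse q powi f i) = q ^ n * wt (f ` {..<n})"
proof -
  have "(\<Prod>i<m. inverse q powi f i) = q ^ m * q powi (- (\<Sum>i<m. f i + 1))" for m
  proof (induction m)
    case (Suc m)
    have "inverse q powi f m = q * q powi (- (f m + 1))"
      unfolding power_int_minus using q_nonzero by (simp add: power_int_add power_int_inverse)
    moreover have "q powi (- (\<Sum>i<Suc m. f i + 1)) = q powi (- (\<Sum>i<m. f i + 1)) * q powi (- (f m + 1))"
      using power_int_add[of q "- (\<Sum>i<m. f i + 1)" "- (f m + 1)"] q_nonzero by simp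
    ultimately show ?case unfolding prod.lessThan_Suc Suc by (simp only: power_Suc mult_ac)
  qed simp
  then show ?thesis using assms by (simp add: wt_def sum.reindex)
qed

lemma prod_inverse_power:
  "(\<Prod>k=1..n. inverse q ^ k / (inverse q ^ k - 1)) = 1 / ((1 - q) ^ n * q_fact q n)"
proof -
  have "(\<Prod>k=1..n. inverse q ^ k / (inverse q ^ k - 1)) = (\<Prod>k=1..n. 1 / ((1 - q) * q_int q k))"
  proof (rule prod.cong[OF refl])
    fix k assume "k \<in> {1..n}"
    then have "q ^ k \<noteq> 1" using q_power_ne_1[of k] by simp
    then show "inverse q ^ k / (inverse q ^ k - 1) = 1 / ((1 - q) * q_int q k)"
      unfolding q_int_closed_form using q_nonzero by (simp add: power_inverse field_simps)
  qed
  also have "\<dots> = 1 / (\<Prod>k=1..n. (1 - q) * q_int q k)" by (simp add: prod_dividef)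
  finally show ?thesis by (simp add: prod.distrib q_fact_def)
qed

text \<open>The recursion that removes the top row. \<open>sum_vandermonde_interlacing\<close> with
  p = 1/q turns the sum over B into the Vandermonde product of A; the powers of q and of 1 - q
  cancel, and the remaining q-factorial is the quotient of \<open>q_H q (Suc n)\<close> by
  \<open>q_H q n\<close>.\<close>

theorem patterns_recursion:
  assumes "finite A" "A \<noteq> {}"
  shows "patterns A = (\<Sum>B | interlaces B A. wt B * patterns B)"
proof -
  obtain n where n: "card A = Suc n" using assms by (metis card_gt_0_iff gr0_implies_Suc)
  define \<alpha> where "\<alpha> i = sorted_list_of_set A ! i" for i
  have len: "length (sorted_list_of_set A) = Suc n" using n by simp
  have "sorted_wrt (<) (sorted_list_of_set A)" by simp
  then have mono: "strict_mono_on {..n} \<alpha>"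
    using len sorted_wrt_nth_less[of "(<)" "sorted_list_of_set A"]
    by (auto simp: \<alpha>_def intro!: strict_mono_onI)
  then have mono': "strict_mono_on {..<Suc n} \<alpha>" by (simp add: lessThan_Suc_atMost)
  have im: "A = \<alpha> ` {..n}"
  proof -
    have "\<alpha> ` {..n} = set (sorted_list_of_set A)"
      using n by (auto simp: \<alpha>_def set_conv_nth less_Suc_eq_le)
    then show ?thesis using assms by simp
  qed
  define P where "P = PiE {..<n} (\<lambda>i. {\<alpha> i<..\<alpha> (Suc i)})"
  note enum = interlacing_enumeration[OF mono, folded P_def im]
  \<comment> \<open>The ratio of a difference of nodes to the corresponding factor of
    \<open>vdm\<close>. A has n pairs more than B, so a surplus \<open>c ^ n\<close>
    remains.\<close>
  define c where "c = q * (1 - q)"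
  have c: "c \<noteq> 0" using q_nonzero q_ne_1 by (simp add: c_def)
  have "(\<Sum>b\<in>P. (\<Prod>i<n. inverse q powi b i) * (\<Prod>j<n. \<Prod>i<j. inverse q powi b j - inverse q powi b i))
    = (\<Prod>k=1..n. inverse q ^ k / (inverse q ^ k - 1))
      * (\<Prod>j<Suc n. \<Prod>i<j. inverse q powi \<alpha> j - inverse q powi \<alpha> i)"
    unfolding P_def
  proof (rule sum_vandermonde_interlacing)
    show "inverse q \<noteq> 0" using q_nonzero by simp
    show "inverse q ^ k \<noteq> 1" if "k > 0" for k
      using q_power_ne_1[OF that] by (simp add: power_inverse)
    show "\<alpha> i \<le> \<alpha> (Suc i)" if "i < n" for i
      using strict_mono_onD[OF mono, of i "Suc i"] that by simp
  qed
  also have "(\<Prod>j<Suc n. \<Prod>i<j. inverse q powi \<alpha> j - inverse q powi \<alpha> i) = (\<Prod>j<Suc n. c ^ j) * vdm A"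
    unfolding c_def vandermonde_eq_vdm[OF mono'] by (simp only: lessThan_Suc_atMost im)
  also have "(\<Sum>b\<in>P. (\<Prod>i<n. inverse q powi b i) * (\<Prod>j<n. \<Prod>i<j. inverse q powi b j - inverse q powi b i))
    = (\<Sum>b\<in>P. q ^ n * (\<Prod>j<n. c ^ j) * (wt (b ` {..<n}) * vdm (b ` {..<n})))"
  proof (rule sum.cong[OF refl])
    fix b assume "b \<in> P"
    then have sm: "strict_mono_on {..<n} b" by (rule enum(2))
    show "(\<Prod>i<n. inverse q powi b i) * (\<Prod>j<n. \<Prod>i<j. inverse q powi b j - inverse q powi b i)
      = q ^ n * (\<Prod>j<n. c ^ j) * (wt (b ` {..<n}) * vdm (b ` {..<n}))"
      unfolding vandermonde_eq_vdm[OF sm] prod_powi_eq_wt[OF strict_mono_on_imp_inj_on[OF sm]] c_def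
      by (simp add: mult_ac)
  qed
  also have "\<dots> = q ^ n * (\<Prod>j<n. c ^ j) * (\<Sum>b\<in>P. wt (b ` {..<n}) * vdm (b ` {..<n}))"
    by (simp add: sum_distrib_left)
  also have "(\<Sum>b\<in>P. wt (b ` {..<n}) * vdm (b ` {..<n})) = (\<Sum>B | interlaces B A. wt B * vdm B)"
    using sum.reindex_bij_betw[OF enum(1), of "\<lambda>B. wt B * vdm B"] by simp
  also have "(\<Prod>j<Suc n. c ^ j) = (\<Prod>j<n. c ^ j) * c ^ n" by simp
  finally have main: "q ^ n * (\<Prod>j<n. c ^ j) * (\<Sum>B | interlaces B A. wt B * vdm B)
    = 1 / ((1 - q) ^ n * q_fact q n) * ((\<Prod>j<n. c ^ j) * c ^ n * vdm A)"
    by (simp only: prod_inverse_power)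
  have "(\<Sum>B | interlaces B A. wt B * vdm B) = vdm A / q_fact q n"
  proof -
    have "(\<Prod>j<n. c ^ j) \<noteq> 0" using c by simp
    moreover have "(\<Prod>j<n. c ^ j) * (q ^ n * (\<Sum>B | interlaces B A. wt B * vdm B))
      = (\<Prod>j<n. c ^ j) * (1 / ((1 - q) ^ n * q_fact q n) * (c ^ n * vdm A))"
      using main by (simp only: mult_ac)
    ultimately have "q ^ n * (\<Sum>B | interlaces B A. wt B * vdm B)
      = 1 / ((1 - q) ^ n * q_fact q n) * (c ^ n * vdm A)"
      using mult_left_cancel by blast
    also have "c ^ n = q ^ n * (1 - q) ^ n" by (simp add: c_def power_mult_distrib)
    also have "1 / ((1 - q) ^ n * q_fact q n) * (q ^ n * (1 - q) ^ n * vdm A) = q ^ n * (vdm A / q_fact q n)"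
      using q_ne_1 q_fact_nonzero[of n] by simp
    finally show ?thesis by (rule mult_left_cancel[THEN iffD1, rotated]) (use q_nonzero in simp)
  qed
  moreover have "(\<Sum>B | interlaces B A. wt B * patterns B) = (\<Sum>B | interlaces B A. wt B * vdm B) / q_H q n"
    unfolding sum_divide_distrib patterns_def by (intro sum.cong) (auto simp: interlaces_def n)
  ultimately show ?thesis by (simp add: patterns_def n q_H_Suc mult.commute)
qed

end

section \<open>Strips and blocks of consecutive integers\<close>

lemma count_ge_below: "A \<subseteq> {l..<u} \<Longrightarrow> k \<le> l \<Longrightarrow> count_ge A k = int (card A)"
proof -
  assume "A \<subseteq> {l..<u}" "k \<le> l"
  then have "{j \<in> A. k \<le> j} = A" by fastforce
  then show ?thesis by (simp add: count_ge_def)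
qed

lemma count_ge_above: "A \<subseteq> {l..<u} \<Longrightarrow> u \<le> k \<Longrightarrow> count_ge A k = 0"
proof -
  assume "A \<subseteq> {l..<u}" "u \<le> k"
  then have "{j \<in> A. k \<le> j} = {}" by fastforce
  then show ?thesis by (simp only: count_ge_def card.empty)
qed

text \<open>A and B stand for the rows of the up- and down-triangles of a strip that left lozenges
  do not cover. A down-triangle must be matched with the up-triangle in its own row or in the row
  above, and these inequalities are the resulting Hall-type criterion; see
  \<open>strip_tiling_unique\<close> and \<open>strip_tiling_exists\<close>.\<close>

definition strip_ok :: "int set \<Rightarrow> int set \<Rightarrow> bool" where
  "strip_ok A B \<longleftrightarrow> (\<forall>k. count_ge B k \<le> count_ge A k \<and> count_ge A k \<le> count_ge B (k - 1))"

text \<open>The strip of a trapezoid that gains a row at its lower end. Inside the window, taking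
  complements reverses the strip inequalities into interlacing; outside it the counts are constant
  and only the relation of cardinalities is left.\<close>

lemma strip_ok_left:
  assumes S: "S \<subseteq> {l..<u}" and S': "S' \<subseteq> {l - 1..<u}" and lu: "l \<le> u"
  shows "strip_ok ({l..<u} - S) ({l - 1..<u} - S') \<longleftrightarrow> interlaces S S'"
proof -
  have fin: "finite S" "finite S'" using S S' finite_subset by blast+
  have cU: "count_ge ({l..<u} - S) k = max 0 (u - max l k) - count_ge S k"
    and cD: "count_ge ({l - 1..<u} - S') k = max 0 (u - max (l - 1) k) - count_ge S' k" for k
    using S S' by (simp_all add: count_ge_Diff count_ge_interval)
  note below = count_ge_below[OF S] count_ge_below[OF S']
  note above = count_ge_above[OF S] count_ge_above[OF S']
  show ?thesis
  proof
    assume ok: "strip_ok ({l..<u} - S) ({l - 1..<u} - S')"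
    have ok: "max 0 (u - max (l - 1) k) - count_ge S' k \<le> max 0 (u - max l k) - count_ge S k"
      "max 0 (u - max l k) - count_ge S k \<le> max 0 (u - max (l - 1) (k - 1)) - count_ge S' (k - 1)" for k
      using ok unfolding strip_ok_def cU cD by blast+
    \<comment> \<open>Below the window counts are cardinalities, so the two inequalities at
      \<open>l - 1\<close> and at \<open>l\<close> fix their difference.\<close>
    have card: "int (card S') = int (card S) + 1"
      using ok(1)[of "l - 1"] ok(2)[of l] below(1)[of l] below(1)[of "l - 1"] below(2)[of "l - 1"] lu
      by simp
    have "count_ge S k \<le> count_ge S' k \<and> count_ge S' k \<le> count_ge S (k + 1) + 1" for k
    proof -
      consider "k < l" | "l \<le> k" "k < u" | "u \<le> k" by linarith
      then show ?thesis
      proof cases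
        case 1
        then show ?thesis using below(1)[of k] below(2)[of k] below(1)[of "k + 1"] card by simp
      next
        case 2
        then show ?thesis using ok(1)[of k] ok(2)[of "k + 1"] lu by (simp add: max_def split: if_splits)
      next
        case 3
        then show ?thesis using above(1)[of k] above(2)[of k] above(1)[of "k + 1"] by simp
      qed
    qed
    then show "interlaces S S'" using fin card by (auto simp: interlaces_def)
  next
    assume i: "interlaces S S'"
    then have card: "int (card S') = int (card S) + 1" by (simp add: interlaces_def)
    have i: "count_ge S k \<le> count_ge S' k" "count_ge S' k \<le> count_ge S (k + 1) + 1" for k
      using i by (auto simp: interlaces_def)
    show "strip_ok ({l..<u} - S) ({l - 1..<u} - S')"
      unfolding strip_ok_def
    proof (intro allI)
      fix k
      consider "k < l" | "k = l" | "l < k" "k \<le> u" | "u < k" by linarith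
      then show "count_ge ({l - 1..<u} - S') k \<le> count_ge ({l..<u} - S) k \<and>
        count_ge ({l..<u} - S) k \<le> count_ge ({l - 1..<u} - S') (k - 1)"
      proof cases
        case 1
        then show ?thesis unfolding cU cD
          using below(1)[of k] below(2)[of k] below(2)[of "k - 1"] card lu by simp
      next
        case 2
        then show ?thesis unfolding cU cD
          using i(1)[of k] below(1)[of k] below(2)[of "k - 1"] card lu by (simp add: max_def)
      next
        case 3
        then show ?thesis unfolding cU cD
          using i(1)[of k] i(2)[of "k - 1"] by (simp add: max_def)
      next
        case 4
        then show ?thesis unfolding cU cD
          using above(1)[of k] above(2)[of k] above(2)[of "k - 1"] by (simp add: max_def)
      qed
    qed
  qed
qed

text \<open>Here a row is lost at the upper end and the right line carries one lozenge less. The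
  enumerations satisfy s_i \<le> s'_i < s_(i+1), with the weak inequality on the other side than in
  \<open>interlaces\<close>; raising S' by 1 restores that convention.\<close>

lemma strip_ok_right:
  assumes S: "S \<subseteq> {l..<u}" and S': "S' \<subseteq> {l..<u - 1}" and lu: "l < u"
  shows "strip_ok ({l..<u} - S) ({l..<u - 1} - S') \<longleftrightarrow> interlaces ((+) 1 ` S') S"
proof -
  have fin: "finite S" "finite S'" using S S' finite_subset by blast+
  have cU: "count_ge ({l..<u} - S) k = max 0 (u - max l k) - count_ge S k"
    and cD: "count_ge ({l..<u - 1} - S') k = max 0 (u - 1 - max l k) - count_ge S' k" for k
    using S S' by (simp_all add: count_ge_Diff count_ge_interval)
  note below = count_ge_below[OF S] count_ge_below[OF S']
  note above = count_ge_above[OF S] count_ge_above[OF S']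
  have int_iff: "interlaces ((+) 1 ` S') S \<longleftrightarrow> int (card S) = int (card S') + 1 \<and>
    (\<forall>k. count_ge S' (k - 1) \<le> count_ge S k \<and> count_ge S k \<le> count_ge S' k + 1)"
    using fin by (auto simp: interlaces_def count_ge_shift card_image)
  show ?thesis
  proof
    assume ok: "strip_ok ({l..<u} - S) ({l..<u - 1} - S')"
    have ok: "max 0 (u - 1 - max l k) - count_ge S' k \<le> max 0 (u - max l k) - count_ge S k"
      "max 0 (u - max l k) - count_ge S k \<le> max 0 (u - 1 - max l (k - 1)) - count_ge S' (k - 1)" for k
      using ok unfolding strip_ok_def cU cD by blast+
    have card: "int (card S) = int (card S') + 1"
      using ok(1)[of l] ok(2)[of "l"] below(1)[of l] below(2)[of "l - 1"] below(2)[of l] lu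
      by simp
    have "count_ge S' (k - 1) \<le> count_ge S k \<and> count_ge S k \<le> count_ge S' k + 1" for k
    proof -
      consider "k \<le> l" | "l < k" "k < u" | "u \<le> k" by linarith
      then show ?thesis
      proof cases
        case 1
        then show ?thesis using below(1)[of k] below(2)[of k] below(2)[of "k - 1"] card by simp
      next
        case 2
        then show ?thesis using ok(1)[of k] ok(2)[of k] lu by (simp add: max_def split: if_splits)
      next
        case 3
        then show ?thesis using above(1)[of k] above(2)[of k] above(2)[of "k - 1"] by simp
      qed
    qed
    then show "interlaces ((+) 1 ` S') S" using card int_iff by blast
  next
    assume "interlaces ((+) 1 ` S') S"
    then have card: "int (card S) = int (card S') + 1"
      and i: "count_ge S' (k - 1) \<le> count_ge S k" "count_ge S k \<le> count_ge S' k + 1" for k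
      using int_iff by blast+
    show "strip_ok ({l..<u} - S) ({l..<u - 1} - S')"
      unfolding strip_ok_def
    proof (intro allI)
      fix k
      consider "k \<le> l" | "l < k" "k < u" | "u \<le> k" by linarith
      then show "count_ge ({l..<u - 1} - S') k \<le> count_ge ({l..<u} - S) k \<and>
        count_ge ({l..<u} - S) k \<le> count_ge ({l..<u - 1} - S') (k - 1)"
      proof cases
        case 1
        then show ?thesis unfolding cU cD
          using below(1)[of k] below(2)[of k] below(2)[of "k - 1"] card lu by simp
      next
        case 2
        then show ?thesis unfolding cU cD
          using i(1)[of k] i(2)[of k] by (simp add: max_def)
      next
        case 3
        then show ?thesis unfolding cU cD
          using above(1)[of k] above(2)[of k] above(2)[of "k - 1"] by (simp add: max_def)
      qed
    qed
  qed
qed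

lemma interlaces_bounds:
  assumes B: "interlaces B A" and A: "A \<subseteq> {l..<u}"
  shows "B \<subseteq> {l + 1..<u}"
proof
  fix j assume j: "j \<in> B"
  have fin: "finite B" using B by (simp add: interlaces_def)
  have step: "count_ge B j = count_ge B (j + 1) + 1" using count_ge_step[OF fin, of j] j by simp
  have "count_ge A j \<noteq> 0"
    using step B count_ge_nonneg[of B "j + 1"] unfolding interlaces_def by (smt (verit))
  then have "j < u" using count_ge_above[OF A, of j] by (cases "j < u") auto
  moreover have "l < j"
  proof (rule ccontr)
    assume "\<not> l < j"
    then have "count_ge A j = int (card A)" using count_ge_below[OF A] by simp
    then have "int (card A) \<le> count_ge B (j + 1) + 1" using B unfolding interlaces_def by metis
    also have "\<dots> \<le> int (card B)"
      using step card_mono[OF fin, of "{i \<in> B. j \<le> i}"] by (auto simp: count_ge_def)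
    finally show False using B by (simp add: interlaces_def)
  qed
  ultimately show "j \<in> {l + 1..<u}" by simp
qed

text \<open>The element of B enclosed by the consecutive elements j - 1 and j of A is greater than j
  - 1 and at most j, hence equal to j.\<close>

lemma interlaces_forced:
  assumes B: "interlaces B A" and A: "{l..<u} \<subseteq> A"
  shows "{l + 1..<u} \<subseteq> B"
proof
  fix j assume j: "j \<in> {l + 1..<u}"
  then have jA: "j \<in> A" "j - 1 \<in> A" using A by auto
  have fin: "finite A" "finite B" using B by (auto simp: interlaces_def)
  have "count_ge A (j - 1) \<le> count_ge B j + 1" "count_ge B (j + 1) \<le> count_ge A (j + 1)"
    using B unfolding interlaces_def by (metis diff_add_cancel)+
  then show "j \<in> B"
    using count_ge_step[OF fin(1), of "j - 1"] count_ge_step[OF fin(1), of j]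
      count_ge_step[OF fin(2), of j] jA by (auto split: if_splits)
qed

text \<open>One strip is read in two ways. With the blocks filled in it is a strip for
  \<open>strip_ok_left\<close>; between a and hi it is one for \<open>strip_ok_right\<close>; the
  complements are the same sets. So S' interlaces with S exactly when the enlarged sets interlace in
  the opposite order, and the blocks are forced.\<close>

lemma interlaces_blocks:
  fixes lo a hi tp :: int
  assumes "lo \<le> a" "a < hi" "hi \<le> tp" and S': "S' \<subseteq> {a..<hi - 1}"
  defines "X \<equiv> {lo..<a}" and "Y \<equiv> {hi..<tp}"
  shows "bij_betw (\<lambda>S. X \<union> S \<union> Y) {S. S \<subseteq> {a..<hi} \<and> interlaces ((+) 1 ` S') S}
    {B. interlaces B ({lo - 1..<a} \<union> S' \<union> {hi - 1..<tp})}"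
proof -
  let ?A' = "{lo - 1..<a} \<union> S' \<union> {hi - 1..<tp}"
  have iff: "interlaces (X \<union> S \<union> Y) ?A' \<longleftrightarrow> interlaces ((+) 1 ` S') S" if S: "S \<subseteq> {a..<hi}" for S
  proof -
    have "interlaces (X \<union> S \<union> Y) ?A' \<longleftrightarrow> strip_ok ({lo..<tp} - (X \<union> S \<union> Y)) ({lo - 1..<tp} - ?A')"
      using assms S by (intro strip_ok_left[symmetric]) fastforce+
    also have "{lo..<tp} - (X \<union> S \<union> Y) = {a..<hi} - S" using assms S by auto
    also have "{lo - 1..<tp} - ?A' = {a..<hi - 1} - S'" using assms by auto
    also have "strip_ok ({a..<hi} - S) ({a..<hi - 1} - S') \<longleftrightarrow> interlaces ((+) 1 ` S') S"
      using assms S by (intro strip_ok_right) auto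
    finally show ?thesis .
  qed
  have "inj_on (\<lambda>S. X \<union> S \<union> Y) {S. S \<subseteq> {a..<hi} \<and> interlaces ((+) 1 ` S') S}"
  proof (rule inj_onI)
    fix S T assume "S \<in> {S. S \<subseteq> {a..<hi} \<and> interlaces ((+) 1 ` S') S}"
      "T \<in> {S. S \<subseteq> {a..<hi} \<and> interlaces ((+) 1 ` S') S}" and eq: "X \<union> S \<union> Y = X \<union> T \<union> Y"
    then have "S \<inter> (X \<union> Y) = {}" "T \<inter> (X \<union> Y) = {}" by (auto simp: X_def Y_def)
    then show "S = T" using eq by blast
  qed
  moreover have "B \<in> (\<lambda>S. X \<union> S \<union> Y) ` {S. S \<subseteq> {a..<hi} \<and> interlaces ((+) 1 ` S') S}"
    if B: "interlaces B ?A'" for B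
  proof -
    have sub: "B \<subseteq> {lo..<tp}"
      using interlaces_bounds[OF B, of "lo - 1" tp] assms by fastforce
    have "X \<subseteq> B" "Y \<subseteq> B"
      using interlaces_forced[OF B, of "lo - 1" a] interlaces_forced[OF B, of "hi - 1" tp]
      by (auto simp: X_def Y_def)
    then have eq: "B = X \<union> (B \<inter> {a..<hi}) \<union> Y" using sub by (auto simp: X_def Y_def)
    then have "interlaces ((+) 1 ` S') (B \<inter> {a..<hi})"
      using iff[of "B \<inter> {a..<hi}"] B by auto
    then show ?thesis using eq by blast
  qed
  ultimately show ?thesis using iff by (auto simp: bij_betw_def)
qed

section \<open>Summation over a cut between blocks of forced lozenges\<close>

context generic_q
begin

lemma powi_mult: "q powi m * q powi n = q powi (m + n)"
  using q_nonzero by (simp add: power_int_add)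

lemma wt_Un_disjoint:
  "finite A \<Longrightarrow> finite B \<Longrightarrow> A \<inter> B = {} \<Longrightarrow> wt (A \<union> B) = wt A * wt B"
  by (simp add: wt_def sum.union_disjoint powi_mult add.commute)

lemma wt_shift: "wt ((+) 1 ` A) = q powi (- int (card A)) * wt A"
  by (simp add: wt_def sum.reindex powi_mult sum.distrib card_image)

lemma cross_Un_left:
  "finite A \<Longrightarrow> finite A' \<Longrightarrow> A \<inter> A' = {} \<Longrightarrow> cross (A \<union> A') B = cross A B * cross A' B"
  unfolding cross_def by (subst prod.union_disjoint) (simp_all add: prod.distrib)

lemma cross_Un_right:
  "finite B \<Longrightarrow> finite B' \<Longrightarrow> B \<inter> B' = {} \<Longrightarrow> cross A (B \<union> B') = cross A B * cross A B'"
  unfolding cross_def by (subst prod.union_disjoint) simp_all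

lemma vdm_Un:
  assumes "finite A" "finite B" and less: "\<And>u v. u \<in> A \<Longrightarrow> v \<in> B \<Longrightarrow> u < v"
  shows "vdm (A \<union> B) = vdm A * vdm B * cross A B"
proof -
  define f where "f v u = q powi (- (v + 1)) * q_int q (nat (v - u))" for v u
  have disj: "A \<inter> B = {}" using less by fastforce
  have "vdm (A \<union> B) = (\<Prod>v\<in>A. \<Prod>u\<in>{u \<in> A \<union> B. u < v}. f v u) * (\<Prod>v\<in>B. \<Prod>u\<in>{u \<in> A \<union> B. u < v}. f v u)"
    unfolding vdm_def f_def by (rule prod.union_disjoint[OF assms(1,2) disj])
  also have "(\<Prod>v\<in>A. \<Prod>u\<in>{u \<in> A \<union> B. u < v}. f v u) = vdm A"
  proof -
    have "{u \<in> A \<union> B. u < v} = {u \<in> A. u < v}" if "v \<in> A" for v using less[of v] that by fastforce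
    then show ?thesis unfolding vdm_def f_def by (intro prod.cong) auto
  qed
  also have "(\<Prod>v\<in>B. \<Prod>u\<in>{u \<in> A \<union> B. u < v}. f v u) = (\<Prod>v\<in>B. (\<Prod>u\<in>A. f v u) * (\<Prod>u\<in>{u \<in> B. u < v}. f v u))"
  proof (rule prod.cong[OF refl])
    fix v assume "v \<in> B"
    then have "{u \<in> A \<union> B. u < v} = A \<union> {u \<in> B. u < v}" using less by auto
    then show "(\<Prod>u\<in>{u \<in> A \<union> B. u < v}. f v u) = (\<Prod>u\<in>A. f v u) * (\<Prod>u\<in>{u \<in> B. u < v}. f v u)"
      using assms(1,2) disj by (auto intro!: prod.union_disjoint)
  qed
  also have "\<dots> = cross A B * vdm B" unfolding prod.distrib cross_def vdm_def f_def ..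
  finally show ?thesis by (simp add: mult_ac)
qed

lemma sum_card_less:
  fixes A :: "int set"
  assumes "finite A"
  shows "(\<Sum>v\<in>A. card {u \<in> A. u < v}) = card A choose 2"
  using assms
proof (induction A rule: finite_linorder_max_induct)
  case empty
  then show ?case by simp
next
  case (insert b A)
  have "{u \<in> insert b A. u < v} = {u \<in> A. u < v}" if "v \<in> A" for v using insert.hyps(2) that by auto
  moreover have "{u \<in> insert b A. u < b} = A" using insert.hyps(2) by auto
  moreover have "b \<notin> A" using insert.hyps(2) by auto
  moreover have "Suc n choose 2 = n + (n choose 2)" for n by (simp add: numeral_2_eq_2)
  ultimately show ?case using insert by simp
qed

lemma vdm_shift:
  assumes "finite A"
  shows "vdm ((+) 1 ` A) = q powi (- int (card A choose 2)) * vdm A"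
proof -
  have "vdm ((+) 1 ` A) = (\<Prod>v\<in>A. \<Prod>u\<in>{u \<in> A. u < v}. inverse q * (q powi (- (v + 1)) * q_int q (nat (v - u))))"
  proof -
    have "{u \<in> (+) 1 ` A. u < 1 + v} = (+) 1 ` {u \<in> A. u < v}" for v by auto
    moreover have "q powi (- (1 + v + 1)) = inverse q * q powi (- (v + 1))" for v
      using powi_mult[of "-1" "- (v + 1)"] by simp
    ultimately show ?thesis
      unfolding vdm_def by (simp only: prod.reindex inj_on_add comp_def add_diff_cancel_left mult.assoc)
  qed
  also have "\<dots> = (\<Prod>v\<in>A. inverse q ^ card {u \<in> A. u < v}) * vdm A"
    unfolding vdm_def prod.distrib[symmetric] by (intro prod.cong) (auto simp: prod.distrib)
  also have "(\<Prod>v\<in>A. inverse q ^ card {u \<in> A. u < v}) = q powi (- int (card A choose 2))"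
    unfolding power_sum[symmetric] sum_card_less[OF assms] power_int_minus
    by (simp add: power_inverse)
  finally show ?thesis .
qed

text \<open>A translation by 1 costs one factor q per element, from the weight, and one per pair,
  from the Vandermonde factors.\<close>

lemma patterns_shift:
  assumes "finite A"
  shows "wt ((+) 1 ` A) * patterns ((+) 1 ` A) = q powi (- int (Suc (card A) choose 2)) * (wt A * patterns A)"
proof -
  have "q powi (- int (Suc (card A) choose 2)) = q powi (- int (card A)) * q powi (- int (card A choose 2))"
    unfolding powi_mult by (simp add: numeral_2_eq_2)
  then show ?thesis
    unfolding patterns_def wt_shift vdm_shift[OF assms] by (simp add: card_image)
qed

text \<open>The sum over a cut of a hexagon: blocks of forced left lozenges surround S on one side
  of the cut, while the other side has none.\<close>

definition block_sum :: "int \<Rightarrow> int \<Rightarrow> int \<Rightarrow> int \<Rightarrow> nat \<Rightarrow> 'a" where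
  "block_sum lo a hi tp m = (\<Sum>S | S \<subseteq> {a..<hi} \<and> card S = m.
     wt S * patterns ({lo..<a} \<union> S \<union> {hi..<tp}) * patterns S)"

text \<open>Moves the cut by one line. \<open>patterns S\<close> is expanded by one row, a translate
  of S', and the sums are exchanged; by \<open>interlaces_blocks\<close> the inner sum over S is the
  recursion for S' between blocks extended by one row. The prefactor removes the block weights that
  this recursion contains and accounts for the translation.\<close>

lemma block_sum_step:
  assumes "lo \<le> a" "a < hi" "hi \<le> tp"
  shows "block_sum lo a hi tp (Suc m) = q powi ((\<Sum>j\<in>{lo..<a}. j + 1) + (\<Sum>j\<in>{hi..<tp}. j + 1) - int (Suc m choose 2))
    * block_sum (lo - 1) a (hi - 1) tp m"
proof -
  define X where "X = {lo..<a}"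
  define Y where "Y = {hi..<tp}"
  define P where "P = {S. S \<subseteq> {a..<hi} \<and> card S = Suc m}"
  define P' where "P' = {S. S \<subseteq> {a..<hi - 1} \<and> card S = m}"
  have fin: "finite P" "finite P'"
    using finite_subset[of P "Pow {a..<hi}"] finite_subset[of P' "Pow {a..<hi - 1}"]
    by (auto simp: P_def P'_def)
  have finP: "finite S" if "S \<in> P \<or> S \<in> P'" for S
    using that finite_subset[of S] by (auto simp: P_def P'_def)
  have patS: "patterns S = (\<Sum>S' | S' \<in> P' \<and> interlaces ((+) 1 ` S') S. wt ((+) 1 ` S') * patterns ((+) 1 ` S'))"
    if S: "S \<in> P" for S
  proof -
    have S': "finite S" "S \<noteq> {}" "S \<subseteq> {a..<hi}" "card S = Suc m" using S finP[of S] by (auto simp: P_def)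
    have "bij_betw ((`) ((+) 1)) {S'. S' \<in> P' \<and> interlaces ((+) 1 ` S') S} {B. interlaces B S}"
    proof (rule bij_betw_byWitness[where f' = "(`) ((+) (-1))"])
      show "(`) ((+) (-1)) ` {B. interlaces B S} \<subseteq> {S'. S' \<in> P' \<and> interlaces ((+) 1 ` S') S}"
      proof (rule image_subsetI)
        fix B assume "B \<in> {B. interlaces B S}"
        then have B: "interlaces B S" by simp
        have "B \<subseteq> {a + 1..<hi}" using interlaces_bounds[OF B S'(3)] .
        moreover have "card B = m" using B S' by (simp add: interlaces_def)
        moreover have "(+) 1 ` (+) (-1) ` B = B" by (simp add: image_image)
        ultimately show "(+) (-1) ` B \<in> {S'. S' \<in> P' \<and> interlaces ((+) 1 ` S') S}"
          using B by (auto simp: P'_def card_image)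
      qed
    qed (auto simp: image_image)
    then show ?thesis
      unfolding patterns_recursion[OF S'(1,2)]
      by (rule sum.reindex_bij_betw[symmetric])
  qed
  have patS': "patterns ({lo - 1..<a} \<union> S' \<union> {hi - 1..<tp})
    = (\<Sum>S | S \<in> P \<and> interlaces ((+) 1 ` S') S. wt (X \<union> S \<union> Y) * patterns (X \<union> S \<union> Y))"
    if S': "S' \<in> P'" for S'
  proof -
    have fS': "finite S'" "card S' = m" "S' \<subseteq> {a..<hi - 1}" using S' finP[of S'] by (auto simp: P'_def)
    have eq: "{S. S \<subseteq> {a..<hi} \<and> interlaces ((+) 1 ` S') S} = {S. S \<in> P \<and> interlaces ((+) 1 ` S') S}"
      using fS' by (auto simp: P_def interlaces_def card_image)
    show ?thesis
      unfolding eq[symmetric] X_def Y_def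
      by (subst patterns_recursion) (use assms fS' in \<open>auto intro!: sum.reindex_bij_betw[symmetric] interlaces_blocks\<close>)
  qed
  have wtXY: "wt (X \<union> S \<union> Y) = wt X * wt Y * wt S" if "S \<in> P" for S
  proof -
    have "finite S" "X \<inter> S = {}" "(X \<union> S) \<inter> Y = {}"
      using finP[of S] that assms by (fastforce simp: P_def X_def Y_def)+
    then show ?thesis by (simp add: wt_Un_disjoint X_def Y_def mult_ac)
  qed
  have shift: "wt ((+) 1 ` S') * patterns ((+) 1 ` S') = q powi (- int (Suc m choose 2)) * (wt S' * patterns S')"
    if "S' \<in> P'" for S'
    using that finP[of S'] patterns_shift[of S'] by (simp add: P'_def)
  have wt_nz: "wt A \<noteq> 0" for A using q_nonzero by (simp add: wt_def)
  have "block_sum lo a hi tp (Suc m) = (\<Sum>S\<in>P. wt S * patterns (X \<union> S \<union> Y) * patterns S)"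
    by (simp add: block_sum_def P_def X_def Y_def)
  also have "\<dots> = (\<Sum>S\<in>P. \<Sum>S' | S' \<in> P' \<and> interlaces ((+) 1 ` S') S.
      wt S * patterns (X \<union> S \<union> Y) * (q powi (- int (Suc m choose 2)) * (wt S' * patterns S')))"
    by (rule sum.cong[OF refl]) (simp add: patS shift sum_distrib_left)
  also have "\<dots> = (\<Sum>S'\<in>P'. \<Sum>S | S \<in> P \<and> interlaces ((+) 1 ` S') S.
      wt S * patterns (X \<union> S \<union> Y) * (q powi (- int (Suc m choose 2)) * (wt S' * patterns S')))"
    by (rule sum.swap_restrict[OF fin])
  also have "\<dots> = (\<Sum>S'\<in>P'. q powi (- int (Suc m choose 2)) * inverse (wt X * wt Y)
      * (wt S' * patterns ({lo - 1..<a} \<union> S' \<union> {hi - 1..<tp}) * patterns S'))"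
  proof (rule sum.cong[OF refl])
    fix S' assume S': "S' \<in> P'"
    have "patterns ({lo - 1..<a} \<union> S' \<union> {hi - 1..<tp})
      = wt X * wt Y * (\<Sum>S | S \<in> P \<and> interlaces ((+) 1 ` S') S. wt S * patterns (X \<union> S \<union> Y))"
      unfolding patS'[OF S'] sum_distrib_left by (rule sum.cong) (auto simp: wtXY)
    then have "(\<Sum>S | S \<in> P \<and> interlaces ((+) 1 ` S') S. wt S * patterns (X \<union> S \<union> Y))
      = inverse (wt X * wt Y) * patterns ({lo - 1..<a} \<union> S' \<union> {hi - 1..<tp})"
      using wt_nz[of X] wt_nz[of Y] by (simp add: field_simps)
    then show "(\<Sum>S | S \<in> P \<and> interlaces ((+) 1 ` S') S.
        wt S * patterns (X \<union> S \<union> Y) * (q powi (- int (Suc m choose 2)) * (wt S' * patterns S')))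
      = q powi (- int (Suc m choose 2)) * inverse (wt X * wt Y)
        * (wt S' * patterns ({lo - 1..<a} \<union> S' \<union> {hi - 1..<tp}) * patterns S')"
      unfolding sum_distrib_right[symmetric] by (simp only: mult_ac)
  qed
  also have "\<dots> = q powi (- int (Suc m choose 2)) * inverse (wt X * wt Y) * block_sum (lo - 1) a (hi - 1) tp m"
    by (simp add: block_sum_def P'_def sum_distrib_left)
  also have "inverse (wt X * wt Y) = q powi ((\<Sum>j\<in>X. j + 1) + (\<Sum>j\<in>Y. j + 1))"
    unfolding wt_def powi_mult power_int_minus[symmetric] by (simp add: add.commute)
  finally show ?thesis
    by (simp only: powi_mult X_def Y_def) (simp add: algebra_simps)
qed

end

section \<open>Evaluation of the sum over the middle line\<close>

definition interval_sum :: "int \<Rightarrow> int \<Rightarrow> int" where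
  "interval_sum l u = (\<Sum>j\<in>{l..<u}. j + 1)"

lemma interval_sum_closed_form:
  assumes "l \<le> u"
  shows "2 * interval_sum l u = u * (u + 1) - l * (l + 1)"
  using assms
proof (induction u rule: int_ge_induct)
  case (step u)
  have "{l..<u + 1} = insert u {l..<u}" using step by auto
  then have "interval_sum l (u + 1) = interval_sum l u + (u + 1)" by (simp add: interval_sum_def)
  then show ?case using step by (simp add: algebra_simps)
qed (simp add: interval_sum_def)

text \<open>G and L will be the hyperfactorials at a + x + y + z and b + y + z + t, which arise on
  both sides of a fraction bar and are absent from \<open>P_prod\<close>.\<close>

lemma regroup_fractions:
  fixes A B :: "'a::field"
  assumes "G \<noteq> 0" "L \<noteq> 0"
  shows "(A * Y / (B * C) * (X * A1 / D) * (Bb * T / F) * (G * I / (J * K)) * (I * L / (N * V)))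
     * (P * Q * (R * Z / (G * L)) / U)
     = (X * Y * Z * T * A1 * Bb) / (D * F * C) * ((R * A) / (N * U * J)) * ((P * Q * I\<^sup>2) / (B * K * V))"
proof -
  have "(A * Y / (B * C) * (X * A1 / D) * (Bb * T / F) * (G * I / (J * K)) * (I * L / (N * V)))
     * (P * Q * (R * Z / (G * L)) / U) = (A * Y * X * A1 * Bb * T * I * I * P * Q * R * Z * (G * inverse G) * (L * inverse L))
     * inverse B * inverse C * inverse D * inverse F * inverse J * inverse K * inverse N * inverse V * inverse U"
    by (simp only: divide_inverse inverse_mult_distrib mult_ac)
  also have "G * inverse G = 1" using assms by simp
  also have "L * inverse L = 1" using assms by simp
  finally show ?thesis
    by (simp only: divide_inverse inverse_mult_distrib mult_ac mult_1 mult_1_right power2_eq_square)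
qed

text \<open>The exponent as it accumulates in \<open>main_sum_eq\<close>. The sum over i < y comes
  from moving the cut y times, the next three terms from the Vandermonde product of two intervals,
  the last four from dividing by the cross factors that do not involve S.\<close>

definition main_exponent :: "nat \<Rightarrow> nat \<Rightarrow> nat \<Rightarrow> nat \<Rightarrow> nat \<Rightarrow> nat \<Rightarrow> int" where
  "main_exponent a b x y z t =
     (\<Sum>i<y. interval_sum (- int x - int i) (int a) + interval_sum (int (a + y + z) - int i) (int (a + y + z + b + t)) - int ((y - i) choose 2))
     - (\<Sum>i<x + y + a. int i * (- int x - int y + int i + 1))
     - (\<Sum>i<y + b + t. int i * (int a + int z + int i + 1))
     - int (x + y + a) * interval_sum (int (a + z)) (int (a + y + z + b + t))
     + int x * interval_sum 0 (int a)
     + int b * interval_sum (int (a + y + z + b)) (int (a + y + z + b + t))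
     + int x * interval_sum (int (a + y + z)) (int (a + y + z + b))
     + int a * interval_sum (int (a + y + z + b)) (int (a + y + z + b + t))"

context generic_q
begin

lemma prod_q_int_interval:
  assumes "l + int m \<le> v"
  shows "(\<Prod>u\<in>{l..<l + int m}. q_int q (nat (v - u))) = q_fact q (nat (v - l)) / q_fact q (nat (v - l) - m)"
  using assms
proof (induction m)
  case 0
  then show ?case using q_fact_nonzero by simp
next
  case (Suc m)
  have ins: "{l..<l + int (Suc m)} = insert (l + int m) {l..<l + int m}" by auto
  define k where "k = nat (v - l) - Suc m"
  have k: "nat (v - l) - m = Suc k" "nat (v - (l + int m)) = Suc k" "nat (v - l) - Suc m = k"
    using Suc.prems unfolding k_def by arith+
  have f: "q_fact q (Suc k) = q_fact q k * q_int q (Suc k)" by (simp add: q_fact_def)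
  have "(\<Prod>u\<in>{l..<l + int (Suc m)}. q_int q (nat (v - u)))
    = q_int q (Suc k) * (q_fact q (nat (v - l)) / q_fact q (Suc k))"
    unfolding ins using Suc k by simp
  also have "\<dots> = q_fact q (nat (v - l)) / q_fact q k"
    unfolding f using q_int_nonzero[of "Suc k"] q_fact_nonzero[of k] by simp
  finally show ?case using k by simp
qed

lemma prod_q_fact: "(\<Prod>i<k. q_fact q (c + i)) = q_H q (c + k) / q_H q c"
  by (induction k) (simp_all add: q_H_Suc q_H_nonzero)

lemma prod_interval_shift:
  fixes f :: "int \<Rightarrow> 'a"
  shows "(\<Prod>v\<in>{l..<l + int k}. f v) = (\<Prod>i<k. f (l + int i))"
  by (rule prod.reindex_bij_witness[of _ "\<lambda>i. l + int i" "\<lambda>v. nat (v - l)"]) auto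

lemma prod_powi_sum: "finite I \<Longrightarrow> (\<Prod>i\<in>I. q powi f i) = q powi (\<Sum>i\<in>I. f i)"
  by (induction I rule: finite_induct) (simp_all add: powi_mult)

text \<open>Here g is the length of the gap. The double product of q-integers gives quotients of
  q-factorials along one interval, and these give hyperfactorials along the other.\<close>

lemma cross_intervals:
  fixes l :: int and m g k :: nat
  defines "h \<equiv> l + int m + int g"
  shows "cross {l..<l + int m} {h..<h + int k} = q powi (- (int m * interval_sum h (h + int k)))
    * (q_H q (m + g + k) * q_H q g / (q_H q (m + g) * q_H q (g + k)))"
proof -
  have "cross {l..<l + int m} {h..<h + int k}
    = (\<Prod>v\<in>{h..<h + int k}. q powi (- (int m * (v + 1))) * (q_fact q (nat (v - l)) / q_fact q (nat (v - l) - m)))"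
    unfolding cross_def
  proof (rule prod.cong[OF refl])
    fix v assume v: "v \<in> {h..<h + int k}"
    have "(\<Prod>u\<in>{l..<l + int m}. q powi (- (v + 1)) * q_int q (nat (v - u)))
      = (q powi (- (v + 1))) ^ m * (\<Prod>u\<in>{l..<l + int m}. q_int q (nat (v - u)))"
      by (simp add: prod.distrib)
    also have "(q powi (- (v + 1))) ^ m = q powi (- (int m * (v + 1)))"
      by (simp add: power_int_mult[symmetric] power_int_power' algebra_simps)
    also have "(\<Prod>u\<in>{l..<l + int m}. q_int q (nat (v - u))) = q_fact q (nat (v - l)) / q_fact q (nat (v - l) - m)"
      using v by (intro prod_q_int_interval) (simp add: h_def)
    finally show "(\<Prod>u\<in>{l..<l + int m}. q powi (- (v + 1)) * q_int q (nat (v - u)))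
      = q powi (- (int m * (v + 1))) * (q_fact q (nat (v - l)) / q_fact q (nat (v - l) - m))" .
  qed
  also have "\<dots> = (\<Prod>v\<in>{h..<h + int k}. q powi (- (int m * (v + 1))))
      * (\<Prod>v\<in>{h..<h + int k}. q_fact q (nat (v - l)) / q_fact q (nat (v - l) - m))"
    by (rule prod.distrib)
  also have "(\<Prod>v\<in>{h..<h + int k}. q powi (- (int m * (v + 1)))) = q powi (- (int m * interval_sum h (h + int k)))"
    by (simp add: prod_powi_sum interval_sum_def sum_negf sum_distrib_left)
  also have "(\<Prod>v\<in>{h..<h + int k}. q_fact q (nat (v - l)) / q_fact q (nat (v - l) - m))
    = (\<Prod>i<k. q_fact q ((m + g) + i) / q_fact q (g + i))"
    unfolding prod_interval_shift by (intro prod.cong refl) (simp add: h_def nat_add_distrib add.assoc)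
  also have "\<dots> = q_H q (m + g + k) * q_H q g / (q_H q (m + g) * q_H q (g + k))"
    by (simp only: prod_dividef prod_q_fact) (simp add: field_simps)
  finally show ?thesis .
qed

lemma vdm_interval:
  "vdm {l..<l + int n} = q powi (- (\<Sum>i<n. int i * (l + int i + 1))) * q_H q n"
proof -
  have "vdm {l..<l + int n} = (\<Prod>i<n. \<Prod>u\<in>{u \<in> {l..<l + int n}. u < l + int i}.
      q powi (- (l + int i + 1)) * q_int q (nat (l + int i - u)))"
    unfolding vdm_def prod_interval_shift ..
  also have "\<dots> = (\<Prod>i<n. q powi (- (int i * (l + int i + 1))) * q_fact q i)"
  proof (rule prod.cong[OF refl])
    fix i assume i: "i \<in> {..<n}"
    have "{u \<in> {l..<l + int n}. u < l + int i} = {l..<l + int i}" using i by auto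
    then have "(\<Prod>u\<in>{u \<in> {l..<l + int n}. u < l + int i}. q powi (- (l + int i + 1)) * q_int q (nat (l + int i - u)))
      = (q powi (- (l + int i + 1))) ^ i * (\<Prod>u\<in>{l..<l + int i}. q_int q (nat (l + int i - u)))"
      by (simp add: prod.distrib)
    also have "(q powi (- (l + int i + 1))) ^ i = q powi (- (int i * (l + int i + 1)))"
      by (simp add: power_int_mult[symmetric] power_int_power' algebra_simps)
    also have "(\<Prod>u\<in>{l..<l + int i}. q_int q (nat (l + int i - u))) = q_fact q i"
      by (subst prod_q_int_interval) (simp_all add: q_fact_def)
    finally show "(\<Prod>u\<in>{u \<in> {l..<l + int n}. u < l + int i}.
        q powi (- (l + int i + 1)) * q_int q (nat (l + int i - u)))
      = q powi (- (int i * (l + int i + 1))) * q_fact q i" .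
  qed
  also have "\<dots> = q powi (- (\<Sum>i<n. int i * (l + int i + 1))) * q_H q n"
    by (simp only: prod.distrib prod_powi_sum[OF finite_lessThan] sum_negf q_H_def)
  finally show ?thesis .
qed

lemma patterns_empty: "patterns {} = 1"
  by (simp add: patterns_def vdm_def q_H_def)

lemma block_sum_0: "block_sum lo a hi tp 0 = patterns ({lo..<a} \<union> {hi..<tp})"
proof -
  have "{S. S \<subseteq> {a..<hi} \<and> card S = 0} = {{}}" using finite_subset[of _ "{a..<hi}"] by auto
  then show ?thesis by (simp add: block_sum_def patterns_empty wt_def)
qed

lemma block_sum_eq:
  assumes "lo \<le> a" "a + int m \<le> hi" "hi \<le> tp"
  shows "block_sum lo a hi tp m = q powi (\<Sum>i<m. interval_sum (lo - int i) a + interval_sum (hi - int i) tp - int ((m - i) choose 2))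
    * patterns ({lo - int m..<a} \<union> {hi - int m..<tp})"
  using assms
proof (induction m arbitrary: lo hi)
  case 0
  then show ?case by (simp add: block_sum_0)
next
  case (Suc m)
  have "block_sum lo a hi tp (Suc m) = q powi (interval_sum lo a + interval_sum hi tp - int (Suc m choose 2))
    * block_sum (lo - 1) a (hi - 1) tp m"
    using Suc.prems unfolding interval_sum_def by (intro block_sum_step) auto
  also have "block_sum (lo - 1) a (hi - 1) tp m
    = q powi (\<Sum>i<m. interval_sum (lo - 1 - int i) a + interval_sum (hi - 1 - int i) tp - int ((m - i) choose 2))
      * patterns ({lo - 1 - int m..<a} \<union> {hi - 1 - int m..<tp})"
    using Suc.prems by (intro Suc.IH) auto
  finally show ?case
    by (subst sum.lessThan_Suc_shift) (simp add: mult.assoc[symmetric] powi_mult diff_diff_eq)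
qed

lemma vdm_Un3:
  assumes "finite A" "finite B" "finite C"
    and "\<And>u v. u \<in> A \<Longrightarrow> v \<in> B \<Longrightarrow> u < v" "\<And>u v. u \<in> A \<union> B \<Longrightarrow> v \<in> C \<Longrightarrow> u < v"
  shows "vdm (A \<union> B \<union> C) = vdm A * vdm B * cross A B * vdm C * (cross A C * cross B C)"
proof -
  have "A \<inter> B = {}" using assms(4) by fastforce
  moreover have "vdm (A \<union> B \<union> C) = vdm (A \<union> B) * vdm C * cross (A \<union> B) C"
    using assms by (intro vdm_Un) auto
  ultimately show ?thesis using assms by (simp add: vdm_Un[of A B] cross_Un_left)
qed

text \<open>A count of pairs. Pairs inside S occur twice on both sides, all other pairs once. The
  pairs absent from the two Vandermonde products on the left join a block with index 0 to a block
  with index 1; they make up the extra factor, which does not depend on S.\<close>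

lemma vdm_regroup:
  assumes fin: "finite X0" "finite X1" "finite S" "finite Y1" "finite Y0"
    and "\<And>u v. u \<in> X0 \<Longrightarrow> v \<in> X1 \<Longrightarrow> u < v" "\<And>u v. u \<in> X0 \<union> X1 \<Longrightarrow> v \<in> S \<Longrightarrow> u < v"
    "\<And>u v. u \<in> X0 \<union> X1 \<union> S \<Longrightarrow> v \<in> Y1 \<union> Y0 \<Longrightarrow> u < v" "\<And>u v. u \<in> Y1 \<Longrightarrow> v \<in> Y0 \<Longrightarrow> u < v"
  shows "vdm (X0 \<union> S \<union> Y0) * vdm (X1 \<union> S \<union> Y1) * (cross X0 X1 * cross Y1 Y0 * cross X0 Y1 * cross X1 Y0)
    = vdm ((X0 \<union> X1) \<union> S \<union> (Y1 \<union> Y0)) * vdm S"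
proof -
  have disj: "X0 \<inter> X1 = {}" "(X0 \<union> X1) \<inter> S = {}" "X0 \<inter> S = {}" "X1 \<inter> S = {}" "Y1 \<inter> Y0 = {}"
    using assms(6-9) by fastforce+
  have 1: "vdm (X0 \<union> S \<union> Y0) = vdm X0 * vdm S * cross X0 S * vdm Y0 * (cross X0 Y0 * cross S Y0)"
    using assms by (intro vdm_Un3) auto
  have 2: "vdm (X1 \<union> S \<union> Y1) = vdm X1 * vdm S * cross X1 S * vdm Y1 * (cross X1 Y1 * cross S Y1)"
    using assms by (intro vdm_Un3) auto
  have "vdm ((X0 \<union> X1) \<union> S \<union> (Y1 \<union> Y0)) = vdm ((X0 \<union> X1) \<union> S) * vdm (Y1 \<union> Y0) * cross ((X0 \<union> X1) \<union> S) (Y1 \<union> Y0)"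
    using assms by (intro vdm_Un) auto
  also have "vdm ((X0 \<union> X1) \<union> S) = vdm (X0 \<union> X1) * vdm S * cross (X0 \<union> X1) S"
    using assms by (intro vdm_Un) auto
  also have "vdm (X0 \<union> X1) = vdm X0 * vdm X1 * cross X0 X1"
    using assms by (intro vdm_Un) auto
  also have "vdm (Y1 \<union> Y0) = vdm Y1 * vdm Y0 * cross Y1 Y0"
    using assms by (intro vdm_Un) auto
  also have "cross ((X0 \<union> X1) \<union> S) (Y1 \<union> Y0) = cross X0 Y1 * cross X0 Y0 * (cross X1 Y1 * cross X1 Y0) * (cross S Y1 * cross S Y0)"
    using fin disj by (simp add: cross_Un_left cross_Un_right)
  also have "cross (X0 \<union> X1) S = cross X0 S * cross X1 S"
    using fin disj by (simp add: cross_Un_left)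
  finally show ?thesis unfolding 1 2 by (simp only: mult_ac)
qed

text \<open>The first pattern factor belongs to the trapezoid left of the line i = x, the second to
  the one on its right, where the blocks are the left sides of the removed triangles.\<close>

definition main_sum :: "nat \<Rightarrow> nat \<Rightarrow> nat \<Rightarrow> nat \<Rightarrow> nat \<Rightarrow> nat \<Rightarrow> 'a" where
  "main_sum a b x y z t = (\<Sum>S | S \<subseteq> {int a..<int (a + y + z)} \<and> card S = y. wt S
     * patterns ({- int x..<0} \<union> S \<union> {int (a + y + z + b)..<int (a + y + z + b + t)})
     * patterns ({0..<int a} \<union> S \<union> {int (a + y + z)..<int (a + y + z + b)}))"

lemma main_sum_eq: "main_sum a b x y z t = q powi main_exponent a b x y z t * P_prod q a b x y z t"
proof -
  define h where "h = a + y + z"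
  define X0 where "X0 = {- int x..<0}"
  define X1 where "X1 = {0..<int a}"
  define Y1 where "Y1 = {int h..<int (h + b)}"
  define Y0 where "Y0 = {int (h + b)..<int (h + b + t)}"
  define W where "W = cross X0 X1 * cross Y1 Y0 * cross X0 Y1 * cross X1 Y0"
  \<comment> \<open>The part of the summand that is independent of S: \<open>vdm_regroup\<close>
    contributes 1 / W, and the hyperfactorials change because the cardinalities x + y + t and a + y
    + b become x + a + y + b + t and y.\<close>
  define K where "K = q_H q (x + a + y + b + t) * q_H q y / (q_H q (x + y + t) * q_H q (a + y + b) * W)"
  have XY: "X0 \<union> X1 = {- int x..<int a}" "Y1 \<union> Y0 = {int h..<int (h + b + t)}"
    by (auto simp: X0_def X1_def Y0_def Y1_def)
  have Wnz: "W \<noteq> 0"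
    unfolding W_def cross_def
    using q_nonzero q_int_nonzero by (auto simp: X0_def X1_def Y0_def Y1_def h_def)
  have "main_sum a b x y z t = (\<Sum>S | S \<subseteq> {int a..<int h} \<and> card S = y. K * (wt S
     * patterns ({- int x..<int a} \<union> S \<union> {int h..<int (h + b + t)}) * patterns S))"
    unfolding main_sum_def h_def[symmetric] X0_def[symmetric] X1_def[symmetric] Y0_def[symmetric] Y1_def[symmetric] XY[symmetric]
  proof (rule sum.cong[OF refl])
    fix S assume "S \<in> {S. S \<subseteq> {int a..<int h} \<and> card S = y}"
    then have S: "S \<subseteq> {int a..<int h}" "card S = y" "finite S" using finite_subset[of S] by auto
    have reg: "vdm (X0 \<union> S \<union> Y0) * vdm (X1 \<union> S \<union> Y1) * W = vdm (X0 \<union> X1 \<union> S \<union> (Y1 \<union> Y0)) * vdm S"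
      unfolding W_def using S by (intro vdm_regroup) (auto simp: X0_def X1_def Y0_def Y1_def h_def subset_iff)
    have c1: "card (X0 \<union> S \<union> Y0) = x + y + t"
    proof -
      have "X0 \<inter> S = {}" "(X0 \<union> S) \<inter> Y0 = {}" using S by (auto simp: X0_def Y0_def h_def subset_iff)
      then show ?thesis using S by (simp add: card_Un_disjoint X0_def Y0_def)
    qed
    have c2: "card (X1 \<union> S \<union> Y1) = a + y + b"
    proof -
      have "X1 \<inter> S = {}" "(X1 \<union> S) \<inter> Y1 = {}" using S by (auto simp: X1_def Y1_def h_def subset_iff)
      then show ?thesis using S by (simp add: card_Un_disjoint X1_def Y1_def)
    qed
    have c3: "card (X0 \<union> X1 \<union> S \<union> (Y1 \<union> Y0)) = x + a + y + b + t"
    proof -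
      have "(X0 \<union> X1) \<inter> S = {}" "(X0 \<union> X1 \<union> S) \<inter> (Y1 \<union> Y0) = {}"
        using S unfolding XY by (auto simp: h_def subset_iff)
      then show ?thesis using S unfolding XY by (simp add: card_Un_disjoint)
    qed
    have "patterns (X0 \<union> S \<union> Y0) * patterns (X1 \<union> S \<union> Y1)
      = vdm (X0 \<union> X1 \<union> S \<union> (Y1 \<union> Y0)) * vdm S / W / (q_H q (x + y + t) * q_H q (a + y + b))"
      unfolding patterns_def c1 c2 reg[symmetric] using Wnz by simp
    also have "\<dots> = K * (patterns (X0 \<union> X1 \<union> S \<union> (Y1 \<union> Y0)) * patterns S)"
      unfolding patterns_def c3 S(2) K_def using q_H_nonzero Wnz by simp
    finally show "wt S * patterns (X0 \<union> S \<union> Y0) * patterns (X1 \<union> S \<union> Y1)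
      = K * (wt S * patterns (X0 \<union> X1 \<union> S \<union> (Y1 \<union> Y0)) * patterns S)"
      by (simp only: mult_ac)
  qed
  also have "\<dots> = K * block_sum (- int x) (int a) (int h) (int (h + b + t)) y"
    by (simp add: block_sum_def sum_distrib_left)
  also have "block_sum (- int x) (int a) (int h) (int (h + b + t)) y
    = q powi (\<Sum>i<y. interval_sum (- int x - int i) (int a) + interval_sum (int h - int i) (int (h + b + t)) - int ((y - i) choose 2))
      * patterns ({- int x - int y..<int a} \<union> {int h - int y..<int (h + b + t)})"
    by (rule block_sum_eq) (auto simp: h_def)
  \<comment> \<open>After y moves of the cut two intervals are left, of lengths x + y + a and y + b
    + t, separated by a gap of length z.\<close>
  also have "patterns ({- int x - int y..<int a} \<union> {int h - int y..<int (h + b + t)})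
    = q powi (- (\<Sum>i<x + y + a. int i * (- int x - int y + int i + 1)))
      * q powi (- (\<Sum>i<y + b + t. int i * (int a + int z + int i + 1)))
      * q powi (- (int (x + y + a) * interval_sum (int (a + z)) (int (h + b + t))))
      * (q_H q (x + y + a) * q_H q (y + b + t)
        * (q_H q (x + y + a + z + (y + b + t)) * q_H q z / (q_H q (x + y + a + z) * q_H q (z + (y + b + t))))
        / q_H q (x + a + 2 * y + b + t))"
  proof -
    define X where "X = {- int x - int y..<- int x - int y + int (x + y + a)}"
    define Y where "Y = {int a + int z..<int a + int z + int (y + b + t)}"
    have eq: "{- int x - int y..<int a} = X" "{int h - int y..<int (h + b + t)} = Y"
      by (auto simp: X_def Y_def h_def)
    have XY: "X \<inter> Y = {}" "finite X" "finite Y" by (auto simp: X_def Y_def)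
    have "card (X \<union> Y) = x + a + 2 * y + b + t"
      by (subst card_Un_disjoint[OF XY(2,3,1)]) (simp add: X_def Y_def)
    moreover have "vdm (X \<union> Y) = vdm X * vdm Y * cross X Y"
      by (rule vdm_Un) (auto simp: X_def Y_def)
    moreover have "vdm X = q powi (- (\<Sum>i<x + y + a. int i * (- int x - int y + int i + 1))) * q_H q (x + y + a)"
      unfolding X_def by (rule vdm_interval)
    moreover have "vdm Y = q powi (- (\<Sum>i<y + b + t. int i * (int a + int z + int i + 1))) * q_H q (y + b + t)"
      unfolding Y_def by (rule vdm_interval)
    moreover have "cross X Y = q powi (- (int (x + y + a) * interval_sum (int (a + z)) (int (h + b + t))))
      * (q_H q (x + y + a + z + (y + b + t)) * q_H q z / (q_H q (x + y + a + z) * q_H q (z + (y + b + t))))"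
      using cross_intervals[of "- int x - int y" "x + y + a" z "y + b + t"]
      by (simp add: X_def Y_def h_def algebra_simps)
    ultimately show ?thesis unfolding eq patterns_def by (simp only: mult_ac times_divide_eq_left times_divide_eq_right)
  qed
  also have "K = q powi (int x * interval_sum 0 (int a)) * q powi (int b * interval_sum (int (h + b)) (int (h + b + t)))
      * q powi (int x * interval_sum (int h) (int (h + b))) * q powi (int a * interval_sum (int (h + b)) (int (h + b + t)))
    * (q_H q (x + a + y + b + t) * q_H q y / (q_H q (x + y + t) * q_H q (a + y + b))
      * (q_H q x * q_H q a / q_H q (x + a)) * (q_H q b * q_H q t / q_H q (b + t))
      * (q_H q (x + h) * q_H q (h + b) / (q_H q (x + h + b) * q_H q h))
      * (q_H q (a + (y + z + b)) * q_H q (y + z + b + t) / (q_H q (a + (y + z + b) + t) * q_H q (y + z + b))))"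
  proof -
    have H0: "q_H q 0 = 1" by (simp add: q_H_def)
    have p: "q powi (- e) = inverse (q powi e)" for e by (rule power_int_minus)
    have c1: "cross X0 X1 = q powi (- (int x * interval_sum 0 (int a))) * (q_H q (x + a) / (q_H q x * q_H q a))"
      using cross_intervals[of "- int x" x 0 a] by (simp add: X0_def X1_def H0)
    have c2: "cross Y1 Y0 = q powi (- (int b * interval_sum (int (h + b)) (int (h + b + t)))) * (q_H q (b + t) / (q_H q b * q_H q t))"
      using cross_intervals[of "int h" b 0 t] by (simp add: Y0_def Y1_def H0)
    have c3: "cross X0 Y1 = q powi (- (int x * interval_sum (int h) (int (h + b)))) * (q_H q (x + h + b) * q_H q h / (q_H q (x + h) * q_H q (h + b)))"
      using cross_intervals[of "- int x" x h b] by (simp add: X0_def Y1_def)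
    have c4: "cross X1 Y0 = q powi (- (int a * interval_sum (int (h + b)) (int (h + b + t))))
      * (q_H q (a + (y + z + b) + t) * q_H q (y + z + b) / (q_H q (a + (y + z + b)) * q_H q (y + z + b + t)))"
      using cross_intervals[of 0 a "y + z + b" t] by (simp add: X1_def Y0_def h_def algebra_simps)
    show ?thesis
      unfolding K_def W_def c1 c2 c3 c4 p using q_nonzero q_H_nonzero by (simp add: divide_simps)
  qed
  finally have main: "main_sum a b x y z t
    = q powi (int x * interval_sum 0 (int a)) * q powi (int b * interval_sum (int (h + b)) (int (h + b + t)))
      * q powi (int x * interval_sum (int h) (int (h + b))) * q powi (int a * interval_sum (int (h + b)) (int (h + b + t)))
      * q powi (\<Sum>i<y. interval_sum (- int x - int i) (int a) + interval_sum (int h - int i) (int (h + b + t)) - int ((y - i) choose 2))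
      * q powi (- (\<Sum>i<x + y + a. int i * (- int x - int y + int i + 1)))
      * q powi (- (\<Sum>i<y + b + t. int i * (int a + int z + int i + 1)))
      * q powi (- (int (x + y + a) * interval_sum (int (a + z)) (int (h + b + t))))
      * ((q_H q (x + a + y + b + t) * q_H q y / (q_H q (x + y + t) * q_H q (a + y + b))
      * (q_H q x * q_H q a / q_H q (x + a)) * (q_H q b * q_H q t / q_H q (b + t))
      * (q_H q (x + h) * q_H q (h + b) / (q_H q (x + h + b) * q_H q h))
      * (q_H q (a + (y + z + b)) * q_H q (y + z + b + t) / (q_H q (a + (y + z + b) + t) * q_H q (y + z + b))))
      * (q_H q (x + y + a) * q_H q (y + b + t)
        * (q_H q (x + y + a + z + (y + b + t)) * q_H q z / (q_H q (x + y + a + z) * q_H q (z + (y + b + t))))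
        / q_H q (x + a + 2 * y + b + t)))"
    by (simp only: mult_ac)
  have pp: "(q_H q (x + a + y + b + t) * q_H q y / (q_H q (x + y + t) * q_H q (a + y + b))
      * (q_H q x * q_H q a / q_H q (x + a)) * (q_H q b * q_H q t / q_H q (b + t))
      * (q_H q (x + h) * q_H q (h + b) / (q_H q (x + h + b) * q_H q h))
      * (q_H q (a + (y + z + b)) * q_H q (y + z + b + t) / (q_H q (a + (y + z + b) + t) * q_H q (y + z + b))))
      * (q_H q (x + y + a) * q_H q (y + b + t)
        * (q_H q (x + y + a + z + (y + b + t)) * q_H q z / (q_H q (x + y + a + z) * q_H q (z + (y + b + t))))
        / q_H q (x + a + 2 * y + b + t)) = P_prod q a b x y z t"
  proof -
    have eqs: "q_H q (x + a + y + b + t) = q_H q (a + b + x + y + t)" "q_H q (a + y + b) = q_H q (a + b + y)" "q_H q (x + a) = q_H q (a + x)"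
      "q_H q (x + h) = q_H q (a + x + y + z)" "q_H q (h + b) = q_H q (a + b + y + z)" "q_H q (x + h + b) = q_H q (a + b + x + y + z)" "q_H q h = q_H q (a + y + z)"
      "q_H q (a + (y + z + b)) = q_H q (a + b + y + z)" "q_H q (y + z + b + t) = q_H q (b + y + z + t)"
      "q_H q (a + (y + z + b) + t) = q_H q (a + b + y + z + t)" "q_H q (y + z + b) = q_H q (b + y + z)" "q_H q (x + y + a) = q_H q (a + x + y)" "q_H q (y + b + t) = q_H q (b + y + t)"
      "q_H q (x + y + a + z + (y + b + t)) = q_H q (a + b + x + 2 * y + z + t)" "q_H q (x + y + a + z) = q_H q (a + x + y + z)"
      "q_H q (z + (y + b + t)) = q_H q (b + y + z + t)" "q_H q (x + a + 2 * y + b + t) = q_H q (a + b + x + 2 * y + t)"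
      by (simp_all add: h_def ac_simps mult_2_right)
    show ?thesis
      unfolding P_prod_def eqs by (rule regroup_fractions[OF q_H_nonzero q_H_nonzero])
  qed
  show ?thesis
    unfolding main pp powi_mult main_exponent_def unfolding h_def
    by (rule arg_cong[where f = "\<lambda>e. q powi e * _"]) simp
qed

end

section \<open>Tilings as families of sets\<close>

lemma up_in_cells_iff: "Up c j \<in> cells L \<longleftrightarrow> L = Right_Loz c j \<or> L = Left_Loz c j \<or> L = Vertical_Loz c j"
  by (cases L) auto

lemma down_in_cells_iff:
  "Down c j \<in> cells L \<longleftrightarrow> L = Right_Loz c j \<or> L = Left_Loz (c + 1) j \<or> L = Vertical_Loz c (j + 1)"
  by (cases L) auto

lemma all_unit_triangle_iff: "(\<forall>\<tau>. P \<tau>) \<longleftrightarrow> (\<forall>c j. P (Up c j) \<and> P (Down c j))"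
proof safe
  fix \<tau> assume "\<forall>c j. P (Up c j) \<and> P (Down c j)"
  then show "P \<tau>" by (cases \<tau>) auto
qed blast+

lemma tilings_iff:
  "T \<in> tilings R \<longleftrightarrow> (\<forall>\<tau>. (\<tau> \<in> R \<longleftrightarrow> (\<exists>L\<in>T. \<tau> \<in> cells L)) \<and>
     (\<forall>L\<in>T. \<forall>L'\<in>T. \<tau> \<in> cells L \<longrightarrow> \<tau> \<in> cells L' \<longrightarrow> L = L'))"
  unfolding tilings_def pairwise_def disjnt_def by blast

text \<open>Only three lozenges can cover a given unit triangle, so exact covering of it is a
  propositional condition on three memberships.\<close>

lemma unique_cover_iff:
  assumes "\<And>L. P L \<longleftrightarrow> L = A \<or> L = B \<or> L = C" "A \<noteq> B" "A \<noteq> C" "B \<noteq> C"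
  shows "(X \<longleftrightarrow> (\<exists>L\<in>T. P L)) \<and> (\<forall>L\<in>T. \<forall>L'\<in>T. P L \<longrightarrow> P L' \<longrightarrow> L = L') \<longleftrightarrow>
    (X \<longleftrightarrow> A \<in> T \<or> B \<in> T \<or> C \<in> T) \<and> \<not> (A \<in> T \<and> B \<in> T) \<and> \<not> (A \<in> T \<and> C \<in> T) \<and> \<not> (B \<in> T \<and> C \<in> T)"
proof -
  have 1: "(\<exists>L\<in>T. P L) \<longleftrightarrow> A \<in> T \<or> B \<in> T \<or> C \<in> T" unfolding assms(1) by blast
  have "(\<forall>L\<in>T. \<forall>L'\<in>T. P L \<longrightarrow> P L' \<longrightarrow> L = L') \<longleftrightarrow>
    \<not> (A \<in> T \<and> B \<in> T) \<and> \<not> (A \<in> T \<and> C \<in> T) \<and> \<not> (B \<in> T \<and> C \<in> T)"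
    unfolding assms(1) using assms(2-4) by blast
  then show ?thesis unfolding 1 by simp
qed

definition lefts :: "lozenge set \<Rightarrow> int \<Rightarrow> int set" where "lefts T c = {j. Left_Loz c j \<in> T}"
definition rights :: "lozenge set \<Rightarrow> int \<Rightarrow> int set" where "rights T c = {j. Right_Loz c j \<in> T}"
definition verticals :: "lozenge set \<Rightarrow> int \<Rightarrow> int set" where "verticals T c = {j. Vertical_Loz c j \<in> T}"

definition region_of :: "(int \<Rightarrow> int set) \<Rightarrow> (int \<Rightarrow> int set) \<Rightarrow> region" where
  "region_of U D = {\<tau>. case \<tau> of Up c j \<Rightarrow> j \<in> U c | Down c j \<Rightarrow> j \<in> D c}"

text \<open>A and B are rows of up- and down-triangles not covered by left lozenges, R and V the
  rows of right and vertical lozenges. The translation by -1 reflects that a vertical lozenge in row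
  j takes the down-triangle of row j - 1.\<close>

definition strip_tiling :: "int set \<Rightarrow> int set \<Rightarrow> int set \<Rightarrow> int set \<Rightarrow> bool" where
  "strip_tiling A B R V \<longleftrightarrow> A = R \<union> V \<and> R \<inter> V = {} \<and> B = R \<union> (+) (-1) ` V \<and> R \<inter> (+) (-1) ` V = {}"

text \<open>Right and vertical lozenges stay inside one strip. A left lozenge on the line i = c
  takes an up-triangle from strip c and a down-triangle from strip c - 1. Given the left lozenges,
  the tiling condition therefore decouples into strips.\<close>

lemma tilings_region_of_iff:
  "T \<in> tilings (region_of U D) \<longleftrightarrow> (\<forall>c. lefts T c \<subseteq> U c \<and> lefts T (c + 1) \<subseteq> D c \<and>
     strip_tiling (U c - lefts T c) (D c - lefts T (c + 1)) (rights T c) (verticals T c))"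
    (is "?l \<longleftrightarrow> ?r")
proof -
  have vert: "j \<in> (+) (-1) ` verticals T c \<longleftrightarrow> Vertical_Loz c (j + 1) \<in> T" for j c
    by (auto simp: verticals_def image_iff intro!: exI[of _ "j + 1"])
  have "?l \<longleftrightarrow> (\<forall>c j. (j \<in> U c \<longleftrightarrow> Right_Loz c j \<in> T \<or> Left_Loz c j \<in> T \<or> Vertical_Loz c j \<in> T) \<and>
      \<not> (Right_Loz c j \<in> T \<and> Left_Loz c j \<in> T) \<and> \<not> (Right_Loz c j \<in> T \<and> Vertical_Loz c j \<in> T) \<and>
      \<not> (Left_Loz c j \<in> T \<and> Vertical_Loz c j \<in> T) \<and>
      (j \<in> D c \<longleftrightarrow> Right_Loz c j \<in> T \<or> Left_Loz (c + 1) j \<in> T \<or> Vertical_Loz c (j + 1) \<in> T) \<and>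
      \<not> (Right_Loz c j \<in> T \<and> Left_Loz (c + 1) j \<in> T) \<and> \<not> (Right_Loz c j \<in> T \<and> Vertical_Loz c (j + 1) \<in> T) \<and>
      \<not> (Left_Loz (c + 1) j \<in> T \<and> Vertical_Loz c (j + 1) \<in> T))"
    (is "_ \<longleftrightarrow> (\<forall>c j. ?P c j)")
  proof -
    have "?l \<longleftrightarrow> (\<forall>c j.
      ((Up c j \<in> region_of U D \<longleftrightarrow> (\<exists>L\<in>T. Up c j \<in> cells L)) \<and>
     (\<forall>L\<in>T. \<forall>L'\<in>T. Up c j \<in> cells L \<longrightarrow> Up c j \<in> cells L' \<longrightarrow> L = L')) \<and>
      ((Down c j \<in> region_of U D \<longleftrightarrow> (\<exists>L\<in>T. Down c j \<in> cells L)) \<and>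
     (\<forall>L\<in>T. \<forall>L'\<in>T. Down c j \<in> cells L \<longrightarrow> Down c j \<in> cells L' \<longrightarrow> L = L')))"
      unfolding tilings_iff by (rule all_unit_triangle_iff)
    also have "\<dots> \<longleftrightarrow> (\<forall>c j. ?P c j)"
    proof (intro all_cong1)
      fix c j
      show "((Up c j \<in> region_of U D \<longleftrightarrow> (\<exists>L\<in>T. Up c j \<in> cells L)) \<and>
         (\<forall>L\<in>T. \<forall>L'\<in>T. Up c j \<in> cells L \<longrightarrow> Up c j \<in> cells L' \<longrightarrow> L = L')) \<and>
        ((Down c j \<in> region_of U D \<longleftrightarrow> (\<exists>L\<in>T. Down c j \<in> cells L)) \<and>
         (\<forall>L\<in>T. \<forall>L'\<in>T. Down c j \<in> cells L \<longrightarrow> Down c j \<in> cells L' \<longrightarrow> L = L')) \<longleftrightarrow> ?P c j"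
        unfolding unique_cover_iff[OF up_in_cells_iff lozenge.distinct(1) lozenge.distinct(3) lozenge.distinct(5)]
          unique_cover_iff[OF down_in_cells_iff lozenge.distinct(1) lozenge.distinct(3) lozenge.distinct(5)]
        by (simp only: region_of_def mem_Collect_eq unit_triangle.case conj_assoc)
    qed
    finally show ?thesis .
  qed
  also have "\<dots> \<longleftrightarrow> ?r"
    unfolding strip_tiling_def set_eq_iff subset_iff Int_iff empty_iff Un_iff Diff_iff vert
    unfolding lefts_def rights_def verticals_def mem_Collect_eq
    unfolding all_conj_distrib[symmetric] by (intro all_cong1) argo
  finally show ?thesis .
qed

lemma strip_tiling_count:
  assumes fin: "finite A" and st: "strip_tiling A B R V"
  shows "count_ge A k = count_ge R k + count_ge V k" "count_ge B k = count_ge R k + count_ge V (k + 1)"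
proof -
  have f: "finite R" "finite V" using fin st by (auto simp: strip_tiling_def)
  then show "count_ge A k = count_ge R k + count_ge V k"
    using st by (simp add: strip_tiling_def count_ge_Un_disjoint)
  have "count_ge B k = count_ge R k + count_ge ((+) (-1) ` V) k"
    using st f count_ge_Un_disjoint[of R "(+) (-1) ` V" k] unfolding strip_tiling_def by blast
  then show "count_ge B k = count_ge R k + count_ge V (k + 1)"
    unfolding count_ge_shift by simp
qed

text \<open>In the difference of the counts of A and B at k the right lozenges cancel, and what
  remains is 1 or 0 according to whether k is in V.\<close>

lemma strip_tiling_unique:
  assumes fin: "finite A" and st: "strip_tiling A B R V"
  shows "strip_ok A B" "V = {k \<in> A. count_ge B k < count_ge A k}" "R = {k \<in> A. count_ge A k \<le> count_ge B k}"
proof -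
  have f: "finite R" "finite V" using fin st by (auto simp: strip_tiling_def)
  note c = strip_tiling_count[OF fin st]
  show "strip_ok A B"
    unfolding strip_ok_def c using count_ge_antimono[OF f(2), of _ "_ + 1"] count_ge_antimono[OF f(1)]
    by simp
  have "k \<in> V \<longleftrightarrow> count_ge B k < count_ge A k" for k
    unfolding c using count_ge_step[OF f(2), of k] by simp
  moreover have "A = R \<union> V" "R \<inter> V = {}" using st by (auto simp: strip_tiling_def)
  ultimately show "V = {k \<in> A. count_ge B k < count_ge A k}" "R = {k \<in> A. count_ge A k \<le> count_ge B k}"
    by (auto simp: not_le[symmetric])
qed

text \<open>Conversely, \<open>strip_ok\<close> makes this difference 0 or 1 at every k, so it can
  be used as the indicator of the vertical lozenges.\<close>

lemma strip_tiling_exists: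
  assumes fin: "finite A" "finite B" and ok: "strip_ok A B"
  shows "strip_tiling A B {k \<in> A. count_ge A k \<le> count_ge B k} {k \<in> A. count_ge B k < count_ge A k}"
    (is "strip_tiling A B ?R ?V")
proof -
  have ok: "count_ge B k \<le> count_ge A k" "count_ge A (k + 1) \<le> count_ge B k" for k
    using ok unfolding strip_ok_def by (auto, metis add_diff_cancel_right')
  note step = count_ge_step[OF fin(1)] count_ge_step[OF fin(2)]
  have V: "j \<in> (+) (-1) ` ?V \<longleftrightarrow> j + 1 \<in> ?V" for j
    by (auto simp: image_iff intro!: exI[of _ "j + 1"])
  have R_B: "j \<in> B" "j + 1 \<notin> ?V" if "j \<in> ?R" for j
    using that ok(1)[of "j + 1"] ok(2)[of j] step(1)[of j] step(2)[of j] by (auto split: if_splits)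
  have V_B: "j \<in> B" if "j + 1 \<in> ?V" for j
    using that ok(2)[of j] step(2)[of j] by (auto split: if_splits)
  have B_RV: "j \<in> ?R \<or> j + 1 \<in> ?V" if "j \<in> B" for j
    using that ok(1)[of "j + 1"] ok(1)[of j] ok(2)[of j] ok(2)[of "j + 1"] step(1)[of j] step(2)[of j]
      step(1)[of "j + 1"] by (auto split: if_splits)
  have "B = ?R \<union> (+) (-1) ` ?V"
    using R_B(1) V_B B_RV V by blast
  moreover have "?R \<inter> (+) (-1) ` ?V = {}" using R_B(2) V by blast
  ultimately show ?thesis unfolding strip_tiling_def by auto
qed

text \<open>Summation by layers: it expresses total heights, hence \<open>kappa\<close>, through the
  functions by which tilings are compared.\<close>

lemma sum_heights_eq_sum_counts:
  fixes S :: "int set"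
  assumes "S \<subseteq> {0..<int H}"
  shows "(\<Sum>j\<in>S. j + 1) = (\<Sum>k<H. count_ge S (int k))"
proof -
  have fin: "finite S" using assms finite_subset by blast
  have "(\<Sum>k<H. count_ge S (int k)) = (\<Sum>k<H. \<Sum>j\<in>S. if int k \<le> j then 1 else 0)"
    unfolding count_ge_def by (intro sum.cong refl) (simp add: sum.If_cases fin Int_def)
  also have "\<dots> = (\<Sum>j\<in>S. \<Sum>k<H. if int k \<le> j then 1 else 0)" by (rule sum.swap)
  also have "\<dots> = (\<Sum>j\<in>S. j + 1)"
  proof (rule sum.cong[OF refl])
    fix j assume "j \<in> S"
    then have j: "0 \<le> j" "j < int H" using assms by auto
    then have "{..<H} \<inter> {k. int k \<le> j} = {..nat j}" by auto
    then show "(\<Sum>k<H. if int k \<le> j then 1 else 0) = j + 1" using j by (simp add: sum.If_cases)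
  qed
  finally show ?thesis by simp
qed

text \<open>A function that vanishes far up and grows by 0 or 1 with each step downwards is the
  counting function of the set of its jumps; both properties pass to the maximum.\<close>

lemma count_ge_max:
  assumes fin: "finite A" "finite B"
  defines "M \<equiv> (\<lambda>k. max (count_ge A k) (count_ge B k))"
  defines "J \<equiv> {k. M (k + 1) < M k}"
  shows "J \<subseteq> A \<union> B" "count_ge J k = M k"
proof -
  note stepA = count_ge_step[OF fin(1)] and stepB = count_ge_step[OF fin(2)]
  show sub: "J \<subseteq> A \<union> B"
  proof
    fix k assume "k \<in> J"
    then show "k \<in> A \<union> B" using stepA[of k] stepB[of k] by (auto simp: J_def M_def split: if_splits)
  qed
  have finJ: "finite J" using sub fin finite_subset by blast
  have M_step: "M k = M (k + 1) + (if k \<in> J then 1 else 0)" for k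
    using stepA[of k] stepB[of k] by (auto simp: J_def M_def split: if_splits)
  have "bdd_above (A \<union> B)" using fin by simp
  then obtain u where u: "\<And>j. j \<in> A \<union> B \<Longrightarrow> j \<le> u" by (auto simp: bdd_above_def)
  have zero: "count_ge J k = 0 \<and> M k = 0" if "u < k" for k
  proof -
    have "{j \<in> A. k \<le> j} = {}" "{j \<in> B. k \<le> j} = {}" "{j \<in> J. k \<le> j} = {}"
      using u sub that by fastforce+
    then show ?thesis unfolding M_def count_ge_def by (simp only: card.empty) simp
  qed
  \<comment> \<open>Induction downwards from a height above both sets.\<close>
  have "count_ge J (u + 1 - int n) = M (u + 1 - int n)" for n
  proof (induction n)
    case 0
    then show ?case using zero[of "u + 1"] by simp
  next
    case (Suc n)
    have "u + 1 - int (Suc n) + 1 = u + 1 - int n" by simp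
    then show ?case
      using M_step[of "u + 1 - int (Suc n)"] count_ge_step[OF finJ, of "u + 1 - int (Suc n)"] Suc
      by (simp add: algebra_simps)
  qed
  from this[of "nat (u + 1 - k)"] show "count_ge J k = M k"
    using zero[of k] by (cases "u < k") auto
qed

definition kappa :: "lozenge set \<Rightarrow> nat" where
  "kappa T = (\<Sum>(i, j) | Right_Loz i j \<in> T. nat (j + 1))"

lemma prod_weight:
  assumes "finite T"
  shows "(\<Prod>L\<in>T. weight q L) = q ^ kappa T"
proof -
  have inj: "inj_on (\<lambda>(i, j). Right_Loz i j) {(i, j). Right_Loz i j \<in> T}" by (auto simp: inj_on_def)
  have im: "(\<lambda>(i, j). Right_Loz i j) ` {(i, j). Right_Loz i j \<in> T} \<subseteq> T" by auto
  have "(\<Prod>L\<in>T. weight q L) = (\<Prod>L\<in>(\<lambda>(i, j). Right_Loz i j) ` {(i, j). Right_Loz i j \<in> T}. weight q L)"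
  proof (rule prod.mono_neutral_right[OF assms im])
    show "\<forall>L\<in>T - (\<lambda>(i, j). Right_Loz i j) ` {(i, j). Right_Loz i j \<in> T}. weight q L = 1"
    proof
      fix L assume "L \<in> T - (\<lambda>(i, j). Right_Loz i j) ` {(i, j). Right_Loz i j \<in> T}"
      then show "weight q L = 1" by (cases L) auto
    qed
  qed
  also have "\<dots> = (\<Prod>(i, j) | Right_Loz i j \<in> T. q ^ nat (j + 1))"
    unfolding prod.reindex[OF inj] by (intro prod.cong) auto
  also have "\<dots> = q ^ kappa T" unfolding kappa_def power_sum by (intro prod.cong) auto
  finally show ?thesis .
qed

section \<open>Regions composed of strips and their families of left lozenges\<close>

locale strip_region =
  fixes U D :: "int \<Rightarrow> int set" and c0 :: int and N H :: nat
  assumes U_sub: "U c \<subseteq> {0..<int H}" and D_sub: "D c \<subseteq> {0..<int H}"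
    and U_empty: "c \<notin> {c0..<c0 + int N} \<Longrightarrow> U c = {}"
    and D_empty: "c \<notin> {c0..<c0 + int N} \<Longrightarrow> D c = {}"
begin

lemma finite_U: "finite (U c)" and finite_D: "finite (D c)"
  using U_sub[of c] D_sub[of c] finite_subset by blast+

definition families :: "(int \<Rightarrow> int set) set" where
  "families = {S. \<forall>c. S c \<subseteq> U c \<and> S (c + 1) \<subseteq> D c \<and> strip_ok (U c - S c) (D c - S (c + 1))}"

text \<open>The inverse of \<open>lefts\<close>: within each strip the other lozenges are those
  dictated by \<open>strip_tiling_unique\<close>.\<close>

definition tiling_of :: "(int \<Rightarrow> int set) \<Rightarrow> lozenge set" where
  "tiling_of S = {L. case L of Left_Loz c j \<Rightarrow> j \<in> S c
     | Right_Loz c j \<Rightarrow> j \<in> U c - S c \<and> count_ge (U c - S c) j \<le> count_ge (D c - S (c + 1)) j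
     | Vertical_Loz c j \<Rightarrow> j \<in> U c - S c \<and> count_ge (D c - S (c + 1)) j < count_ge (U c - S c) j}"

lemma lefts_bij: "bij_betw lefts (tilings (region_of U D)) families"
proof (rule bij_betw_byWitness[where f' = tiling_of])
  show "\<forall>T\<in>tilings (region_of U D). tiling_of (lefts T) = T"
  proof
    fix T assume "T \<in> tilings (region_of U D)"
    then have st: "strip_tiling (U c - lefts T c) (D c - lefts T (c + 1)) (rights T c) (verticals T c)" for c
      by (auto simp: tilings_region_of_iff)
    show "tiling_of (lefts T) = T"
    proof (rule Set.set_eqI)
      fix L
      show "L \<in> tiling_of (lefts T) \<longleftrightarrow> L \<in> T"
        using strip_tiling_unique(2,3)[OF _ st] finite_U
        by (cases L) (auto simp: tiling_of_def lefts_def rights_def verticals_def set_eq_iff)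
    qed
  qed
  show "\<forall>S\<in>families. lefts (tiling_of S) = S"
    by (auto simp: lefts_def tiling_of_def)
  show "lefts ` tilings (region_of U D) \<subseteq> families"
  proof (rule image_subsetI)
    fix T assume "T \<in> tilings (region_of U D)"
    then show "lefts T \<in> families"
      unfolding families_def tilings_region_of_iff
      using strip_tiling_unique(1)[OF finite_Diff[OF finite_U]] by blast
  qed
  show "tiling_of ` families \<subseteq> tilings (region_of U D)"
  proof (rule image_subsetI)
    fix S assume S: "S \<in> families"
    have l: "lefts (tiling_of S) = S" by (auto simp: lefts_def tiling_of_def)
    have rv: "rights (tiling_of S) c = {k \<in> U c - S c. count_ge (U c - S c) k \<le> count_ge (D c - S (c + 1)) k}"
      "verticals (tiling_of S) c = {k \<in> U c - S c. count_ge (D c - S (c + 1)) k < count_ge (U c - S c) k}" for c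
      by (auto simp: rights_def verticals_def tiling_of_def)
    show "tiling_of S \<in> tilings (region_of U D)"
      unfolding tilings_region_of_iff l rv
      using S strip_tiling_exists[OF finite_Diff[OF finite_U] finite_Diff[OF finite_D]]
      unfolding families_def by blast
  qed
qed

text \<open>On the two border lines, and outside them, at least one of the strips that a left
  lozenge would meet is empty.\<close>

lemma families_empty:
  assumes "S \<in> families" "c \<notin> {c0<..<c0 + int N}"
  shows "S c = {}"
proof (cases "c \<le> c0")
  case True
  have "S (c - 1 + 1) \<subseteq> D (c - 1)" using assms(1) unfolding families_def by blast
  then show ?thesis using D_empty[of "c - 1"] True by simp
next
  case False
  have "S c \<subseteq> U c" using assms(1) unfolding families_def by blast
  then show ?thesis using U_empty[of c] False assms(2) by auto
qed

context
  fixes T assumes T: "T \<in> tilings (region_of U D)"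
begin

lemma lefts_family: "lefts T \<in> families"
  using lefts_bij T by (auto simp: bij_betw_def)

lemma strip_tiling_T:
  "strip_tiling (U c - lefts T c) (D c - lefts T (c + 1)) (rights T c) (verticals T c)"
  using T by (auto simp: tilings_region_of_iff)

lemma rights_sub: "rights T c \<subseteq> U c"
  using strip_tiling_T[of c] by (auto simp: strip_tiling_def)

lemma lefts_sub: "lefts T c \<subseteq> U c" "lefts T (c + 1) \<subseteq> D c"
  using T by (auto simp: tilings_region_of_iff)

lemma finite_rights: "finite {(i, j). Right_Loz i j \<in> T}"
proof (rule finite_subset)
  show "{(i, j). Right_Loz i j \<in> T} \<subseteq> {c0..<c0 + int N} \<times> {0..<int H}"
    using rights_sub U_sub U_empty by (fastforce simp: rights_def)
qed auto

text \<open>Comparing down-triangles from row k upwards with up-triangles from row k + 1 upwards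
  cancels the vertical lozenges and leaves the right lozenge in row k.\<close>

lemma right_indicator:
  "(if Right_Loz c k \<in> T then 1 else 0)
    = count_ge (D c) k - count_ge (lefts T (c + 1)) k - count_ge (U c) (k + 1) + count_ge (lefts T c) (k + 1)"
proof -
  have fin: "finite (U c - lefts T c)" using finite_U by simp
  note cnt = strip_tiling_count[OF fin strip_tiling_T[of c]]
  have "finite (rights T c)" using rights_sub finite_U finite_subset by blast
  then have "count_ge (rights T c) k - count_ge (rights T c) (k + 1) = (if Right_Loz c k \<in> T then 1 else 0)"
    using count_ge_step[of "rights T c" k] by (simp add: rights_def)
  then show ?thesis
    using cnt(2)[of k] cnt(1)[of "k + 1"] lefts_sub[of c] finite_U finite_D by (simp add: count_ge_Diff)
qed

text \<open>
  Charge \<open>(j + 1) (j + 2) / 2\<close> to a down-triangle and \<open>- j (j + 1) / 2\<close> to an up-triangle in row \<open>j\<close>: then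
  a vertical lozenge has charge \<open>0\<close>, and a right or left lozenge has charge \<open>j + 1\<close>.
\<close>

lemma kappa_eq:
  "2 * int (kappa T) = (\<Sum>c\<in>{c0..<c0 + int N}. (\<Sum>j\<in>D c. (j + 1) * (j + 2)) - (\<Sum>j\<in>U c. j * (j + 1)))
     - 2 * (\<Sum>c\<in>{c0..<c0 + int N}. \<Sum>j\<in>lefts T c. j + 1)"
proof -
  let ?C = "{c0..<c0 + int N}"
  have strip: "2 * (\<Sum>j\<in>rights T c. j + 1) = (\<Sum>j\<in>D c. (j + 1) * (j + 2)) - (\<Sum>j\<in>U c. j * (j + 1))
      - (\<Sum>j\<in>lefts T (c + 1). (j + 1) * (j + 2)) + (\<Sum>j\<in>lefts T c. j * (j + 1))" for c
  proof -
    have st: "U c - lefts T c = rights T c \<union> verticals T c" "rights T c \<inter> verticals T c = {}"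
      "D c - lefts T (c + 1) = rights T c \<union> (+) (-1) ` verticals T c" "rights T c \<inter> (+) (-1) ` verticals T c = {}"
      using strip_tiling_T[of c] by (auto simp: strip_tiling_def)
    have fin: "finite (rights T c)" "finite (verticals T c)"
      using st(1) finite_U[of c] by (metis finite_Diff finite_Un)+
    have "(\<Sum>j\<in>D c. (j + 1) * (j + 2)) - (\<Sum>j\<in>lefts T (c + 1). (j + 1) * (j + 2)) = (\<Sum>j\<in>D c - lefts T (c + 1). (j + 1) * (j + 2))"
      using finite_D lefts_sub by (simp add: sum_diff)
    also have "\<dots> = (\<Sum>j\<in>rights T c. (j + 1) * (j + 2)) + (\<Sum>j\<in>verticals T c. j * (j + 1))"
      unfolding st(3) using fin st(4) by (simp add: sum.union_disjoint sum.reindex algebra_simps)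
    finally have d: "(\<Sum>j\<in>D c. (j + 1) * (j + 2)) - (\<Sum>j\<in>lefts T (c + 1). (j + 1) * (j + 2))
      = (\<Sum>j\<in>rights T c. (j + 1) * (j + 2)) + (\<Sum>j\<in>verticals T c. j * (j + 1))" .
    have "(\<Sum>j\<in>U c. j * (j + 1)) - (\<Sum>j\<in>lefts T c. j * (j + 1)) = (\<Sum>j\<in>U c - lefts T c. j * (j + 1))"
      using finite_U lefts_sub by (simp add: sum_diff)
    also have "\<dots> = (\<Sum>j\<in>rights T c. j * (j + 1)) + (\<Sum>j\<in>verticals T c. j * (j + 1))"
      unfolding st(1) using fin st(2) by (simp add: sum.union_disjoint)
    finally have u: "(\<Sum>j\<in>U c. j * (j + 1)) - (\<Sum>j\<in>lefts T c. j * (j + 1))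
      = (\<Sum>j\<in>rights T c. j * (j + 1)) + (\<Sum>j\<in>verticals T c. j * (j + 1))" .
    have "(\<Sum>j\<in>rights T c. (j + 1) * (j + 2)) - (\<Sum>j\<in>rights T c. j * (j + 1)) = 2 * (\<Sum>j\<in>rights T c. j + 1)"
      by (simp add: sum_subtractf[symmetric] sum_distrib_left algebra_simps)
    then show ?thesis using d u by linarith
  qed
  have "{(i, j). Right_Loz i j \<in> T} = (SIGMA c:?C. rights T c)"
    using rights_sub U_empty by (fastforce simp: rights_def)
  moreover have "finite (rights T c)" for c using rights_sub finite_U finite_subset by blast
  ultimately have "kappa T = (\<Sum>c\<in>?C. \<Sum>j\<in>rights T c. nat (j + 1))"
    unfolding kappa_def by (simp add: sum.Sigma)
  then have "int (kappa T) = (\<Sum>c\<in>?C. \<Sum>j\<in>rights T c. int (nat (j + 1)))" by simp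
  also have "\<dots> = (\<Sum>c\<in>?C. \<Sum>j\<in>rights T c. j + 1)"
    using rights_sub U_sub by (intro sum.cong refl) fastforce
  finally have "2 * int (kappa T) = (\<Sum>c\<in>?C. 2 * (\<Sum>j\<in>rights T c. j + 1))" by (simp add: sum_distrib_left)
  also have "\<dots> = (\<Sum>c\<in>?C. (\<Sum>j\<in>D c. (j + 1) * (j + 2)) - (\<Sum>j\<in>U c. j * (j + 1)))
    - ((\<Sum>c\<in>?C. \<Sum>j\<in>lefts T (c + 1). (j + 1) * (j + 2)) - (\<Sum>c\<in>?C. \<Sum>j\<in>lefts T c. j * (j + 1)))"
    unfolding strip by (simp add: sum.distrib sum_subtractf)
  \<comment> \<open>The two ranges of lines differ only at the border lines, which carry no left
    lozenges.\<close>
  also have "(\<Sum>c\<in>?C. \<Sum>j\<in>lefts T (c + 1). (j + 1) * (j + 2)) = (\<Sum>c\<in>?C. \<Sum>j\<in>lefts T c. (j + 1) * (j + 2))"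
  proof -
    have "(\<Sum>c\<in>?C. \<Sum>j\<in>lefts T (c + 1). (j + 1) * (j + 2)) = (\<Sum>c\<in>{c0 + 1..<c0 + int N + 1}. \<Sum>j\<in>lefts T c. (j + 1) * (j + 2))"
      by (rule sum.reindex_bij_witness[of _ "\<lambda>c. c - 1" "\<lambda>c. c + 1"]) auto
    also have "\<dots> = (\<Sum>c\<in>{c0<..<c0 + int N}. \<Sum>j\<in>lefts T c. (j + 1) * (j + 2))"
      using families_empty[OF lefts_family] by (intro sum.mono_neutral_right) auto
    also have "\<dots> = (\<Sum>c\<in>?C. \<Sum>j\<in>lefts T c. (j + 1) * (j + 2))"
      using families_empty[OF lefts_family] by (intro sum.mono_neutral_left) auto
    finally show ?thesis .
  qed
  finally show ?thesis
    by (simp add: sum_subtractf[symmetric] sum_distrib_left algebra_simps)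
qed

end

end

section \<open>Chain sums, minimal tilings and volume\<close>

text \<open>A transfer matrix formulation in which strip i is a step of the relation. Values beyond
  l are set to the empty set, so that a chain is determined by its entries up to l.\<close>

definition chains :: "(nat \<Rightarrow> int set \<Rightarrow> int set \<Rightarrow> bool) \<Rightarrow> nat \<Rightarrow> int set \<Rightarrow> (nat \<Rightarrow> int set) set" where
  "chains rel l A = {S. S 0 = {} \<and> S l = A \<and> (\<forall>i<l. rel i (S i) (S (Suc i))) \<and> (\<forall>i>l. S i = {})}"

definition chain_sum :: "(nat \<Rightarrow> int set \<Rightarrow> int set \<Rightarrow> bool) \<Rightarrow> (int set \<Rightarrow> 'a::comm_semiring_1) \<Rightarrow> nat \<Rightarrow> int set \<Rightarrow> 'a" where
  "chain_sum rel w l A = (\<Sum>S\<in>chains rel l A. \<Prod>i<l. w (S i))"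

lemma chain_sum_0: "chain_sum rel w 0 {} = 1"
proof -
  have "chains rel 0 {} = {\<lambda>_. {}}"
    by (auto simp: chains_def fun_eq_iff) (metis gr0I empty_iff)
  then show ?thesis by (simp add: chain_sum_def)
qed

lemma finite_chains:
  assumes "\<And>i A. finite {B. rel i B A}"
  shows "finite (chains rel l A)"
proof (induction l arbitrary: A)
  case 0
  have "chains rel 0 A \<subseteq> {\<lambda>_. {}}" by (auto simp: chains_def fun_eq_iff) (metis gr0I empty_iff)
  then show ?case by (rule finite_subset) simp
next
  case (Suc l)
  have "chains rel (Suc l) A \<subseteq> (\<lambda>S. S(Suc l := A)) ` (\<Union>B\<in>{B. rel l B A}. chains rel l B)"
  proof
    fix S assume S: "S \<in> chains rel (Suc l) A"
    have "S(Suc l := {}) \<in> chains rel l (S l)" "rel l (S l) A" "S = (S(Suc l := {}))(Suc l := A)"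
      using S by (auto simp: chains_def)
    then show "S \<in> (\<lambda>S. S(Suc l := A)) ` (\<Union>B\<in>{B. rel l B A}. chains rel l B)" by blast
  qed
  then show ?case by (rule finite_subset) (use assms Suc in auto)
qed

lemma chain_sum_Suc:
  assumes "\<And>i A. finite {B. rel i B A}"
  shows "chain_sum rel w (Suc l) A = (\<Sum>B | rel l B A. w B * chain_sum rel w l B)"
proof -
  have "(\<Sum>B | rel l B A. w B * chain_sum rel w l B) = (\<Sum>B | rel l B A. \<Sum>S\<in>chains rel l B. w B * (\<Prod>i<l. w (S i)))"
    by (simp add: chain_sum_def sum_distrib_left)
  also have "\<dots> = (\<Sum>(B, S)\<in>(SIGMA B:{B. rel l B A}. chains rel l B). w B * (\<Prod>i<l. w (S i)))"
    using assms finite_chains[of rel, OF assms] by (simp add: sum.Sigma)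
  also have "\<dots> = chain_sum rel w (Suc l) A"
    unfolding chain_sum_def
  proof (rule sum.reindex_bij_witness[of _ "\<lambda>S. (S l, S(Suc l := {}))" "\<lambda>(B, S). S(Suc l := A)"])
    fix p assume p: "p \<in> (SIGMA B:{B. rel l B A}. chains rel l B)"
    then obtain B S where BS: "p = (B, S)" "rel l B A" "S \<in> chains rel l B" by auto
    show "(case p of (B, S) \<Rightarrow> S(Suc l := A)) \<in> chains rel (Suc l) A"
      using BS by (auto simp: chains_def less_Suc_eq)
    show "((case p of (B, S) \<Rightarrow> S(Suc l := A)) l, (case p of (B, S) \<Rightarrow> S(Suc l := A))(Suc l := {})) = p"
      using BS by (auto simp: chains_def fun_eq_iff)
    show "(\<Prod>i<Suc l. w ((case p of (B, S) \<Rightarrow> S(Suc l := A)) i)) = (case p of (B, S) \<Rightarrow> w B * (\<Prod>i<l. w (S i)))"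
      using BS by (auto simp: chains_def mult.commute)
  next
    fix S assume S: "S \<in> chains rel (Suc l) A"
    then show "(S l, S(Suc l := {})) \<in> (SIGMA B:{B. rel l B A}. chains rel l B)"
      "(case (S l, S(Suc l := {})) of (B, S) \<Rightarrow> S(Suc l := A)) = S"
      by (auto simp: chains_def)
  qed
  finally show ?thesis by simp
qed

context strip_region
begin

text \<open>B and A are the left lozenges on the left and right border lines of strip number i,
  counted from 0.\<close>

definition rel :: "nat \<Rightarrow> int set \<Rightarrow> int set \<Rightarrow> bool" where
  "rel i B A \<longleftrightarrow> B \<subseteq> U (c0 + int i) \<and> A \<subseteq> D (c0 + int i) \<and>
     strip_ok (U (c0 + int i) - B) (D (c0 + int i) - A)"

lemma finite_rel: "finite {B. rel i B A}"
  by (rule finite_subset[of _ "Pow (U (c0 + int i))"]) (auto simp: rel_def finite_U)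

lemma strip_ok_empty: "strip_ok {} {}"
  by (simp add: strip_ok_def count_ge_def)

lemma families_bij: "bij_betw (\<lambda>S i. S (c0 + int i)) families (chains rel N {})"
proof (rule bij_betw_byWitness[where f' = "\<lambda>g c. if c < c0 then {} else g (nat (c - c0))"])
  show "\<forall>S\<in>families. (\<lambda>c. if c < c0 then {} else S (c0 + int (nat (c - c0)))) = S"
  proof (intro ballI ext)
    fix S c assume "S \<in> families"
    then show "(if c < c0 then {} else S (c0 + int (nat (c - c0)))) = S c"
      using families_empty[of S c] by auto
  qed
  show "\<forall>g\<in>chains rel N {}. (\<lambda>i. if c0 + int i < c0 then {} else g (nat (c0 + int i - c0))) = g"
    by auto
  show "(\<lambda>S i. S (c0 + int i)) ` families \<subseteq> chains rel N {}"
  proof (rule image_subsetI)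
    fix S assume S: "S \<in> families"
    then have "rel i (S (c0 + int i)) (S (c0 + int (Suc i)))" for i
      unfolding rel_def families_def by (simp add: add.assoc[symmetric] add.commute[of 1])
    then show "(\<lambda>i. S (c0 + int i)) \<in> chains rel N {}"
      using families_empty[OF S] by (auto simp: chains_def)
  qed
  show "(\<lambda>g c. if c < c0 then {} else g (nat (c - c0))) ` chains rel N {} \<subseteq> families"
  proof (rule image_subsetI)
    fix g assume g: "g \<in> chains rel N {}"
    define S where "S c = (if c < c0 then {} else g (nat (c - c0)))" for c
    have gN: "g i = {}" if "i \<ge> N" for i using g that by (cases "i = N") (auto simp: chains_def)
    have "S c \<subseteq> U c \<and> S (c + 1) \<subseteq> D c \<and> strip_ok (U c - S c) (D c - S (c + 1))" for c
    proof -
      consider "c < c0" | "c0 \<le> c" "c < c0 + int N" | "c0 + int N \<le> c" by linarith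
      then show ?thesis
      proof cases
        case 1
        then have "S c = {}" "S (c + 1) = {}" using g by (auto simp: S_def chains_def)
        then show ?thesis using 1 U_empty[of c] D_empty[of c] strip_ok_empty by auto
      next
        case 2
        then have "rel (nat (c - c0)) (g (nat (c - c0))) (g (Suc (nat (c - c0))))"
          using g by (auto simp: chains_def)
        moreover have "nat (c + 1 - c0) = Suc (nat (c - c0))" using 2 by auto
        ultimately show ?thesis using 2 by (simp add: rel_def S_def)
      next
        case 3
        then have "S c = {}" "S (c + 1) = {}" by (auto simp: S_def gN)
        then show ?thesis using 3 U_empty[of c] D_empty[of c] strip_ok_empty by auto
      qed
    qed
    then show "(\<lambda>c. if c < c0 then {} else g (nat (c - c0))) \<in> families"
      unfolding families_def S_def by blast
  qed
qed

lemma finite_tiling_box: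
  obtains \<B> where "finite \<B>" "\<And>T. T \<in> tilings (region_of U D) \<Longrightarrow> T \<subseteq> \<B>"
proof
  let ?I = "{c0..<c0 + int N} \<times> {0..<int H}"
  let ?B = "(\<lambda>(c, j). Left_Loz c j) ` ?I \<union> (\<lambda>(c, j). Right_Loz c j) ` ?I \<union> (\<lambda>(c, j). Vertical_Loz c j) ` ?I"
  show "finite ?B" by simp
  fix T assume T: "T \<in> tilings (region_of U D)"
  have box: "(c, j) \<in> ?I" if "j \<in> U c" for c j
    using that U_sub[of c] U_empty[of c] by (cases "c \<in> {c0..<c0 + int N}") auto
  have "verticals T c \<subseteq> U c" for c using strip_tiling_T[OF T, of c] by (auto simp: strip_tiling_def)
  then have U: "Left_Loz c j \<in> T \<Longrightarrow> j \<in> U c" "Right_Loz c j \<in> T \<Longrightarrow> j \<in> U c" "Vertical_Loz c j \<in> T \<Longrightarrow> j \<in> U c" for c j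
    using lefts_sub(1)[OF T, of c] rights_sub[OF T, of c] by (auto simp: lefts_def rights_def verticals_def)
  show "T \<subseteq> ?B"
  proof
    fix L assume L: "L \<in> T"
    show "L \<in> ?B"
    proof (cases L)
      case (Right_Loz c j)
      then show ?thesis using U(2)[of c j] L box[of j c] by force
    next
      case (Left_Loz c j)
      then show ?thesis using U(1)[of c j] L box[of j c] by force
    next
      case (Vertical_Loz c j)
      then show ?thesis using U(3)[of c j] L box[of j c] by force
    qed
  qed
qed

lemma finite_tilings: "finite (tilings (region_of U D))"
  and finite_tiling: "T \<in> tilings (region_of U D) \<Longrightarrow> finite T"
proof -
  obtain \<B> where B: "finite \<B>" "\<And>T. T \<in> tilings (region_of U D) \<Longrightarrow> T \<subseteq> \<B>"
    using finite_tiling_box by blast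
  then have "tilings (region_of U D) \<subseteq> Pow \<B>" by blast
  then show "finite (tilings (region_of U D))" using B(1) finite_subset by blast
  show "T \<in> tilings (region_of U D) \<Longrightarrow> finite T" using B finite_subset by blast
qed

lemma M2_kappa: "M2 q (region_of U D) = (\<Sum>T\<in>tilings (region_of U D). q ^ kappa T)"
  unfolding M2_def by (intro sum.cong refl prod_weight finite_tiling)

text \<open>C is half of the tiling-independent constant in \<open>kappa_eq\<close>; the rest of the
  weight is a product over lines, hence a weight of chains.\<close>

lemma M2_eq_chain_sum:
  fixes q :: "'a::field"
  assumes "generic_q q"
    and C: "2 * C = (\<Sum>c\<in>{c0..<c0 + int N}. (\<Sum>j\<in>D c. (j + 1) * (j + 2)) - (\<Sum>j\<in>U c. j * (j + 1)))"
  shows "M2 q (region_of U D) = q powi C * chain_sum rel (generic_q.wt q) N {}"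
proof -
  interpret generic_q q by fact
  have wt: "q ^ kappa T = q powi C * (\<Prod>i<N. wt (lefts T (c0 + int i)))" if T: "T \<in> tilings (region_of U D)" for T
  proof -
    have "int (kappa T) = C - (\<Sum>c\<in>{c0..<c0 + int N}. \<Sum>j\<in>lefts T c. j + 1)"
      using kappa_eq[OF T] C by linarith
    also have "(\<Sum>c\<in>{c0..<c0 + int N}. \<Sum>j\<in>lefts T c. j + 1) = (\<Sum>i<N. \<Sum>j\<in>lefts T (c0 + int i). j + 1)"
      by (rule sum.reindex_bij_witness[of _ "\<lambda>i. c0 + int i" "\<lambda>c. nat (c - c0)"]) auto
    finally have k: "int (kappa T) = C + (\<Sum>i<N. - (\<Sum>j\<in>lefts T (c0 + int i). j + 1))"
      by (simp add: sum_negf)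
    have "q ^ kappa T = q powi (int (kappa T))" by simp
    also have "\<dots> = q powi C * q powi (\<Sum>i<N. - (\<Sum>j\<in>lefts T (c0 + int i). j + 1))"
      unfolding k powi_mult ..
    finally show ?thesis unfolding wt_def prod_powi_sum[OF finite_lessThan] .
  qed
  have "M2 q (region_of U D) = (\<Sum>T\<in>tilings (region_of U D). q powi C * (\<Prod>i<N. wt (lefts T (c0 + int i))))"
    unfolding M2_kappa by (rule sum.cong[OF refl wt])
  also have "\<dots> = (\<Sum>S\<in>families. q powi C * (\<Prod>i<N. wt (S (c0 + int i))))"
    by (rule sum.reindex_bij_betw[OF lefts_bij])
  also have "\<dots> = (\<Sum>S\<in>chains rel N {}. q powi C * (\<Prod>i<N. wt (S i)))"
    by (rule sum.reindex_bij_betw[OF families_bij])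
  finally show ?thesis by (simp add: chain_sum_def sum_distrib_left)
qed

text \<open>The strip conditions bound differences between counting functions of neighbouring lines
  by quantities depending on the region alone. Constraints of this form are stable under pointwise
  maxima, and by \<open>count_ge_max\<close> the maxima again come from sets.\<close>

lemma tiling_join:
  assumes T: "T \<in> tilings (region_of U D)" "T' \<in> tilings (region_of U D)"
  obtains J where "J \<in> tilings (region_of U D)"
    "\<And>c k. count_ge (lefts J c) k = max (count_ge (lefts T c) k) (count_ge (lefts T' c) k)"
proof -
  let ?M = "\<lambda>c k. max (count_ge (lefts T c) k) (count_ge (lefts T' c) k)"
  define S where "S c = {k. ?M c (k + 1) < ?M c k}" for c
  have fin: "finite (lefts T c)" "finite (lefts T' c)" for c
    using lefts_sub(1)[OF T(1), of c] lefts_sub(1)[OF T(2), of c] finite_U finite_subset by blast+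
  have cnt: "count_ge (S c) k = ?M c k" for c k
    unfolding S_def by (rule count_ge_max(2)[OF fin])
  have sub: "S c \<subseteq> lefts T c \<union> lefts T' c" for c
    unfolding S_def by (rule count_ge_max(1)[OF fin])
  have "S \<in> families"
    unfolding families_def
  proof (intro CollectI allI conjI)
    fix c
    show sU: "S c \<subseteq> U c" using sub[of c] lefts_sub(1)[OF T(1)] lefts_sub(1)[OF T(2)] by blast
    show sD: "S (c + 1) \<subseteq> D c" using sub[of "c + 1"] lefts_sub(2)[OF T(1)] lefts_sub(2)[OF T(2)] by blast
    have "strip_ok (U c - lefts T c) (D c - lefts T (c + 1))" "strip_ok (U c - lefts T' c) (D c - lefts T' (c + 1))"
      using lefts_family[OF T(1)] lefts_family[OF T(2)] unfolding families_def by blast+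
    then have "count_ge (D c) k - count_ge (lefts T (c + 1)) k \<le> count_ge (U c) k - count_ge (lefts T c) k"
      "count_ge (U c) k - count_ge (lefts T c) k \<le> count_ge (D c) (k - 1) - count_ge (lefts T (c + 1)) (k - 1)"
      "count_ge (D c) k - count_ge (lefts T' (c + 1)) k \<le> count_ge (U c) k - count_ge (lefts T' c) k"
      "count_ge (U c) k - count_ge (lefts T' c) k \<le> count_ge (D c) (k - 1) - count_ge (lefts T' (c + 1)) (k - 1)" for k
      unfolding strip_ok_def count_ge_Diff[OF finite_U lefts_sub(1)[OF T(1)]] count_ge_Diff[OF finite_U lefts_sub(1)[OF T(2)]]
        count_ge_Diff[OF finite_D lefts_sub(2)[OF T(1)]] count_ge_Diff[OF finite_D lefts_sub(2)[OF T(2)]]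
      by blast+
    then show "strip_ok (U c - S c) (D c - S (c + 1))"
      unfolding strip_ok_def count_ge_Diff[OF finite_U sU] count_ge_Diff[OF finite_D sD] cnt
      by (smt (verit, best))
  qed
  then obtain J where "J \<in> tilings (region_of U D)" "lefts J = S"
    using lefts_bij unfolding bij_betw_def by (metis imageE)
  then show ?thesis using that cnt by blast
qed

text \<open>A tiling with least \<open>kappa\<close> has the largest sum of left heights. Its join
  with T dominates it in every count but cannot have a larger sum, so all counts agree and T is
  dominated.\<close>

lemma minimal_tiling:
  assumes "tilings (region_of U D) \<noteq> {}"
  obtains T0 where "T0 \<in> tilings (region_of U D)"
    "\<And>T. T \<in> tilings (region_of U D) \<Longrightarrow> kappa T0 \<le> kappa T"
    "\<And>T c k. T \<in> tilings (region_of U D) \<Longrightarrow> 0 \<le> k \<Longrightarrow> count_ge (lefts T c) k \<le> count_ge (lefts T0 c) k"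
proof -
  let ?R = "tilings (region_of U D)" and ?C = "{c0..<c0 + int N}"
  obtain T0 where T0: "T0 \<in> ?R" and min: "\<And>T. T \<in> ?R \<Longrightarrow> kappa T0 \<le> kappa T"
    using ex_min_if_finite[of "kappa ` ?R"] finite_tilings assms
    by (metis (no_types, lifting) arg_min_if_finite(1) arg_min_least)
  have lsum: "(\<Sum>c\<in>?C. \<Sum>j\<in>lefts T c. j + 1) = (\<Sum>(c, k)\<in>?C \<times> {..<H}. count_ge (lefts T c) (int k))"
    if "T \<in> ?R" for T
  proof -
    have "(\<Sum>j\<in>lefts T c. j + 1) = (\<Sum>k<H. count_ge (lefts T c) (int k))" for c
      using lefts_sub(1)[OF that, of c] U_sub[of c] by (intro sum_heights_eq_sum_counts) auto
    then show ?thesis by (simp add: sum.cartesian_product)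
  qed
  have "count_ge (lefts T c) k \<le> count_ge (lefts T0 c) k" if T: "T \<in> ?R" and k: "0 \<le> k" for T c k
  proof (cases "c \<in> ?C \<and> k < int H")
    case True
    obtain J where J: "J \<in> ?R"
      "\<And>c k. count_ge (lefts J c) k = max (count_ge (lefts T c) k) (count_ge (lefts T0 c) k)"
      using tiling_join[OF T T0] by blast
    have "(\<Sum>(c, k)\<in>?C \<times> {..<H}. count_ge (lefts J c) (int k)) \<le> (\<Sum>(c, k)\<in>?C \<times> {..<H}. count_ge (lefts T0 c) (int k))"
      unfolding lsum[OF J(1), symmetric] lsum[OF T0, symmetric]
      using kappa_eq[OF J(1)] kappa_eq[OF T0] min[OF J(1)] by linarith
    moreover have "(\<Sum>(c, k)\<in>?C \<times> {..<H}. count_ge (lefts T0 c) (int k)) \<le> (\<Sum>(c, k)\<in>?C \<times> {..<H}. count_ge (lefts J c) (int k))"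
      by (rule sum_mono) (auto simp: J(2))
    ultimately have eq: "(\<Sum>(c, k)\<in>?C \<times> {..<H}. count_ge (lefts T0 c) (int k)) = (\<Sum>(c, k)\<in>?C \<times> {..<H}. count_ge (lefts J c) (int k))"
      by linarith
    have "(case (c, nat k) of (c, k) \<Rightarrow> count_ge (lefts T0 c) (int k)) = (case (c, nat k) of (c, k) \<Rightarrow> count_ge (lefts J c) (int k))"
      by (rule sum_mono_inv[OF eq]) (use True k in \<open>auto simp: J(2)\<close>)
    then show ?thesis using k J(2)[of c k] by simp
  next
    case False
    then have "count_ge (lefts T c) k = 0"
      using lefts_sub(1)[OF T, of c] U_sub[of c] U_empty[of c] count_ge_above[of "lefts T c" 0 "int H" k] by auto
    then show ?thesis using count_ge_nonneg[of "lefts T0 c" k] by simp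
  qed
  then show ?thesis using that T0 min by blast
qed

text \<open>The heights are integers here, unlike in \<open>solid\<close>, so that the induction in
  \<open>rcount_plus_lefts\<close> can descend to an arbitrary height.\<close>

definition rcount :: "lozenge set \<Rightarrow> int \<Rightarrow> int \<Rightarrow> nat" where
  "rcount T d k = card {(i, j). Right_Loz i j \<in> T \<and> i + j = d \<and> k \<le> j + 1}"

lemma rcount_step:
  assumes T: "T \<in> tilings (region_of U D)"
  shows "int (rcount T d k) = int (rcount T d (k + 1)) + (if Right_Loz (d - k + 1) (k - 1) \<in> T then 1 else 0)"
proof -
  let ?S = "\<lambda>k. {(i, j). Right_Loz i j \<in> T \<and> i + j = d \<and> k \<le> j + 1}"
  have fin: "finite (?S (k + 1))"
    by (rule finite_subset[OF _ finite_rights[OF T]]) auto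
  show ?thesis
  proof (cases "Right_Loz (d - k + 1) (k - 1) \<in> T")
    case True
    have "?S k = insert (d - k + 1, k - 1) (?S (k + 1))"
    proof -
      have "j = k - 1" if "k \<le> j + 1" "\<not> k + 1 \<le> j + 1" for j using that by linarith
      then show ?thesis using True by auto
    qed
    moreover have "(d - k + 1, k - 1) \<notin> ?S (k + 1)" by auto
    ultimately show ?thesis using True fin unfolding rcount_def by (simp only: card_insert_disjoint) simp
  next
    case False
    have "?S k = ?S (k + 1)"
    proof -
      have "k + 1 \<le> j + 1" if "k \<le> j + 1" "Right_Loz i j \<in> T" "i + j = d" for i j
      proof (rule ccontr)
        assume "\<not> k + 1 \<le> j + 1"
        then have "j = k - 1" "i = d - k + 1" using that by linarith+
        then show False using False that(2) by metis
      qed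
      then show ?thesis by auto
    qed
    then show ?thesis using False unfolding rcount_def by simp
  qed
qed

text \<open>
  The right and left lozenges met on the two lattice lines going up from a point are the net flow
  out of the wedge between these lines, so their total number does not depend on the tiling.
\<close>

lemma rcount_plus_lefts:
  assumes T: "T \<in> tilings (region_of U D)" and T': "T' \<in> tilings (region_of U D)"
  shows "int (rcount T d k) + count_ge (lefts T (d - k + 2)) (k - 1)
    = int (rcount T' d k) + count_ge (lefts T' (d - k + 2)) (k - 1)"
proof -
  have base: "int (rcount T d k) + count_ge (lefts T (d - k + 2)) (k - 1) = 0"
    if T: "T \<in> tilings (region_of U D)" and k: "int H + 1 \<le> k" for T k
  proof -
    have "{(i, j). Right_Loz i j \<in> T \<and> i + j = d \<and> k \<le> j + 1} = {}"
    proof -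
      have "j < int H" if "Right_Loz i j \<in> T" for i j
        using that rights_sub[OF T, of i] U_sub[of i] by (auto simp: rights_def)
      then show ?thesis using k by fastforce
    qed
    moreover have "count_ge (lefts T (d - k + 2)) (k - 1) = 0"
      using lefts_sub(1)[OF T] U_sub k by (intro count_ge_above[of _ 0 "int H"]) (blast, simp)
    ultimately show ?thesis unfolding rcount_def by (simp only: card.empty)
  qed
  \<comment> \<open>One row down, the quantity changes by counts of the region alone, which are the
    same for every tiling.\<close>
  have step: "int (rcount T d k) + count_ge (lefts T (d - k + 2)) (k - 1)
    = int (rcount T d (k + 1)) + count_ge (lefts T (d - (k + 1) + 2)) (k + 1 - 1)
      + count_ge (D (d - k + 1)) (k - 1) - count_ge (U (d - k + 1)) k"
    if T: "T \<in> tilings (region_of U D)" for T k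
  proof -
    have e: "d - k + 1 + 1 = d - k + 2" "d - (k + 1) + 2 = d - k + 1" "k - 1 + 1 = k" "k + 1 - 1 = k" by auto
    show ?thesis using right_indicator[OF T, of "d - k + 1" "k - 1"] rcount_step[OF T, of d k] unfolding e by linarith
  qed
  have "int (rcount T d (int H + 1 - int n)) + count_ge (lefts T (d - (int H + 1 - int n) + 2)) (int H + 1 - int n - 1)
    = int (rcount T' d (int H + 1 - int n)) + count_ge (lefts T' (d - (int H + 1 - int n) + 2)) (int H + 1 - int n - 1)" for n
  proof (induction n)
    case 0
    then show ?case using base[OF T, of "int H + 1"] base[OF T', of "int H + 1"] by simp
  next
    case (Suc n)
    have e: "int H + 1 - int (Suc n) + 1 = int H + 1 - int n" by simp
    show ?case
      using step[OF T, of "int H + 1 - int (Suc n)"] step[OF T', of "int H + 1 - int (Suc n)"] Suc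
      unfolding e by linarith
  qed
  from this[of "nat (int H + 1 - k)"] show ?thesis
    using base[OF T, of k] base[OF T', of k] by (cases "k \<le> int H + 1") auto
qed

lemma solid_alt: "solid T = {(d, m, k). 1 \<le> k \<and> m < rcount T d (int k)}"
  by (simp add: solid_def rcount_def)

text \<open>A double count: a right lozenge in row j contributes one cube for each of the heights 1,
  ..., j + 1.\<close>

lemma card_solid:
  assumes T: "T \<in> tilings (region_of U D)"
  shows "finite (solid T)" "card (solid T) = kappa T"
proof -
  define R where "R = {(i, j). Right_Loz i j \<in> T}"
  define Ds where "Ds = (\<lambda>(i, j). i + j) ` R"
  have finR: "finite R" unfolding R_def by (rule finite_rights[OF T])
  have Rbd: "0 \<le> j \<and> j < int H" if "(i, j) \<in> R" for i j
    using that rights_sub[OF T, of i] U_sub[of i] by (auto simp: rights_def R_def)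
  have rc: "rcount T d k = (\<Sum>(i, j)\<in>R. if i + j = d \<and> k \<le> j + 1 then 1 else 0)" for d k
  proof -
    have "rcount T d k = card (R \<inter> {(i, j). i + j = d \<and> k \<le> j + 1})"
      unfolding rcount_def by (rule arg_cong[where f = card]) (auto simp: R_def)
    also have "\<dots> = (\<Sum>p\<in>R. if p \<in> {(i, j). i + j = d \<and> k \<le> j + 1} then 1 else 0)"
      using finR by (simp add: sum.If_cases)
    also have "\<dots> = (\<Sum>(i, j)\<in>R. if i + j = d \<and> k \<le> j + 1 then 1 else 0)"
      by (simp add: case_prod_unfold)
    finally show ?thesis .
  qed
  have zero: "rcount T d (int k) = 0" if "d \<notin> Ds \<or> H < k" for d k
  proof -
    have "{(i, j). Right_Loz i j \<in> T \<and> i + j = d \<and> int k \<le> j + 1} = {}"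
      using that Rbd by (force simp: Ds_def R_def)
    then show ?thesis unfolding rcount_def by (simp only: card.empty)
  qed
  define Q where "Q = (SIGMA p:Ds \<times> {1..H}. {..<rcount T (fst p) (int (snd p))})"
  have finQ: "finite Q" using finR by (auto simp: Q_def Ds_def)
  have bij: "bij_betw (\<lambda>((d, k), m). (d, m, k)) Q (solid T)"
  proof (rule bij_betw_byWitness[where f' = "\<lambda>(d, m, k). ((d, k), m)"])
    show "(\<lambda>(d, m, k). ((d, k), m)) ` solid T \<subseteq> Q"
    proof (rule image_subsetI)
      fix p assume "p \<in> solid T"
      then obtain d m k where p: "p = (d, m, k)" "1 \<le> k" "m < rcount T d (int k)"
        by (auto simp: solid_alt)
      then have "d \<in> Ds" "k \<le> H" using zero[of d k] by (auto simp: not_le[symmetric])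
      then show "(case p of (d, m, k) \<Rightarrow> ((d, k), m)) \<in> Q" using p by (simp add: Q_def)
    qed
  qed (auto simp: Q_def solid_alt)
  show "finite (solid T)" using bij finQ bij_betw_finite by blast
  have "card (solid T) = card Q" using bij_betw_same_card[OF bij] by simp
  also have "\<dots> = (\<Sum>p\<in>Ds \<times> {1..H}. rcount T (fst p) (int (snd p)))"
    using finR by (simp add: Q_def Ds_def)
  also have "\<dots> = (\<Sum>d\<in>Ds. \<Sum>k=1..H. rcount T d (int k))"
    by (simp add: sum.cartesian_product split_beta)
  also have "\<dots> = (\<Sum>d\<in>Ds. \<Sum>k=1..H. \<Sum>(i, j)\<in>R. if i + j = d \<and> int k \<le> j + 1 then 1 else 0)"
    unfolding rc ..
  also have "\<dots> = (\<Sum>d\<in>Ds. \<Sum>(i, j)\<in>R. \<Sum>k=1..H. if i + j = d \<and> int k \<le> j + 1 then 1 else 0)"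
    by (intro sum.cong refl, subst sum.swap) (simp add: split_beta)
  also have "\<dots> = (\<Sum>(i, j)\<in>R. \<Sum>d\<in>Ds. \<Sum>k=1..H. if i + j = d \<and> int k \<le> j + 1 then 1 else 0)"
    by (subst sum.swap) (simp add: split_beta)
  also have "\<dots> = (\<Sum>(i, j)\<in>R. nat (j + 1))"
  proof (rule sum.cong[OF refl], clarify)
    fix i j assume ij: "(i, j) \<in> R"
    have d: "i + j \<in> Ds" "finite Ds" using ij finR by (force simp: Ds_def)+
    have "(\<Sum>d\<in>Ds. \<Sum>k=1..H. if i + j = d \<and> int k \<le> j + 1 then 1 else 0)
      = (\<Sum>d\<in>Ds. if i + j = d then (\<Sum>k=1..H. if int k \<le> j + 1 then 1 else 0) else (0::nat))"
      by (intro sum.cong refl) auto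
    also have "\<dots> = (\<Sum>k=1..H. if int k \<le> j + 1 then 1 else 0)"
      using d by (subst sum.delta') auto
    also have "\<dots> = card ({1..H} \<inter> {k. int k \<le> j + 1})" by (simp add: sum.If_cases)
    also have "{1..H} \<inter> {k. int k \<le> j + 1} = {1..nat (j + 1)}" using Rbd[OF ij] by auto
    finally show "(\<Sum>d\<in>Ds. \<Sum>k=1..H. if i + j = d \<and> int k \<le> j + 1 then 1 else 0) = nat (j + 1)" by simp
  qed
  finally show "card (solid T) = kappa T" by (simp add: kappa_def R_def)
qed

text \<open>By \<open>rcount_plus_lefts\<close>, a tiling with the largest left counts has the
  smallest right counts. Its solid is therefore contained in all others and equals the floor that
  \<open>pile\<close> takes away.\<close>

lemma volume_eq:
  assumes "tilings (region_of U D) \<noteq> {}"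
  obtains T0 where "T0 \<in> tilings (region_of U D)"
    "\<And>T. T \<in> tilings (region_of U D) \<Longrightarrow> kappa T = kappa T0 + volume (region_of U D) T"
proof -
  obtain T0 where T0: "T0 \<in> tilings (region_of U D)"
    "\<And>T. T \<in> tilings (region_of U D) \<Longrightarrow> kappa T0 \<le> kappa T"
    "\<And>T c k. T \<in> tilings (region_of U D) \<Longrightarrow> 0 \<le> k \<Longrightarrow> count_ge (lefts T c) k \<le> count_ge (lefts T0 c) k"
    using minimal_tiling[OF assms] by blast
  have sub: "solid T0 \<subseteq> solid T" if T: "T \<in> tilings (region_of U D)" for T
  proof -
    have "rcount T0 d (int k) \<le> rcount T d (int k)" if "1 \<le> k" for d k
      using rcount_plus_lefts[OF T T0(1), of d "int k"] T0(3)[OF T, of "int k - 1" "d - int k + 2"] that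
      by linarith
    then show ?thesis unfolding solid_alt by (auto intro: less_le_trans)
  qed
  have "kappa T = kappa T0 + volume (region_of U D) T" if T: "T \<in> tilings (region_of U D)" for T
  proof -
    have "(\<Inter>T'\<in>tilings (region_of U D). solid T') = solid T0" using sub T0(1) by blast
    then have "volume (region_of U D) T = card (solid T - solid T0)" by (simp add: volume_def pile_def)
    also have "\<dots> = kappa T - kappa T0"
      using sub[OF T] card_solid[OF T] card_solid[OF T0(1)] by (simp add: card_Diff_subset)
    finally show ?thesis using T0(2)[OF T] by simp
  qed
  then show ?thesis using that T0(1) by blast
qed

end

section \<open>The two halves of the region\<close>

text \<open>e and e' are the rows missing from a trapezoid strip. Treated as occupied by left
  lozenges they give the situation of \<open>strip_ok_left\<close>; since e' consists of intervals,
  \<open>interlaces_forced\<close> puts e into every B.\<close>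

lemma strip_bij_left:
  fixes l m n u :: int
  defines "e \<equiv> {l..<m} \<union> {n..<u}" and "e' \<equiv> {l - 1..<m} \<union> {n - 1..<u}"
  assumes lu: "l \<le> u" and e: "e \<subseteq> {l..<u}" and e': "e' \<subseteq> {l - 1..<u}" and A': "A' \<subseteq> {l - 1..<u} - e'"
  shows "bij_betw (\<lambda>A. A \<union> e) {A. A \<subseteq> {l..<u} - e \<and> strip_ok ({l..<u} - e - A) ({l - 1..<u} - e' - A')}
    {B. interlaces B (A' \<union> e')}" (is "bij_betw ?f ?L ?R")
proof -
  have iff: "strip_ok ({l..<u} - e - A) ({l - 1..<u} - e' - A') \<longleftrightarrow> interlaces (A \<union> e) (A' \<union> e')"
    if A: "A \<subseteq> {l..<u} - e" for A
  proof -
    have "{l..<u} - e - A = {l..<u} - (A \<union> e)" "{l - 1..<u} - e' - A' = {l - 1..<u} - (A' \<union> e')" by auto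
    then show ?thesis using strip_ok_left[of "A \<union> e" l u "A' \<union> e'"] A A' e e' lu by auto
  qed
  have "inj_on ?f ?L" by (rule inj_onI) blast
  moreover have "B \<in> ?f ` ?L" if B: "interlaces B (A' \<union> e')" for B
  proof -
    have "A' \<union> e' \<subseteq> {l - 1..<u}" using A' e' by auto
    from interlaces_bounds[OF B this] have sub: "B \<subseteq> {l..<u}" by simp
    have "e \<subseteq> B"
      using interlaces_forced[OF B, of "l - 1" m] interlaces_forced[OF B, of "n - 1" u]
      by (auto simp: e_def e'_def)
    then have eq: "B = (B - e) \<union> e" by auto
    have "B - e \<subseteq> {l..<u} - e" using sub by auto
    moreover from this have "strip_ok ({l..<u} - e - (B - e)) ({l - 1..<u} - e' - A')"
      using iff[of "B - e"] B eq by simp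
    ultimately show ?thesis using eq by blast
  qed
  ultimately show ?thesis using iff by (auto simp: bij_betw_def)
qed

text \<open>The rows that interlacing forces into B, \<open>{l + 1..<m}\<close> and
  \<open>{n + 1..<u}\<close>, are exactly the translates of the two intervals of e'.\<close>

lemma strip_bij_right:
  fixes l m n u :: int
  defines "e \<equiv> {l..<m} \<union> {n..<u}" and "e' \<equiv> {l..<m - 1} \<union> {n..<u - 1}"
  assumes lu: "l < u" and e: "e \<subseteq> {l..<u}" and e': "e' \<subseteq> {l..<u - 1}" and A: "A \<subseteq> {l..<u} - e"
  shows "bij_betw (\<lambda>A'. (+) 1 ` (A' \<union> e'))
    {A'. A' \<subseteq> {l..<u - 1} - e' \<and> strip_ok ({l..<u} - e - A) ({l..<u - 1} - e' - A')}
    {B. interlaces B (A \<union> e)}" (is "bij_betw ?f ?L ?R")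
proof -
  have iff: "strip_ok ({l..<u} - e - A) ({l..<u - 1} - e' - A') \<longleftrightarrow> interlaces ((+) 1 ` (A' \<union> e')) (A \<union> e)"
    if A': "A' \<subseteq> {l..<u - 1} - e'" for A'
  proof -
    have "{l..<u} - e - A = {l..<u} - (A \<union> e)" "{l..<u - 1} - e' - A' = {l..<u - 1} - (A' \<union> e')" by auto
    then show ?thesis using strip_ok_right[of "A \<union> e" l u "A' \<union> e'"] A A' e e' lu by auto
  qed
  have inj1: "inj ((`) ((+) (1::int)))" by (intro inj_image_mem_iff inj_onI) (simp add: inj_image_eq_iff)
  have "inj_on ?f ?L"
  proof (rule inj_onI)
    fix S T assume "S \<in> ?L" "T \<in> ?L" "?f S = ?f T"
    then have "S \<union> e' = T \<union> e'" "S \<inter> e' = {}" "T \<inter> e' = {}" using inj1 by (auto dest: injD)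
    then show "S = T" by blast
  qed
  moreover have "B \<in> ?f ` ?L" if B: "interlaces B (A \<union> e)" for B
  proof -
    have "A \<union> e \<subseteq> {l..<u}" using A e by auto
    from interlaces_bounds[OF B this] have sub: "B \<subseteq> {l + 1..<u}" by simp
    have eB: "{l + 1..<m} \<union> {n + 1..<u} \<subseteq> B"
      using interlaces_forced[OF B, of l m] interlaces_forced[OF B, of n u] by (auto simp: e_def)
    define B' where "B' = (+) (-1) ` B"
    have B': "B = (+) 1 ` B'" by (simp add: B'_def image_image)
    have "e' \<subseteq> B'"
    proof
      fix j assume "j \<in> e'"
      then have "j + 1 \<in> B" using eB by (auto simp: e'_def)
      then show "j \<in> B'" unfolding B'_def by (rule rev_image_eqI) simp
    qed
    then have eq: "B' = (B' - e') \<union> e'" by auto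
    have "B' - e' \<subseteq> {l..<u - 1} - e'" using sub by (auto simp: B'_def)
    moreover from this have "strip_ok ({l..<u} - e - A) ({l..<u - 1} - e' - (B' - e'))"
      using iff[of "B' - e'"] B B' eq by simp
    ultimately show ?thesis using eq B' by blast
  qed
  ultimately show ?thesis using iff by (auto simp: bij_betw_def)
qed

locale q_params =
  fixes a b x y z t :: nat
begin

text \<open>There are w + x strips to the left of the line i = x and n strips to its right. The
  removed triangle of side b has its base at height h, the N side lies at height tp, and the NE side
  on the line i + j = mx.\<close>

definition w :: nat where "w = y + t"
definition n :: nat where "n = y + a + b"
definition h :: nat where "h = a + y + z"
definition tp :: nat where "tp = a + b + y + z + t"
definition mx :: nat where "mx = x + y + a + b + z"

definition QU :: "int \<Rightarrow> int set" where "QU c = {j. Up c j \<in> Q_region a b x y z t}"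
definition QD :: "int \<Rightarrow> int set" where "QD c = {j. Down c j \<in> Q_region a b x y z t}"

lemma Q_region_eq: "region_of QU QD = Q_region a b x y z t"
proof (rule Set.set_eqI)
  fix \<tau>
  show "\<tau> \<in> region_of QU QD \<longleftrightarrow> \<tau> \<in> Q_region a b x y z t"
    by (cases \<tau>) (auto simp: region_of_def QU_def QD_def)
qed

lemma QU_iff: "j \<in> QU c \<longleftrightarrow> - int w \<le> c \<and> c < int (x + n) \<and> 0 \<le> j \<and> j < int tp \<and> 0 \<le> c + j \<and> c + j < int mx
    \<and> \<not> (int x \<le> c \<and> int h \<le> j \<and> c + j < int (x + h + b)) \<and> \<not> (int x \<le> c \<and> c + j < int (x + a))"
  unfolding QU_def Q_region_def triangles_in_def hexagon_def up_triangle_def w_def n_def h_def tp_def mx_def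
  by auto

lemma QD_iff: "j \<in> QD c \<longleftrightarrow> - int w \<le> c \<and> c < int (x + n) \<and> 0 \<le> j \<and> j < int tp \<and> - 1 \<le> c + j \<and> c + j + 1 < int mx
    \<and> \<not> (int x \<le> c \<and> int h \<le> j \<and> c + j + 1 < int (x + h + b)) \<and> \<not> (int x \<le> c \<and> c + j + 1 < int (x + a))"
  unfolding QD_def Q_region_def triangles_in_def hexagon_def up_triangle_def w_def n_def h_def tp_def mx_def
  by auto

sublocale strip_region QU QD "- int w" "w + x + n" tp
proof
  show "QU c \<subseteq> {0..<int tp}" "QD c \<subseteq> {0..<int tp}" for c by (auto simp: QU_iff QD_iff)
  show "QU c = {}" "QD c = {}" if "c \<notin> {- int w..<- int w + int (w + x + n)}" for c
    using that by (auto simp: QU_iff QD_iff)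
qed

text \<open>
  \<open>eL c\<close> and \<open>eR m\<close> are the heights of the forced left lozenges on the lines \<open>i = c\<close> and \<open>i = x + m\<close> when
  the left and the right half of the region are completed to trapezoids.
\<close>

definition eL :: "int \<Rightarrow> int set" where "eL c = {- c..<0} \<union> {int mx - c..<int tp}"
definition WL :: "int \<Rightarrow> int set" where "WL c = {- c..<int tp} - eL c"
definition eR :: "nat \<Rightarrow> int set" where "eR m = {0..<int a - int m} \<union> {int h..<int (h + b) - int m}"
definition WR :: "nat \<Rightarrow> int set" where "WR m = {0..<int (h + b) - int m} - eR m"

lemma QU_left: "- int w \<le> c \<Longrightarrow> c < int x \<Longrightarrow> QU c = WL c"
  by (auto simp: QU_iff WL_def eL_def mx_def tp_def w_def n_def)

lemma QD_left: "- int w \<le> c \<Longrightarrow> c < int x \<Longrightarrow> QD c = WL (c + 1)"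
  by (auto simp: QD_iff WL_def eL_def mx_def tp_def w_def n_def)

text \<open>The removed triangle of side b has a side on the line of the NE side, so to the right of
  i = x nothing of the region lies above its base.\<close>

lemma QU_right: "m < n \<Longrightarrow> QU (int (x + m)) = WR m"
  by (auto simp: QU_iff WR_def eR_def mx_def tp_def w_def n_def h_def)

lemma QD_right: "m < n \<Longrightarrow> QD (int (x + m)) = WR (Suc m)"
  by (auto simp: QD_iff WR_def eR_def mx_def tp_def w_def n_def h_def)

lemma finite_eLR: "finite (eL c)" "finite (WL c)" "finite (eR m)" "finite (WR m)"
  by (auto simp: eL_def WL_def eR_def WR_def)

lemma rel_left:
  assumes i: "i < w + x" and A': "A' \<subseteq> WL (- int w + int i + 1)"
  shows "bij_betw (\<lambda>A. A \<union> eL (- int w + int i)) {A. rel i A A'} {B. interlaces B (A' \<union> eL (- int w + int i + 1))}"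
proof -
  define c where "c = - int w + int i"
  have c: "- int w \<le> c" "c < int x" using i by (auto simp: c_def)
  have bd: "- c \<le> int tp" "0 \<le> int tp" "0 < int mx - c"
    using c by (auto simp: tp_def w_def mx_def)
  have "{A. rel i A A'} = {A. A \<subseteq> WL c \<and> strip_ok (WL c - A) (WL (c + 1) - A')}"
    using A' QU_left[OF c] QD_left[OF c] by (auto simp: rel_def c_def)
  moreover have "bij_betw (\<lambda>A. A \<union> eL c) {A. A \<subseteq> WL c \<and> strip_ok (WL c - A) (WL (c + 1) - A')} {B. interlaces B (A' \<union> eL (c + 1))}"
  proof -
    have e: "- (c + 1) = - c - 1" "int mx - (c + 1) = int mx - c - 1" by auto
    have "eL c \<subseteq> {- c..<int tp}" "{- c - 1..<0} \<union> {int mx - c - 1..<int tp} \<subseteq> {- c - 1..<int tp}"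
      using bd by (auto simp: eL_def mx_def)
    then show ?thesis
      using strip_bij_left[of "- c" "int tp" 0 "int mx - c" A'] bd A'
      unfolding WL_def eL_def e c_def[symmetric] by simp
  qed
  ultimately show ?thesis by (simp add: c_def)
qed

lemma rel_right:
  assumes m: "m < n" and A: "A \<subseteq> WR m"
  shows "bij_betw (\<lambda>A'. (+) 1 ` (A' \<union> eR (Suc m))) {A'. rel (w + x + m) A A'} {B. interlaces B (A \<union> eR m)}"
proof -
  have c: "- int w + int (w + x + m) = int (x + m)" by simp
  have bd: "0 < int (h + b) - int m" using m by (auto simp: n_def h_def)
  have "{A'. rel (w + x + m) A A'} = {A'. A' \<subseteq> WR (Suc m) \<and> strip_ok (WR m - A) (WR (Suc m) - A')}"
    using A QU_right[OF m] QD_right[OF m] unfolding rel_def c by auto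
  moreover have "bij_betw (\<lambda>A'. (+) 1 ` (A' \<union> eR (Suc m)))
    {A'. A' \<subseteq> WR (Suc m) \<and> strip_ok (WR m - A) (WR (Suc m) - A')} {B. interlaces B (A \<union> eR m)}"
  proof -
    have e: "int a - int (Suc m) = int a - int m - 1" "int (h + b) - int (Suc m) = int (h + b) - int m - 1" by auto
    have "eR m \<subseteq> {0..<int (h + b) - int m}"
      "{0..<int a - int m - 1} \<union> {int h..<int (h + b) - int m - 1} \<subseteq> {0..<int (h + b) - int m - 1}"
      by (auto simp: eR_def h_def)
    then show ?thesis
      using strip_bij_right[of 0 "int (h + b) - int m" "int a - int m" "int h" A] bd A
      unfolding WR_def eR_def e by simp
  qed
  ultimately show ?thesis by simp
qed

text \<open>Compensates for the forced lozenges, whose weights occur in \<open>patterns\<close> but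
  not in the chain sum.\<close>

definition left_exponent :: "nat \<Rightarrow> int" where
  "left_exponent l = (\<Sum>i<l. \<Sum>j\<in>eL (- int w + int i). j + 1)"

text \<open>Besides the forced lozenges, each translation by 1 in \<open>rel_right\<close>
  contributes a binomial coefficient through \<open>patterns_shift\<close>.\<close>

definition right_exponent :: "nat \<Rightarrow> int" where
  "right_exponent k = (\<Sum>m<k. int ((n - m) choose 2) + (\<Sum>j\<in>eR (Suc m). j + 1))"

context
  fixes q :: "'a::field"
  assumes generic: "generic_q q"
begin

interpretation generic_q q by (rule generic)

abbreviation (input) LS :: "nat \<Rightarrow> int set \<Rightarrow> 'a" where
  "LS \<equiv> chain_sum rel wt"

lemma wt_inverse: "wt A * q powi (\<Sum>j\<in>A. j + 1) = 1"
  by (simp add: wt_def powi_mult)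

text \<open>Interlacing adds one element per line, so only sets that have l elements after
  completion are reached on line l. On those the chain sum satisfies the recursion of
  \<open>patterns\<close>, up to the weights of forced lozenges.\<close>

lemma left_sum:
  assumes "l \<le> w + x" "A \<subseteq> WL (- int w + int l)"
  shows "LS l A = (if card (A \<union> eL (- int w + int l)) = l
    then q powi left_exponent l * patterns (A \<union> eL (- int w + int l)) else 0)"
  using assms
proof (induction l arbitrary: A)
  case 0
  have e: "eL (- int w) = {}" by (auto simp: eL_def w_def mx_def tp_def)
  have "finite A" using 0(2) by (rule finite_subset) (rule finite_eLR)
  moreover have "LS 0 A = 0" if "A \<noteq> {}"
  proof -
    have "chains rel 0 A = {}" using that by (auto simp: chains_def)
    then show ?thesis by (simp add: chain_sum_def)
  qed
  ultimately show ?case by (auto simp: e chain_sum_0 left_exponent_def patterns_empty)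
next
  case (Suc l)
  define c where "c = - int w + int l"
  have c1: "- int w + int (Suc l) = c + 1" by (simp add: c_def)
  have A: "A \<subseteq> WL (c + 1)" using Suc.prems(2) unfolding c1 .
  have l: "l < w + x" using Suc.prems by simp
  have bij: "bij_betw (\<lambda>B. B \<union> eL c) {B. rel l B A} {B. interlaces B (A \<union> eL (c + 1))}"
    using rel_left[OF l, of A] A by (simp add: c_def)
  have card: "card (A \<union> eL (c + 1)) = Suc (card (B \<union> eL c))" if "rel l B A" for B
    using bij that by (auto simp: bij_betw_def interlaces_def)
  have BW: "B \<subseteq> WL c" if "rel l B A" for B
    using that QU_left[of c] l by (simp add: rel_def c_def)
  have wtB: "wt (B \<union> eL c) = wt B * wt (eL c)" if "rel l B A" for B
    using BW[OF that] finite_eLR finite_subset[OF BW[OF that]] by (intro wt_Un_disjoint) (auto simp: WL_def)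
  have rec: "LS (Suc l) A = (\<Sum>B | rel l B A. wt B * LS l B)"
    by (rule chain_sum_Suc) (rule finite_rel)
  show ?case
  proof (cases "card (A \<union> eL (c + 1)) = Suc l")
    case True
    have "LS (Suc l) A = (\<Sum>B | rel l B A. wt B * (q powi left_exponent l * patterns (B \<union> eL c)))"
      unfolding rec
    proof (rule sum.cong[OF refl])
      fix B assume "B \<in> {B. rel l B A}"
      then have B: "rel l B A" by simp
      show "wt B * LS l B = wt B * (q powi left_exponent l * patterns (B \<union> eL c))"
        using Suc.IH[of B] l BW[OF B] card[OF B] True by (simp add: c_def)
    qed
    also have "\<dots> = (\<Sum>B | rel l B A. q powi left_exponent (Suc l) * (wt (B \<union> eL c) * patterns (B \<union> eL c)))"
    proof (rule sum.cong[OF refl])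
      fix B assume "B \<in> {B. rel l B A}"
      then have B: "rel l B A" by simp
      have "q powi left_exponent (Suc l) = q powi left_exponent l * q powi (\<Sum>j\<in>eL c. j + 1)"
        by (simp add: left_exponent_def powi_mult c_def)
      then have "q powi left_exponent (Suc l) * (wt (B \<union> eL c) * patterns (B \<union> eL c))
        = wt B * (q powi left_exponent l * patterns (B \<union> eL c)) * (wt (eL c) * q powi (\<Sum>j\<in>eL c. j + 1))"
        unfolding wtB[OF B] by (simp only: mult_ac)
      then show "wt B * (q powi left_exponent l * patterns (B \<union> eL c)) = q powi left_exponent (Suc l) * (wt (B \<union> eL c) * patterns (B \<union> eL c))"
        unfolding wt_inverse mult_1_right by (rule sym)
    qed
    also have "\<dots> = q powi left_exponent (Suc l) * (\<Sum>B | rel l B A. wt (B \<union> eL c) * patterns (B \<union> eL c))"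
      by (simp add: sum_distrib_left)
    also have "(\<Sum>B | rel l B A. wt (B \<union> eL c) * patterns (B \<union> eL c)) = (\<Sum>B | interlaces B (A \<union> eL (c + 1)). wt B * patterns B)"
      by (rule sum.reindex_bij_betw[OF bij])
    also have "\<dots> = patterns (A \<union> eL (c + 1))"
    proof (rule patterns_recursion[symmetric])
      show "finite (A \<union> eL (c + 1))" using finite_subset[OF A] finite_eLR by simp
      show "A \<union> eL (c + 1) \<noteq> {}" using True by auto
    qed
    finally show ?thesis using True unfolding c1 by simp
  next
    case False
    have "LS (Suc l) A = 0"
      unfolding rec
    proof (rule sum.neutral, clarify)
      fix B assume B: "rel l B A"
      then show "wt B * LS l B = 0"
        using Suc.IH[of B] l BW[OF B] card[OF B] False by (simp add: c_def)
    qed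
    then show ?thesis using False unfolding c1 by simp
  qed
qed

text \<open>Interpolates between \<open>main_sum\<close>, at m = 0 and up to a power of q, and the
  full chain sum at m = n: up to the line i = x + m families are summed as chains, beyond it as
  patterns.\<close>

definition rsum :: "nat \<Rightarrow> 'a" where
  "rsum m = (\<Sum>A | A \<subseteq> WR m \<and> card (A \<union> eR m) = n - m. LS (w + x + m) A * wt A * patterns (A \<union> eR m))"

text \<open>After the sums are exchanged, the chain steps from A to A' are the possible next rows of
  a pattern with top row \<open>A \<union> eR m\<close>, so the sum over A' is evaluated by
  \<open>patterns_recursion\<close>.\<close>

lemma rsum_step:
  assumes m: "m < n"
  shows "rsum (Suc m) = q powi (int ((n - m) choose 2) + (\<Sum>j\<in>eR (Suc m). j + 1)) * rsum m"
proof -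
  define P where "P = {A. A \<subseteq> WR m \<and> card (A \<union> eR m) = n - m}"
  define P' where "P' = {A. A \<subseteq> WR (Suc m) \<and> card (A \<union> eR (Suc m)) = n - Suc m}"
  define \<kappa> where "\<kappa> = q powi (int ((n - m) choose 2) + (\<Sum>j\<in>eR (Suc m). j + 1))"
  have fin: "finite P" "finite P'"
    using finite_subset[of P "Pow (WR m)"] finite_subset[of P' "Pow (WR (Suc m))"] finite_eLR
    by (auto simp: P_def P'_def)
  have c: "- int w + int (w + x + m) = int (x + m)" by simp
  have rel_sub: "A \<subseteq> WR m" "A' \<subseteq> WR (Suc m)" if "rel (w + x + m) A A'" for A A'
    using that QU_right[OF m] QD_right[OF m] unfolding rel_def c by auto
  have card: "card (A \<union> eR m) = Suc (card (A' \<union> eR (Suc m)))" if r: "rel (w + x + m) A A'" for A A'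
  proof -
    have "interlaces ((+) 1 ` (A' \<union> eR (Suc m))) (A \<union> eR m)"
      using rel_right[OF m rel_sub(1)[OF r]] r by (auto simp: bij_betw_def)
    then show ?thesis by (simp add: interlaces_def card_image)
  qed
  have set1: "{A. rel (w + x + m) A A'} = {A \<in> P. rel (w + x + m) A A'}" if "A' \<in> P'" for A'
  proof -
    have "card (A \<union> eR m) = n - m" if "rel (w + x + m) A A'" for A
      using card[OF that] \<open>A' \<in> P'\<close> m by (simp add: P'_def)
    then show ?thesis using rel_sub(1) by (auto simp: P_def)
  qed
  have set2: "{A'. rel (w + x + m) A A'} = {A' \<in> P'. rel (w + x + m) A A'}" if "A \<in> P" for A
  proof -
    have "card (A' \<union> eR (Suc m)) = n - Suc m" if "rel (w + x + m) A A'" for A'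
    proof -
      have "Suc (card (A' \<union> eR (Suc m))) = n - m" using card[OF that] \<open>A \<in> P\<close> by (simp add: P_def)
      then show ?thesis by arith
    qed
    then show ?thesis using rel_sub(2) unfolding P'_def by blast
  qed
  have inner: "(\<Sum>A' | A' \<in> P' \<and> rel (w + x + m) A A'. wt A' * patterns (A' \<union> eR (Suc m))) = \<kappa> * patterns (A \<union> eR m)"
    if A: "A \<in> P" for A
  proof -
    have AW: "A \<subseteq> WR m" "card (A \<union> eR m) = n - m" using A by (auto simp: P_def)
    have "patterns (A \<union> eR m) = (\<Sum>B | interlaces B (A \<union> eR m). wt B * patterns B)"
    proof (rule patterns_recursion)
      show "finite (A \<union> eR m)" using finite_subset[OF AW(1)] finite_eLR by simp
      show "A \<union> eR m \<noteq> {}" using AW m by auto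
    qed
    also have "\<dots> = (\<Sum>A' | rel (w + x + m) A A'. wt ((+) 1 ` (A' \<union> eR (Suc m))) * patterns ((+) 1 ` (A' \<union> eR (Suc m))))"
      by (rule sum.reindex_bij_betw[OF rel_right[OF m AW(1)], symmetric])
    also have "\<dots> = (\<Sum>A' | A' \<in> P' \<and> rel (w + x + m) A A'. wt ((+) 1 ` (A' \<union> eR (Suc m))) * patterns ((+) 1 ` (A' \<union> eR (Suc m))))"
      unfolding set2[OF A] by simp
    finally have pat: "patterns (A \<union> eR m) = \<dots>" .
    show ?thesis
      unfolding pat sum_distrib_left
    proof (rule sum.cong[OF refl])
      fix A' assume "A' \<in> {A'. A' \<in> P' \<and> rel (w + x + m) A A'}"
      then have A': "A' \<subseteq> WR (Suc m)" "card (A' \<union> eR (Suc m)) = n - Suc m" by (auto simp: P'_def)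
      have fA': "finite A'" using A' finite_eLR finite_subset by blast
      have "wt ((+) 1 ` (A' \<union> eR (Suc m))) * patterns ((+) 1 ` (A' \<union> eR (Suc m)))
        = q powi (- int (Suc (card (A' \<union> eR (Suc m))) choose 2)) * (wt (A' \<union> eR (Suc m)) * patterns (A' \<union> eR (Suc m)))"
        using fA' finite_eLR by (intro patterns_shift) auto
      also have "Suc (card (A' \<union> eR (Suc m))) = n - m" using A' m by simp
      also have "wt (A' \<union> eR (Suc m)) = wt A' * wt (eR (Suc m))"
        using fA' A' finite_eLR by (intro wt_Un_disjoint) (auto simp: WR_def)
      finally have eq: "wt ((+) 1 ` (A' \<union> eR (Suc m))) * patterns ((+) 1 ` (A' \<union> eR (Suc m)))
        = q powi (- int ((n - m) choose 2)) * (wt A' * wt (eR (Suc m)) * patterns (A' \<union> eR (Suc m)))" .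
      have "\<kappa> * (q powi (- int ((n - m) choose 2)) * (wt A' * wt (eR (Suc m)) * patterns (A' \<union> eR (Suc m))))
        = (q powi int ((n - m) choose 2) * q powi (- int ((n - m) choose 2)))
          * (wt (eR (Suc m)) * q powi (\<Sum>j\<in>eR (Suc m). j + 1)) * (wt A' * patterns (A' \<union> eR (Suc m)))"
        unfolding \<kappa>_def powi_mult[symmetric] by (simp only: mult_ac)
      also have "\<dots> = wt A' * patterns (A' \<union> eR (Suc m))"
        unfolding wt_inverse powi_mult by simp
      finally show "wt A' * patterns (A' \<union> eR (Suc m))
        = \<kappa> * (wt ((+) 1 ` (A' \<union> eR (Suc m))) * patterns ((+) 1 ` (A' \<union> eR (Suc m))))"
        unfolding eq by simp
    qed
  qed
  have "rsum (Suc m) = (\<Sum>A'\<in>P'. LS (Suc (w + x + m)) A' * wt A' * patterns (A' \<union> eR (Suc m)))"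
    by (simp add: rsum_def P'_def)
  also have "\<dots> = (\<Sum>A'\<in>P'. \<Sum>A | A \<in> P \<and> rel (w + x + m) A A'. wt A * LS (w + x + m) A * (wt A' * patterns (A' \<union> eR (Suc m))))"
  proof (rule sum.cong[OF refl])
    fix A' assume A': "A' \<in> P'"
    have "LS (Suc (w + x + m)) A' = (\<Sum>A | A \<in> P \<and> rel (w + x + m) A A'. wt A * LS (w + x + m) A)"
      using chain_sum_Suc[of rel wt "w + x + m" A'] finite_rel set1[OF A'] by simp
    then show "LS (Suc (w + x + m)) A' * wt A' * patterns (A' \<union> eR (Suc m))
      = (\<Sum>A | A \<in> P \<and> rel (w + x + m) A A'. wt A * LS (w + x + m) A * (wt A' * patterns (A' \<union> eR (Suc m))))"
      by (simp add: sum_distrib_right mult.assoc)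
  qed
  also have "\<dots> = (\<Sum>A\<in>P. \<Sum>A' | A' \<in> P' \<and> rel (w + x + m) A A'. wt A * LS (w + x + m) A * (wt A' * patterns (A' \<union> eR (Suc m))))"
    by (rule sum.swap_restrict[OF fin(2,1)])
  also have "\<dots> = (\<Sum>A\<in>P. wt A * LS (w + x + m) A * (\<kappa> * patterns (A \<union> eR m)))"
    unfolding sum_distrib_left[symmetric] by (rule sum.cong[OF refl]) (simp only: inner)
  also have "\<dots> = \<kappa> * rsum m"
    unfolding rsum_def P_def sum_distrib_left by (rule sum.cong[OF refl]) (simp only: mult_ac)
  finally show ?thesis by (simp only: \<kappa>_def)
qed

lemma chain_sum_total: "LS (w + x + n) {} = q powi (right_exponent n + left_exponent (w + x)) * main_sum a b x y z t"
proof -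
  have "rsum k = q powi right_exponent k * rsum 0" if "k \<le> n" for k
    using that
  proof (induction k)
    case (Suc k)
    then show ?case using rsum_step[of k] by (simp add: right_exponent_def powi_mult mult.assoc[symmetric] add.commute add.assoc)
  qed (simp add: right_exponent_def)
  moreover have "rsum n = LS (w + x + n) {}"
  proof -
    have e: "eR n = {}" by (auto simp: eR_def n_def)
    have "{A. A \<subseteq> WR n \<and> card (A \<union> eR n) = n - n} = {{}}"
      using finite_subset[OF _ finite_eLR(4)[of n]] by (auto simp: e)
    then show ?thesis by (simp add: rsum_def e patterns_empty wt_def)
  qed
  moreover have "rsum 0 = q powi left_exponent (w + x) * main_sum a b x y z t"
  proof -
    define Y0 where "Y0 = {int (h + b)..<int (h + b + t)}"
    have WR0: "WR 0 = {int a..<int h}" by (auto simp: WR_def eR_def h_def)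
    have eR0: "eR 0 = {0..<int a} \<union> {int h..<int (h + b)}" by (auto simp: eR_def)
    have eLx: "eL (int x) = {- int x..<0} \<union> Y0"
      by (auto simp: eL_def Y0_def mx_def h_def tp_def)
    have cardR: "card (A \<union> eR 0) = n \<longleftrightarrow> card A = y" if "A \<subseteq> {int a..<int h}" for A
    proof -
      have "finite A" using that finite_subset by blast
      moreover have "A \<inter> eR 0 = {}" using that by (auto simp: eR0)
      moreover have "card (eR 0) = a + b"
        unfolding eR0 by (subst card_Un_disjoint) (auto simp: h_def)
      ultimately show ?thesis by (simp add: card_Un_disjoint finite_eLR n_def)
    qed
    have cardL: "card (A \<union> eL (int x)) = w + x" if "A \<subseteq> {int a..<int h}" "card A = y" for A
    proof -
      have "finite A" using that finite_subset by blast
      moreover have "A \<inter> eL (int x) = {}" using that(1) by (auto simp: eLx Y0_def h_def)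
      moreover have "card (eL (int x)) = x + t"
        unfolding eLx Y0_def by (subst card_Un_disjoint) auto
      ultimately show ?thesis by (simp add: card_Un_disjoint finite_eLR w_def that(2))
    qed
    have WLx: "{int a..<int h} \<subseteq> WL (int x)"
      by (auto simp: WL_def eLx Y0_def h_def tp_def)
    have "rsum 0 = (\<Sum>A | A \<subseteq> {int a..<int h} \<and> card A = y. LS (w + x) A * wt A * patterns (A \<union> eR 0))"
      unfolding rsum_def WR0 using cardR by (intro sum.cong) auto
    also have "\<dots> = (\<Sum>A | A \<subseteq> {int a..<int h} \<and> card A = y. q powi left_exponent (w + x) * (wt A
      * patterns ({- int x..<0} \<union> A \<union> Y0) * patterns ({0..<int a} \<union> A \<union> {int h..<int (h + b)})))"
    proof (rule sum.cong[OF refl])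
      fix A assume "A \<in> {A. A \<subseteq> {int a..<int h} \<and> card A = y}"
      then have A: "A \<subseteq> {int a..<int h}" "card A = y" by auto
      have "LS (w + x) A = q powi left_exponent (w + x) * patterns (A \<union> eL (int x))"
        using left_sum[of "w + x" A] A WLx cardL[OF A] by simp
      moreover have "A \<union> eL (int x) = {- int x..<0} \<union> A \<union> Y0" "A \<union> eR 0 = {0..<int a} \<union> A \<union> {int h..<int (h + b)}"
        by (auto simp: eLx eR0)
      ultimately show "LS (w + x) A * wt A * patterns (A \<union> eR 0) = q powi left_exponent (w + x) * (wt A
        * patterns ({- int x..<0} \<union> A \<union> Y0) * patterns ({0..<int a} \<union> A \<union> {int h..<int (h + b)}))"
        by (simp only: mult_ac)
    qed
    also have "\<dots> = q powi left_exponent (w + x) * main_sum a b x y z t"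
      by (simp add: main_sum_def sum_distrib_left Y0_def h_def)
    finally show ?thesis .
  qed
  ultimately show ?thesis by (simp add: powi_mult[symmetric] mult.assoc)
qed

end

end

section \<open>Exponents\<close>

text \<open>The factors 2 and 6 in these formulas clear denominators, so that the computation stays
  in the integers.\<close>

lemma sum_interval_sum_below: "6 * (\<Sum>k<m. interval_sum (T - int k) T) = 3 * T * int m * (int m - 1) - int m * (int m - 1) * (int m - 2)"
proof (induction m)
  case (Suc m)
  have "2 * interval_sum (T - int m) T = T * (T + 1) - (T - int m) * (T - int m + 1)" by (rule interval_sum_closed_form) simp
  then show ?case using Suc by (simp add: algebra_simps)
qed simp

lemma sum_interval_sum_above: "6 * (\<Sum>k<m. interval_sum c (c + int k)) = 3 * c * int m * (int m - 1) + (int m - 1) * int m * (int m + 1)"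
proof (induction m)
  case (Suc m)
  have "2 * interval_sum c (c + int m) = (c + int m) * (c + int m + 1) - c * (c + 1)" by (rule interval_sum_closed_form) simp
  then show ?case using Suc by (simp add: algebra_simps)
qed simp

lemma two_choose_two: "2 * int (Suc m choose 2) = int m * (int m + 1)"
proof (induction m)
  case (Suc m)
  have "Suc (Suc m) choose 2 = Suc m + (Suc m choose 2)" by (simp add: numeral_2_eq_2)
  then show ?case using Suc by (simp add: algebra_simps)
qed (simp add: numeral_2_eq_2)

lemma sum_choose_2: "6 * (\<Sum>i<m. int ((m - i) choose 2)) = (int m + 1) * int m * (int m - 1)"
proof (induction m)
  case (Suc m)
  have "2 * int (Suc m choose 2) = (int m + 1) * int m"
    using two_choose_two[of m] by (simp add: mult.commute)
  then show ?case unfolding sum.lessThan_Suc_shift using Suc by (simp add: algebra_simps)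
qed simp

lemma sum_interval_sum_to:
  assumes "l \<le> T"
  shows "6 * (\<Sum>i<m. interval_sum (l - int i) T) = 3 * int m * T * (T + 1) - l * (l + 1) * (l + 2)
    + (l - int m) * (l - int m + 1) * (l - int m + 2)"
proof (induction m)
  case (Suc m)
  have "2 * interval_sum (l - int m) T = T * (T + 1) - (l - int m) * (l - int m + 1)"
    using assms by (intro interval_sum_closed_form) simp
  then show ?case using Suc by (simp add: algebra_simps)
qed simp

lemma sum_times_shifted: "6 * (\<Sum>i<m. int i * (l + int i + 1)) = 3 * l * int m * (int m - 1) + 2 * (int m - 1) * int m * (int m + 1)"
  by (induction m) (simp_all add: algebra_simps)

text \<open>C is the constant of the region, F and G are the corrections for the left and right
  half. With every sum in closed form this is a cubic polynomial identity in the six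
  parameters.\<close>

lemma total_exponent:
  fixes a b x y z t :: nat
  defines "h \<equiv> int a + int y + int z" and "T \<equiv> int a + int b + int y + int z + int t" and "n \<equiv> y + a + b"
  assumes C: "2 * C = (int x + int y) * T * (T + 1) + int b * h * (h + 1)"
    and F: "F = (\<Sum>k<x. interval_sum (- int k) 0) + (\<Sum>k<t. interval_sum (T - int k) T)"
    and G: "G = (\<Sum>m<n. int ((n - m) choose 2)) + (\<Sum>k<a. interval_sum 0 (int k)) + (\<Sum>k<b. interval_sum h (h + int k))"
  shows "C + F + G + main_exponent a b x y z t = int (E_exp a b x y z)"
proof -
  have eqs: "int (a + y + z) = h" "int (a + y + z + b) = h + int b" "int (a + y + z + b + t) = T" "int (a + z) = h - int y"
    by (simp_all add: h_def T_def)
  define f1 where "f1 = (\<Sum>k<x. interval_sum (- int k) 0)"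
  define f2 where "f2 = (\<Sum>k<t. interval_sum (T - int k) T)"
  define g1 where "g1 = (\<Sum>m<n. int ((n - m) choose 2))"
  define g2 where "g2 = (\<Sum>k<a. interval_sum 0 (int k))"
  define g3 where "g3 = (\<Sum>k<b. interval_sum h (h + int k))"
  define m1 where "m1 = (\<Sum>i<y. interval_sum (- int x - int i) (int a))"
  define m2 where "m2 = (\<Sum>i<y. interval_sum (h - int i) T)"
  define m3 where "m3 = (\<Sum>i<y. int ((y - i) choose 2))"
  define m4 where "m4 = (\<Sum>i<x + y + a. int i * (- int x - int y + int i + 1))"
  define m5 where "m5 = (\<Sum>i<y + b + t. int i * (int a + int z + int i + 1))"
  define r1 where "r1 = interval_sum (h - int y) T"
  define r2 where "r2 = interval_sum 0 (int a)"
  define r3 where "r3 = interval_sum (h + int b) T"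
  define r4 where "r4 = interval_sum h (h + int b)"
  have F1: "6 * f1 = - (int x * (int x - 1) * (int x - 2))"
    using sum_interval_sum_below[of 0 x] by (simp add: f1_def)
  have F2: "6 * f2 = 3 * T * int t * (int t - 1) - int t * (int t - 1) * (int t - 2)"
    unfolding f2_def by (rule sum_interval_sum_below)
  have G1: "6 * g1 = (int n + 1) * int n * (int n - 1)"
    unfolding g1_def by (rule sum_choose_2)
  have G2: "6 * g2 = (int a - 1) * int a * (int a + 1)"
    using sum_interval_sum_above[of 0 a] by (simp add: g2_def)
  have G3: "6 * g3 = 3 * h * int b * (int b - 1) + (int b - 1) * int b * (int b + 1)"
    unfolding g3_def by (rule sum_interval_sum_above)
  have M1: "6 * m1 = 3 * int y * int a * (int a + 1) - (- int x) * (- int x + 1) * (- int x + 2)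
    + (- int x - int y) * (- int x - int y + 1) * (- int x - int y + 2)"
    unfolding m1_def by (rule sum_interval_sum_to) simp
  have M2: "6 * m2 = 3 * int y * T * (T + 1) - h * (h + 1) * (h + 2)
    + (h - int y) * (h - int y + 1) * (h - int y + 2)"
    unfolding m2_def by (rule sum_interval_sum_to) (simp add: h_def T_def)
  have M3: "6 * m3 = (int y + 1) * int y * (int y - 1)"
    unfolding m3_def by (rule sum_choose_2)
  note M4 = sum_times_shifted[of "- int x - int y" "x + y + a", folded m4_def]
  note M5 = sum_times_shifted[of "int a + int z" "y + b + t", folded m5_def]
  have S1: "2 * r1 = T * (T + 1) - (h - int y) * (h - int y + 1)"
    unfolding r1_def by (rule interval_sum_closed_form) (simp add: h_def T_def)
  have S2: "2 * r2 = int a * (int a + 1)" using interval_sum_closed_form[of 0 "int a"] by (simp add: r2_def)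
  have S3: "2 * r3 = T * (T + 1) - (h + int b) * (h + int b + 1)"
    unfolding r3_def by (rule interval_sum_closed_form) (simp add: h_def T_def)
  have S4: "2 * r4 = (h + int b) * (h + int b + 1) - h * (h + 1)"
    unfolding r4_def by (rule interval_sum_closed_form) simp
  have e: "main_exponent a b x y z t = m1 + m2 - m3 - m4 - m5
     - (int x + int y + int a) * r1 + int x * r2 + int b * r3 + int x * r4 + int a * r3"
    unfolding main_exponent_def eqs m1_def m2_def m3_def m4_def m5_def r1_def r2_def r3_def r4_def
    by (simp add: sum.distrib sum_subtractf)
  have "6 * (C + F + G + main_exponent a b x y z t) = 3 * (2 * C) + 6 * f1 + 6 * f2 + 6 * g1 + 6 * g2 + 6 * g3
      + 6 * m1 + 6 * m2 - 6 * m3 - 6 * m4 - 6 * m5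
      - 3 * (int x + int y + int a) * (2 * r1) + 3 * int x * (2 * r2)
      + 3 * int b * (2 * r3) + 3 * int x * (2 * r4) + 3 * int a * (2 * r3)"
    unfolding e F G f1_def[symmetric] f2_def[symmetric] g1_def[symmetric] g2_def[symmetric] g3_def[symmetric]
    by (simp add: algebra_simps)
  also have "\<dots> = 6 * int (E_exp a b x y z)"
  proof -
    have "6 * int (E_exp a b x y z) = 3 * (int y + int b) * (2 * int (Suc z choose 2)) + 3 * int x * (2 * int (Suc (a + z) choose 2))
      + 6 * int b * (int x + int y) * h + 3 * (int x + int y) * (2 * int (Suc b choose 2))"
      by (simp add: E_exp_def h_def algebra_simps)
    then show ?thesis
      unfolding C F1 F2 G1 G2 G3 M1 M2 M3 M4 M5 S1 S2 S3 S4 two_choose_two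
      by (simp add: h_def T_def n_def algebra_simps)
  qed
  finally show ?thesis by simp
qed

section \<open>Passage to arbitrary fields\<close>

lemma sum_product_interval:
  fixes l u :: int
  assumes "l \<le> u"
  shows "3 * (\<Sum>j\<in>{l..<u}. j * (j + 1)) = (u - 1) * u * (u + 1) - (l - 1) * l * (l + 1)"
    and "3 * (\<Sum>j\<in>{l..<u}. (j + 1) * (j + 2)) = u * (u + 1) * (u + 2) - l * (l + 1) * (l + 2)"
proof -
  have ins: "{l..<u + 1} = insert u {l..<u}" if "l \<le> u" for u using that by auto
  show "3 * (\<Sum>j\<in>{l..<u}. j * (j + 1)) = (u - 1) * u * (u + 1) - (l - 1) * l * (l + 1)"
    using assms by (induction u rule: int_ge_induct) (simp_all add: ins algebra_simps)
  show "3 * (\<Sum>j\<in>{l..<u}. (j + 1) * (j + 2)) = u * (u + 1) * (u + 2) - l * (l + 1) * (l + 2)"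
    using assms by (induction u rule: int_ge_induct) (simp_all add: ins algebra_simps)
qed

lemma interval_sum_empty: "u \<le> l \<Longrightarrow> interval_sum l u = 0"
  by (simp add: interval_sum_def)

lemma sum_lessThan_add: "(\<Sum>i<m + k. f i) = (\<Sum>i<m. f i) + (\<Sum>i<k. f (m + i))" for k m :: nat
  by (induction k) (simp_all add: ac_simps)

section \<open>The constants for the given region\<close>

context q_params
begin

text \<open>The charges telescope along a strip. A slanted end lies one row lower for down-triangles
  and contributes equally to both sums; a horizontal end at height u leaves u (u + 1), which is 0 on
  the S side. The N side bounds the strips with c < x - t.\<close>

lemma strip_const_left:
  assumes "- int w \<le> c" "c < int x"
  shows "(\<Sum>j\<in>QD c. (j + 1) * (j + 2)) - (\<Sum>j\<in>QU c. j * (j + 1)) = (if c < int x - int t then int tp * (int tp + 1) else 0)"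
proof -
  have U: "QU c = {max 0 (- c)..<min (int tp) (int mx - c)}"
    unfolding QU_left[OF assms] by (auto simp: WL_def eL_def)
  have D: "QD c = {max 0 (- c - 1)..<min (int tp) (int mx - c - 1)}"
    unfolding QD_left[OF assms] by (auto simp: WL_def eL_def)
  have le: "max 0 (- c) \<le> min (int tp) (int mx - c)" "max 0 (- c - 1) \<le> min (int tp) (int mx - c - 1)"
    using assms by (auto simp: tp_def mx_def w_def)
  have t: "min (int tp) (int mx - c) = int tp \<and> min (int tp) (int mx - c - 1) = int tp" if "c < int x - int t"
    using that by (auto simp: tp_def mx_def)
  have nt: "min (int tp) (int mx - c) = int mx - c \<and> min (int tp) (int mx - c - 1) = int mx - c - 1" if "\<not> c < int x - int t"
    using that by (auto simp: tp_def mx_def)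
  have cc: "(max 0 (- c) = - c \<and> max 0 (- c - 1) = - c - 1) \<or> (max 0 (- c) = 0 \<and> max 0 (- c - 1) = 0)"
    by auto
  have "3 * ((\<Sum>j\<in>QD c. (j + 1) * (j + 2)) - (\<Sum>j\<in>QU c. j * (j + 1)))
    = 3 * (if c < int x - int t then int tp * (int tp + 1) else 0)"
    unfolding right_diff_distrib U D sum_product_interval(1)[OF le(1)] sum_product_interval(2)[OF le(2)]
    using cc t nt by (cases "c < int x - int t") (auto simp: algebra_simps)
  then show ?thesis by simp
qed

text \<open>The same telescoping; the horizontal upper end is now the base of the removed triangle
  of side b, which spans b strips.\<close>

lemma strip_const_right:
  assumes "m < n"
  shows "(\<Sum>j\<in>QD (int (x + m)). (j + 1) * (j + 2)) - (\<Sum>j\<in>QU (int (x + m)). j * (j + 1)) = (if m < b then int h * (int h + 1) else 0)"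
proof -
  define c where "c = int a - int m"
  have U: "QU (int (x + m)) = {max 0 c..<min (int h) (int (h + b) - int m)}"
    unfolding QU_right[OF assms] by (auto simp: WR_def eR_def c_def)
  have D: "QD (int (x + m)) = {max 0 (c - 1)..<min (int h) (int (h + b) - int m - 1)}"
    unfolding QD_right[OF assms] by (auto simp: WR_def eR_def c_def)
  have le: "max 0 c \<le> min (int h) (int (h + b) - int m)" "max 0 (c - 1) \<le> min (int h) (int (h + b) - int m - 1)"
    using assms by (auto simp: h_def n_def c_def)
  have t: "min (int h) (int (h + b) - int m) = int h \<and> min (int h) (int (h + b) - int m - 1) = int h" if "m < b"
    using that by auto
  have nt: "min (int h) (int (h + b) - int m) = int (h + b) - int m \<and> min (int h) (int (h + b) - int m - 1) = int (h + b) - int m - 1" if "\<not> m < b"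
    using that by auto
  have cc: "(max 0 c = c \<and> max 0 (c - 1) = c - 1) \<or> (max 0 c = 0 \<and> max 0 (c - 1) = 0)"
    by auto
  have "3 * ((\<Sum>j\<in>QD (int (x + m)). (j + 1) * (j + 2)) - (\<Sum>j\<in>QU (int (x + m)). j * (j + 1)))
    = 3 * (if m < b then int h * (int h + 1) else 0)"
    unfolding right_diff_distrib U D sum_product_interval(1)[OF le(1)] sum_product_interval(2)[OF le(2)]
    using cc t nt by (cases "m < b") (auto simp: algebra_simps)
  then show ?thesis by simp
qed

lemma region_const:
  "(\<Sum>c\<in>{- int w..<- int w + int (w + x + n)}. (\<Sum>j\<in>QD c. (j + 1) * (j + 2)) - (\<Sum>j\<in>QU c. j * (j + 1)))
    = (int x + int y) * (int tp * (int tp + 1)) + int b * (int h * (int h + 1))" (is "(\<Sum>c\<in>_. ?f c) = _")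
proof -
  have "{- int w..<- int w + int (w + x + n)} = {- int w..<int x} \<union> {int x..<int (x + n)}" by auto
  then have "(\<Sum>c\<in>{- int w..<- int w + int (w + x + n)}. ?f c) = (\<Sum>c\<in>{- int w..<int x}. ?f c) + (\<Sum>c\<in>{int x..<int (x + n)}. ?f c)"
    by (simp add: sum.union_disjoint)
  also have "(\<Sum>c\<in>{- int w..<int x}. ?f c) = (\<Sum>c\<in>{- int w..<int x}. if c < int x - int t then int tp * (int tp + 1) else 0)"
    by (intro sum.cong refl strip_const_left) auto
  also have "\<dots> = (int x + int y) * (int tp * (int tp + 1))"
  proof -
    have "{- int w..<int x} \<inter> {c. c < int x - int t} = {- int w..<int x - int t}" by auto
    then show ?thesis by (simp add: sum.If_cases w_def)
  qed
  also have "(\<Sum>c\<in>{int x..<int (x + n)}. ?f c) = (\<Sum>m<n. ?f (int (x + m)))"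
    by (rule sum.reindex_bij_witness[of _ "\<lambda>m. int (x + m)" "\<lambda>c. nat (c - int x)"]) auto
  also have "\<dots> = (\<Sum>m<n. if m < b then int h * (int h + 1) else 0)"
    by (intro sum.cong refl strip_const_right) auto
  also have "\<dots> = int b * (int h * (int h + 1))"
  proof -
    have "{..<n} \<inter> {m. m < b} = {..<b}" by (auto simp: n_def)
    then show ?thesis by (simp add: sum.If_cases)
  qed
  finally show ?thesis .
qed

lemma left_exponent_eq: "left_exponent (w + x) = (\<Sum>k<x. interval_sum (- int k) 0) + (\<Sum>k<t. interval_sum (int tp - int k) (int tp))"
proof -
  have "left_exponent (w + x) = (\<Sum>i<w + x. interval_sum (int w - int i) 0 + interval_sum (int mx + int w - int i) (int tp))"
    unfolding left_exponent_def
  proof (rule sum.cong[OF refl])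
    fix i assume i: "i \<in> {..<w + x}"
    have "eL (- int w + int i) = {int w - int i..<0} \<union> {int mx + int w - int i..<int tp}"
      unfolding eL_def by (simp add: algebra_simps)
    moreover have "{int w - int i..<0} \<inter> {int mx + int w - int i..<int tp} = {}" using i by (auto simp: mx_def)
    ultimately show "(\<Sum>j\<in>eL (- int w + int i). j + 1) = interval_sum (int w - int i) 0 + interval_sum (int mx + int w - int i) (int tp)"
      by (simp only: interval_sum_def sum.union_disjoint finite_atLeastLessThan_int)
  qed
  also have "\<dots> = (\<Sum>i<w + x. interval_sum (int w - int i) 0) + (\<Sum>i<(x + y) + t. interval_sum (int mx + int w - int i) (int tp))"
    by (simp add: sum.distrib w_def add_ac)
  also have "(\<Sum>i<w + x. interval_sum (int w - int i) 0) = (\<Sum>k<x. interval_sum (- int k) 0)"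
    unfolding sum_lessThan_add by (simp add: interval_sum_empty)
  also have "(\<Sum>i<(x + y) + t. interval_sum (int mx + int w - int i) (int tp)) = (\<Sum>k<t. interval_sum (int tp - int k) (int tp))"
  proof -
    have "(\<Sum>i<x + y. interval_sum (int mx + int w - int i) (int tp)) = 0"
      by (rule sum.neutral) (auto simp: mx_def w_def tp_def intro!: interval_sum_empty)
    moreover have "int mx + int w - int (x + y + k) = int tp - int k" for k
      by (simp add: mx_def w_def tp_def)
    ultimately show ?thesis unfolding sum_lessThan_add[of _ "x + y" t] by (simp only: add_0)
  qed
  finally show ?thesis .
qed

lemma right_exponent_eq: "right_exponent n = (\<Sum>m<n. int ((n - m) choose 2)) + (\<Sum>k<a. interval_sum 0 (int k)) + (\<Sum>k<b. interval_sum (int h) (int h + int k))"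
proof -
  have "(\<Sum>j\<in>eR (Suc m). j + 1) = interval_sum 0 (int a - int (Suc m)) + interval_sum (int h) (int h + (int b - int (Suc m)))" for m
  proof -
    have "eR (Suc m) = {0..<int a - int (Suc m)} \<union> {int h..<int h + (int b - int (Suc m))}"
      unfolding eR_def by (simp add: algebra_simps)
    moreover have "{0..<int a - int (Suc m)} \<inter> {int h..<int h + (int b - int (Suc m))} = {}" by (auto simp: h_def)
    ultimately show ?thesis by (simp only: interval_sum_def sum.union_disjoint finite_atLeastLessThan_int)
  qed
  then have "right_exponent n = (\<Sum>m<n. int ((n - m) choose 2)) + (\<Sum>m<n. interval_sum 0 (int a - int (Suc m)))
    + (\<Sum>m<n. interval_sum (int h) (int h + (int b - int (Suc m))))"
    unfolding right_exponent_def by (simp only: sum.distrib add.assoc)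
  also have "(\<Sum>m<n. interval_sum 0 (int a - int (Suc m))) = (\<Sum>k<a. interval_sum 0 (int k))"
  proof -
    have n: "n = a + (y + b)" by (simp add: n_def)
    have "(\<Sum>m<n. interval_sum 0 (int a - int (Suc m))) = (\<Sum>m<a. interval_sum 0 (int a - int (Suc m)))"
      unfolding n sum_lessThan_add by (simp add: interval_sum_empty)
    also have "\<dots> = (\<Sum>m<a. interval_sum 0 (int (a - Suc m)))" by (intro sum.cong refl) (simp add: of_nat_diff)
    also have "\<dots> = (\<Sum>k<a. interval_sum 0 (int k))" by (rule sum.nat_diff_reindex)
    finally show ?thesis .
  qed
  also have "(\<Sum>m<n. interval_sum (int h) (int h + (int b - int (Suc m)))) = (\<Sum>k<b. interval_sum (int h) (int h + int k))"
  proof -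
    have n: "n = b + (y + a)" by (simp add: n_def)
    have "(\<Sum>m<n. interval_sum (int h) (int h + (int b - int (Suc m)))) = (\<Sum>m<b. interval_sum (int h) (int h + (int b - int (Suc m))))"
      unfolding n sum_lessThan_add by (simp add: interval_sum_empty)
    also have "\<dots> = (\<Sum>m<b. interval_sum (int h) (int h + int (b - Suc m)))" by (intro sum.cong refl) (simp add: of_nat_diff)
    also have "\<dots> = (\<Sum>k<b. interval_sum (int h) (int h + int k))" by (rule sum.nat_diff_reindex)
    finally show ?thesis .
  qed
  finally show ?thesis .
qed

lemma M2_generic:
  fixes q :: "'a::field"
  assumes "generic_q q"
  shows "M2 q (Q_region a b x y z t) = q ^ E_exp a b x y z * P_prod q a b x y z t"
proof -
  interpret generic_q q by fact
  define C where "C = (int x + int y) * int (Suc tp choose 2) + int b * int (Suc h choose 2)"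
  have C2: "2 * C = (int x + int y) * (int tp * (int tp + 1)) + int b * (int h * (int h + 1))"
    unfolding C_def two_choose_two[symmetric] by (simp add: algebra_simps)
  have "M2 q (Q_region a b x y z t) = q powi C * chain_sum rel wt (w + x + n) {}"
    unfolding Q_region_eq[symmetric] by (rule M2_eq_chain_sum[OF assms]) (simp only: C2 region_const)
  also have "\<dots> = q powi C * (q powi (right_exponent n + left_exponent (w + x)) * (q powi main_exponent a b x y z t * P_prod q a b x y z t))"
    by (simp only: chain_sum_total[OF assms] main_sum_eq)
  also have "\<dots> = q powi (C + left_exponent (w + x) + right_exponent n + main_exponent a b x y z t) * P_prod q a b x y z t"
    by (simp only: powi_mult mult.assoc[symmetric]) (simp only: add_ac)
  also have "C + left_exponent (w + x) + right_exponent n + main_exponent a b x y z t = int (E_exp a b x y z)"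
  proof (rule total_exponent)
    have h: "int h = int a + int y + int z" and tp: "int tp = int a + int b + int y + int z + int t" and n: "n = y + a + b"
      by (simp_all add: h_def tp_def n_def)
    show "2 * C = (int x + int y) * (int a + int b + int y + int z + int t) * (int a + int b + int y + int z + int t + 1)
      + int b * (int a + int y + int z) * (int a + int y + int z + 1)"
      unfolding C2 h tp by (simp only: mult.assoc)
    show "left_exponent (w + x) = (\<Sum>k<x. interval_sum (- int k) 0) + (\<Sum>k<t. interval_sum (int a + int b + int y + int z + int t - int k) (int a + int b + int y + int z + int t))"
      unfolding left_exponent_eq tp ..
    show "right_exponent n = (\<Sum>m<y + a + b. int ((y + a + b - m) choose 2)) + (\<Sum>k<a. interval_sum 0 (int k))
      + (\<Sum>k<b. interval_sum (int a + int y + int z) (int a + int y + int z + int k))"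
      using right_exponent_eq unfolding h n .
  qed
  finally show ?thesis by simp
qed

end

section \<open>Transfer by integer polynomials and comparison of lowest terms\<close>

definition eval_int_poly :: "'a::field \<Rightarrow> int poly \<Rightarrow> 'a" where
  "eval_int_poly q p = poly (map_poly of_int p) q"

lemma eval_int_poly_mult: "eval_int_poly q (p * r) = eval_int_poly q p * eval_int_poly q r"
  by (simp add: eval_int_poly_def of_int_poly_hom.hom_mult)

lemma eval_int_poly_sum: "eval_int_poly q (sum f A) = (\<Sum>i\<in>A. eval_int_poly q (f i))"
  by (simp add: eval_int_poly_def of_int_poly_hom.hom_sum poly_sum)

lemma eval_int_poly_prod: "eval_int_poly q (prod f A) = (\<Prod>i\<in>A. eval_int_poly q (f i))"
  by (simp add: eval_int_poly_def of_int_poly_hom.hom_prod poly_prod)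

lemma eval_int_poly_monom: "eval_int_poly q (monom 1 k) = q ^ k"
  by (simp add: eval_int_poly_def map_poly_monom poly_monom)

text \<open>Infinitely many points suffice, and real numbers above 1 satisfy the assumptions of
  \<open>generic_q\<close>.\<close>

lemma int_poly_eqI:
  assumes "\<And>q::real. q > 1 \<Longrightarrow> eval_int_poly q p = eval_int_poly q r"
  shows "p = r"
proof -
  have "poly (map_poly of_int p - map_poly of_int r) q = 0" if "q > (1::real)" for q
    using assms[OF that] by (simp add: eval_int_poly_def)
  then have "{1<..} \<subseteq> {q::real. poly (map_poly of_int p - map_poly of_int r) q = 0}" by auto
  then have "infinite {q::real. poly (map_poly of_int p - map_poly of_int r) q = 0}"
    using infinite_Ioi finite_subset by blast
  then have "map_poly of_int p - map_poly of_int r = (0 :: real poly)"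
    using poly_roots_finite by blast
  then have "map_poly (of_int :: int \<Rightarrow> real) p = map_poly of_int r" by simp
  then have "coeff (map_poly (of_int :: int \<Rightarrow> real) p) i = coeff (map_poly of_int r) i" for i by simp
  then show ?thesis by (intro poly_eqI) (simp add: coeff_map_poly)
qed

definition q_H_poly :: "nat \<Rightarrow> int poly" where
  "q_H_poly m = (\<Prod>k<m. \<Prod>i=1..k. \<Sum>j<i. monom 1 j)"

lemma eval_int_poly_q_H_poly: "eval_int_poly q (q_H_poly m) = q_H q m"
  by (simp add: q_H_poly_def eval_int_poly_sum eval_int_poly_prod eval_int_poly_monom q_H_def q_fact_def q_int_def)

text \<open>Neither numerator nor denominator of the product formula is divisible by q, so the
  lowest power of q in \<open>M2\<close> can be read off.\<close>

lemma poly_q_H_poly_0: "poly (q_H_poly m) 0 = 1"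
proof -
  have "poly (\<Sum>j<i. monom (1::int) j) 0 = 1" if "i \<in> {1..k}" for i k :: nat
    using that unfolding poly_sum poly_monom by (subst sum.remove[of _ 0]) (auto simp: power_0_left)
  then show ?thesis unfolding q_H_poly_def poly_prod by (intro prod.neutral ballI)
qed

definition num_poly :: "nat \<Rightarrow> nat \<Rightarrow> nat \<Rightarrow> nat \<Rightarrow> nat \<Rightarrow> nat \<Rightarrow> int poly" where
  "num_poly a b x y z t = q_H_poly x * q_H_poly y * q_H_poly z * q_H_poly t * q_H_poly a * q_H_poly b
     * (q_H_poly (a + b + x + 2 * y + z + t) * q_H_poly (a + b + x + y + t))
     * (q_H_poly (a + x + y) * q_H_poly (b + y + t) * (q_H_poly (a + b + y + z) * q_H_poly (a + b + y + z)))"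

definition den_poly :: "nat \<Rightarrow> nat \<Rightarrow> nat \<Rightarrow> nat \<Rightarrow> nat \<Rightarrow> nat \<Rightarrow> int poly" where
  "den_poly a b x y z t = q_H_poly (a + x) * q_H_poly (b + t) * q_H_poly (a + b + y)
     * (q_H_poly (a + b + y + z + t) * q_H_poly (a + b + x + 2 * y + t) * q_H_poly (a + b + x + y + z))
     * (q_H_poly (x + y + t) * q_H_poly (a + y + z) * q_H_poly (b + y + z))"

lemma P_prod_eval: "P_prod q a b x y z t = eval_int_poly q (num_poly a b x y z t) / eval_int_poly q (den_poly a b x y z t)"
  by (simp add: P_prod_def num_poly_def den_poly_def eval_int_poly_mult eval_int_poly_q_H_poly power2_eq_square)

theorem theorem3p1:
  fixes a b x y z t :: nat and q :: "'a::field"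
  assumes "\<And>n. 0 < n \<Longrightarrow> q_int q n \<noteq> 0"
  shows "q ^ E_exp a b x y z *
           (\<Sum>T\<in>tilings (Q_region a b x y z t). q ^ volume (Q_region a b x y z t) T)
         = M2 q (Q_region a b x y z t)
       \<and> M2 q (Q_region a b x y z t) = q ^ E_exp a b x y z * P_prod q a b x y z t"
proof -
  interpret q_params a b x y z t .
  define R where "R = Q_region a b x y z t"
  define E where "E = E_exp a b x y z"
  define N where "N = num_poly a b x y z t"
  define D where "D = den_poly a b x y z t"
  have M2_kappa': "M2 r R = (\<Sum>T\<in>tilings R. r ^ kappa T)" for r :: "'b::field"
    using M2_kappa unfolding Q_region_eq R_def .
  have fin: "finite (tilings R)" using finite_tilings unfolding Q_region_eq R_def .
  have N0: "poly N 0 = 1" and D0: "poly D 0 = 1"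
    by (simp_all add: N_def D_def num_poly_def den_poly_def poly_q_H_poly_0)
  have D_nz: "eval_int_poly r D \<noteq> 0" if "\<And>n. 0 < n \<Longrightarrow> q_int r n \<noteq> 0" for r :: "'b::field"
  proof -
    have "q_H r m \<noteq> 0" for m using that by (auto simp: q_H_def q_fact_def)
    then show ?thesis by (simp add: D_def den_poly_def eval_int_poly_mult eval_int_poly_q_H_poly)
  qed
  \<comment> \<open>Cleared of denominators, the generic identity involves only integer polynomials
    and can be evaluated in any field.\<close>
  have key: "(\<Sum>T\<in>tilings R. monom 1 (kappa T)) * D = monom 1 E * N"
  proof (rule int_poly_eqI)
    fix r :: real assume r: "r > 1"
    interpret generic_q r
    proof
      show "r \<noteq> 0" using r by simp
      show "r ^ k \<noteq> 1" if "k > 0" for k using one_less_power[OF r that] by simp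
    qed
    have "eval_int_poly r D \<noteq> 0" using D_nz q_int_nonzero by blast
    moreover have "M2 r R = r ^ E * (eval_int_poly r N / eval_int_poly r D)"
      using M2_generic[OF generic_q_axioms] by (simp add: R_def E_def N_def D_def P_prod_eval)
    ultimately show "eval_int_poly r ((\<Sum>T\<in>tilings R. monom 1 (kappa T)) * D) = eval_int_poly r (monom 1 E * N)"
      by (simp add: eval_int_poly_mult eval_int_poly_sum eval_int_poly_monom M2_kappa')
  qed
  have second: "M2 q R = q ^ E * P_prod q a b x y z t"
  proof -
    have "M2 q R * eval_int_poly q D = q ^ E * eval_int_poly q N"
      using arg_cong[OF key, of "eval_int_poly q"] by (simp add: eval_int_poly_mult eval_int_poly_sum eval_int_poly_monom M2_kappa')
    then show ?thesis using D_nz[OF assms] by (simp add: P_prod_eval N_def D_def field_simps)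
  qed
  \<comment> \<open>Existence of a tiling follows from the identity: without tilings its left side
    would be 0, but N has constant term 1.\<close>
  have "tilings R \<noteq> {}"
  proof
    assume "tilings R = {}"
    then have "monom 1 E * N = 0" using key by simp
    then show False using N0 by auto
  qed
  then obtain T0 where T0: "T0 \<in> tilings R" and vol: "\<And>T. T \<in> tilings R \<Longrightarrow> kappa T = kappa T0 + volume R T"
    using volume_eq unfolding Q_region_eq R_def by blast
  define V where "V = (\<Sum>T\<in>tilings R. monom (1::int) (volume R T))"
  have V: "(\<Sum>T\<in>tilings R. monom 1 (kappa T)) = monom 1 (kappa T0) * V"
    unfolding V_def sum_distrib_left by (rule sum.cong[OF refl]) (simp add: vol mult_monom)
  \<comment> \<open>T0 has volume 0, so its term contributes 1 to the constant term, and no term is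
    negative.\<close>
  have V0: "poly V 0 > 0"
  proof -
    have "volume R T0 = 0" using vol[OF T0] by simp
    then have "(1::int) \<le> 0 ^ volume R T0" by simp
    also have "\<dots> \<le> (\<Sum>T\<in>tilings R. 0 ^ volume R T)"
      using fin T0 by (intro member_le_sum) (auto simp: power_0_left)
    finally show ?thesis by (simp add: V_def poly_sum poly_monom)
  qed
  \<comment> \<open>V, D and N have nonzero constant terms; after cancelling the lower power of q, a
    leftover factor q would force one of these to vanish.\<close>
  have E: "kappa T0 = E"
  proof (rule ccontr)
    assume "kappa T0 \<noteq> E"
    then consider k where "E = kappa T0 + Suc k" | k where "kappa T0 = E + Suc k"
      by (metis less_imp_Suc_add linorder_neqE_nat add_Suc_right)
    then show False
    proof cases
      case 1
      have "monom 1 (kappa T0) * (V * D) = monom 1 (kappa T0) * (monom 1 (Suc k) * N)"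
        using key unfolding V 1 by (simp add: mult_monom mult.assoc[symmetric])
      then have "V * D = monom 1 (Suc k) * N" by (simp add: monom_eq_0_iff)
      then have "poly V 0 * poly D 0 = 0" by (metis poly_mult poly_monom mult_zero_left mult_zero_right power_0_Suc)
      then show False using V0 D0 by simp
    next
      case 2
      have "monom 1 E * (monom 1 (Suc k) * V * D) = monom 1 E * N"
        using key unfolding V 2 by (simp add: mult_monom mult.assoc[symmetric])
      then have "monom 1 (Suc k) * V * D = N" by (simp add: monom_eq_0_iff)
      then have "poly N 0 = 0" by (metis poly_mult poly_monom mult_zero_left mult_zero_right power_0_Suc)
      then show False using N0 by simp
    qed
  qed
  have "q ^ E * (\<Sum>T\<in>tilings R. q ^ volume R T) = M2 q R"
    unfolding M2_kappa' sum_distrib_left by (rule sum.cong[OF refl]) (simp add: vol E power_add)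
  then show ?thesis using second unfolding R_def E_def by blast
qed

end
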